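(* Let $M \geq 3$ and $N \geq M$ be integers, $d = 1/M$, let $f \in W^{2,2}(0,1)$, let $x_1,\dots,x_N \in [0,1]$ be given observation points with indicator function $\rho_N$, and let $y_i = f(x_i) + \eta_i$, $1 \le i \le N$, where $\eta_1,\dots,\eta_N$ are random variables with $\mathbb{E}[\eta_i] = 0$ and $\mathbb{E}[\eta_i\eta_j] = \sigma^2\delta_{ij}$. Suppose $$\sup_{x \in [0,1]} \rho_N(x) \leq \beta_N.$$ Let $K_\ast = 32$, let $p, q$ be nonnegative integers with $0 \leq p < q \leq M$ and $q - p \geq 2\sqrt{K_\ast}$, and put $I' = (pd, qd)$. Choose the regularization parameter $\alpha_N = M\sigma^2/N + d^4$, and suppose $$\inf_{x \in I'} \rho_N(x) \geq \gamma_N > 0.$$ Let $f_N$ be the minimizer of $J(\cdot\,;\alpha_N, \bm{y}_N)$ over $V_M$, where $\bm{y}_N=(y_1,\dots,y_N)^\top$, and let $e_N = f_N - f$. Then for arbitrary $\delta \in (0,1)$, the estimates $$\Vert e_N \Vert_{L^2(I')} \leq C_1 \Big( \frac{M \sigma^2}{N} \Big)^{\frac12} + C_2 M^{-2}, \qquad \Vert e_N' \Vert_{L^2(I')} \leq C_3 \Big( \frac{M \sigma^2}{N} \Big)^{\frac14} + C_4 M^{-1}$$ hold with a probability of at least $1-\delta$, where the constants $C_1, C_2, C_3$ and $C_4$ are independent of $M$ and $N$. Denoting by $K_\sigma$ the Sobolev constant $K(\epsilon_0, |I'|)$ with $\epsilon_0 = \max\{\sqrt{\sigma}, (q-p)d\}$,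 the constants can be written as $$C_1 = 2 \gamma_N^{-\frac12} \Vert f'' \Vert_{L^2(0,1)} + \frac{4}{\sqrt{\delta \gamma_N}},$$ $$C_2 = \Vert f'' \Vert_{L^2(0,1)} \sqrt{\frac{9\beta_N + 8}{2\gamma_N} + 36 K_\ast^2 \beta_N + 64 K_\ast^2} + 4 K_\ast \delta^{-\frac12},$$ $$C_3 = K_\sigma^{\frac12} \Big( \Vert f'' \Vert_{L^2(0,1)} \sqrt{4\gamma_N^{-1} + \tfrac94 \beta_N + 4} + \delta^{-\frac12}\sqrt{16 \gamma_N^{-1} + 1} \Big),$$ $$C_4 = K_\sigma^{\frac12} \Big( \Vert f'' \Vert_{L^2(0,1)} \sqrt{\frac{9\beta_N + 8}{8 K_\ast \gamma_N} + 18 K_\ast \beta_N + 32 K_\ast} + 2\sqrt2\, \delta^{-\frac12} K_\ast^{\frac12} \Big).$$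
   Context: Functions in $W^{2,2}(0,1)$ are identified with their $C^1[0,1]$ representatives. $\sigma \ge 0$ denotes the standard deviation of the noise (its variance is $\sigma^2$) and $\delta_{ij}$ is the Kronecker symbol. Spline space: for a positive integer $M$ and $d = 1/M$, $V_M$ is the $(M+3)$-dimensional space of cubic splines on $[0,1]$ with knots $p_j = jd$, $0 \le j \le M$, i.e. of functions in $C^2[0,1]$ that are polynomials of degree at most $3$ on each $[(j-1)d, jd]$. Tikhonov functional: for $g \in W^{2,2}(0,1)$, $\alpha>0$ and $\bm{z}=(z_1,\dots,z_N)^\top\in\mathbb{R}^N$, $$J(g;\alpha,\bm{z}) = \frac1N \sum_{i=1}^N (g(x_i) - z_i)^2 + \alpha \Vert g'' \Vert_{L^2(0,1)}^2 .$$ It has a unique minimizer over $V_M$ whenever $N \ge 2$ and the $x_i$ are not all identical. Indicator function: let $I_1 = [0,d]$ and $I_j = ((j-1)d, jd]$ for $2 \le j \le M$; let $N_j$ be the number of observation points $x_i$ (counted by index $i$) that belong to $I_j$. Then $\rho_N(x) = N_j/(Nd)$ for $x \in I_j$, and $\rho_N(x) = 0$ for $x \notin [0,1]$. Sobolev constant: for a bounded interval $I_s$ and $\epsilon_0>0$, a Sobolev constant $K(\epsilon_0,|I_s|)$ is a constant $K$ such that for all $u \in W^{2,2}(I_s)$ and all $\epsilon \in (0,\epsilon_0]$, $\Vert u' \Vert_{L^2(I_s)}^2 \le K\big(\epsilon^{-2}\Vert u \Vert_{L^2(I_s)}^2 + \epsilon^2 \Vert u'' \Vert_{L^2(I_s)}^2\big)$.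 If $\epsilon_0 = |I_s|$, the constant $K_\ast = 32$ may be used. *)

theory Defs
  imports "HOL-Probability.Probability" "HOL-Computational_Algebra.Polynomial"
begin

definition L2_on :: "real set \<Rightarrow> (real \<Rightarrow> real) \<Rightarrow> bool" where
  "L2_on S u \<longleftrightarrow> u \<in> borel_measurable (lebesgue_on S) \<and> integrable (lebesgue_on S) (\<lambda>t. (u t)\<^sup>2)"

definition L2_norm_on :: "real set \<Rightarrow> (real \<Rightarrow> real) \<Rightarrow> real" where
  "L2_norm_on S u = sqrt (\<integral>t. (u t)\<^sup>2 \<partial>lebesgue_on S)"

definition test_function :: "real \<Rightarrow> real \<Rightarrow> (real \<Rightarrow> real) \<Rightarrow> bool" where
  "test_function a b \<phi> \<longleftrightarrow>
     (\<forall>k t. (deriv ^^ k) \<phi> field_differentiable (at t)) \<and>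
     (\<exists>c e. a < c \<and> c < e \<and> e < b \<and> (\<forall>t. t \<notin> {c..e} \<longrightarrow> \<phi> t = 0))"

definition weak_deriv :: "nat \<Rightarrow> real \<Rightarrow> real \<Rightarrow> (real \<Rightarrow> real) \<Rightarrow> (real \<Rightarrow> real) \<Rightarrow> bool" where
  "weak_deriv k a b u v \<longleftrightarrow>
     (\<forall>\<phi>. test_function a b \<phi> \<longrightarrow>
        (\<integral>t. u t * (deriv ^^ k) \<phi> t \<partial>lebesgue_on {a<..<b}) =
        (-1) ^ k * (\<integral>t. v t * \<phi> t \<partial>lebesgue_on {a<..<b}))"

definition C1_on :: "real \<Rightarrow> real \<Rightarrow> (real \<Rightarrow> real) \<Rightarrow> bool" where
  "C1_on a b u \<longleftrightarrow>
     (\<exists>u'. (\<forall>t\<in>{a..b}. (u has_real_derivative u' t) (at t within {a..b})) \<and>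
           continuous_on {a..b} u')"

text \<open>Elements of \<open>W\<^sup>2\<^sup>,\<^sup>2(a,b)\<close> are identified with their \<open>C\<^sup>1[a,b]\<close> representatives, so that
  point values and the classical first derivative make sense. A member is a total function whose
  values outside \<open>[a,b]\<close> are arbitrary and irrelevant.\<close>

definition W22 :: "real \<Rightarrow> real \<Rightarrow> (real \<Rightarrow> real) set" where
  "W22 a b = {u. C1_on a b u \<and> (\<forall>k\<le>2. \<exists>v. L2_on {a<..<b} v \<and> weak_deriv k a b u v)}"

text \<open>A representative of the second weak derivative; it is determined only up to null sets,
  hence used only inside \<open>L\<^sup>2\<close> norms.\<close>

definition second_weak_deriv :: "real \<Rightarrow> real \<Rightarrow> (real \<Rightarrow> real) \<Rightarrow> real \<Rightarrow> real" where
  "second_weak_deriv a b u = (SOME v. L2_on {a<..<b} v \<and> weak_deriv 2 a b u v)"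

definition sobolev_constant :: "real \<Rightarrow> real \<Rightarrow> real \<Rightarrow> real \<Rightarrow> bool" where
  "sobolev_constant \<epsilon>0 a b K \<longleftrightarrow>
     (\<forall>u\<in>W22 a b. \<forall>\<epsilon>\<in>{0<..\<epsilon>0}.
        (L2_norm_on {a<..<b} (deriv u))\<^sup>2 \<le>
          K * ((L2_norm_on {a<..<b} u)\<^sup>2 / \<epsilon>\<^sup>2 +
               \<epsilon>\<^sup>2 * (L2_norm_on {a<..<b} (second_weak_deriv a b u))\<^sup>2))"

definition spline_space :: "nat \<Rightarrow> (real \<Rightarrow> real) set" where
  "spline_space M = {g.
     (\<exists>g' g''. (\<forall>t\<in>{0..1}. (g has_real_derivative g' t) (at t within {0..1})) \<and>
               (\<forall>t\<in>{0..1}. (g' has_real_derivative g'' t) (at t within {0..1})) \<and>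
               continuous_on {0..1} g'') \<and>
     (\<forall>j\<in>{1..M}. \<exists>P :: real poly. degree P \<le> 3 \<and>
        (\<forall>t\<in>{(real j - 1) / real M .. real j / real M}. g t = poly P t))}"

definition tikhonov ::
    "nat \<Rightarrow> (nat \<Rightarrow> real) \<Rightarrow> real \<Rightarrow> (nat \<Rightarrow> real) \<Rightarrow> (real \<Rightarrow> real) \<Rightarrow> real" where
  "tikhonov N x \<alpha> z g =
     1 / real N * (\<Sum>i=1..N. (g (x i) - z i)\<^sup>2) +
     \<alpha> * (L2_norm_on {0<..<1} (second_weak_deriv 0 1 g))\<^sup>2"

definition cell :: "nat \<Rightarrow> nat \<Rightarrow> real set" where
  "cell M j = (if j = 1 then {0..1 / real M} else {(real j - 1) / real M<..real j / real M})"

text \<open>The cells with indices \<open>1..M\<close> partition \<open>[0,1]\<close>, so at most one summand is nonzero at any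
  point and all of them vanish outside \<open>[0,1]\<close>.\<close>

definition obs_density :: "nat \<Rightarrow> nat \<Rightarrow> (nat \<Rightarrow> real) \<Rightarrow> real \<Rightarrow> real" where
  "obs_density M N x t =
     (\<Sum>j=1..M. real (card {i\<in>{1..N}. x i \<in> cell M j}) / (real N * (1 / real M)) *
        indicator (cell M j) t)"

text \<open>Below, \<open>F\<close> stands for the \<open>L\<^sup>2(0,1)\<close> norm of the second derivative of the target function
  and \<open>K\<close> for a Sobolev constant. That the constants do not depend on the numbers of knots and of
  observations is expressed by these not being among the arguments.\<close>

definition K_star :: real where
  "K_star = 32"

definition C1_const :: "real \<Rightarrow> real \<Rightarrow> real \<Rightarrow> real" where
  "C1_const \<gamma> \<delta> F = 2 * \<gamma> powr (-1/2) * F + 4 / sqrt (\<delta> * \<gamma>)"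

definition C2_const :: "real \<Rightarrow> real \<Rightarrow> real \<Rightarrow> real \<Rightarrow> real" where
  "C2_const \<beta> \<gamma> \<delta> F =
     F * sqrt ((9 * \<beta> + 8) / (2 * \<gamma>) + 36 * K_star\<^sup>2 * \<beta> + 64 * K_star\<^sup>2) +
     4 * K_star * \<delta> powr (-1/2)"

definition C3_const :: "real \<Rightarrow> real \<Rightarrow> real \<Rightarrow> real \<Rightarrow> real \<Rightarrow> real" where
  "C3_const K \<beta> \<gamma> \<delta> F =
     sqrt K * (F * sqrt (4 / \<gamma> + 9 / 4 * \<beta> + 4) + \<delta> powr (-1/2) * sqrt (16 / \<gamma> + 1))"

definition C4_const :: "real \<Rightarrow> real \<Rightarrow> real \<Rightarrow> real \<Rightarrow> real \<Rightarrow> real" where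
  "C4_const K \<beta> \<gamma> \<delta> F =
     sqrt K * (F * sqrt ((9 * \<beta> + 8) / (8 * K_star * \<gamma>) + 18 * K_star * \<beta> + 32 * K_star) +
               2 * sqrt 2 * \<delta> powr (-1/2) * sqrt K_star)"

end

(*
Let \<open>s = M \<sigma>\<^sup>2 / N\<close> and let \<open>\<parallel>u\<parallel>\<^sub>N\<close> be the mean square over the observation points. The minimizer depends
linearly on the data, so the error is a bias (the error for exact data) plus the minimizer for the
pure noise.

The bias is compared, through the Tikhonov functional, with the complete spline interpolant g of f:
g'' is the L2 projection of f'', hence the norm of g'' is at most that of f'', and f - g vanishes at
the knots, hence \<open>\<parallel>f - g\<parallel>\<^sub>N\<^sup>2 \<le> \<beta> d\<^sup>4 \<parallel>f''\<parallel>\<^sup>2\<close>.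

For the noise part w, a trace computation in an orthonormal system of the Tikhonov form bounds the
expectation of \<open>\<parallel>w\<parallel>\<^sub>N\<^sup>2 + 4 \<alpha> \<parallel>w''\<parallel>\<^sup>2\<close> by \<open>4 s\<close>, and Markov's inequality is applied once.

In both parts \<open>\<parallel>u\<parallel>\<^sup>2 \<le> 4/\<gamma> \<parallel>u\<parallel>\<^sub>N\<^sup>2 + 16 K\<^sup>2 d\<^sup>4 \<parallel>u''\<parallel>\<^sup>2\<close> on I' (every cell of I' contains at least
\<open>\<gamma> N d\<close> observation points; the resulting u' term is absorbed by interpolation between u and u''),
and u' is estimated with the Sobolev constant at \<open>\<epsilon>\<^sup>2 = max (sqrt s) (4 K d\<^sup>2)\<close>.
*)

theory Submission
  imports Defs
begin

section \<open>Square-integrable functions on an interval\<close>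

text \<open>The choice \<alpha> = s + d^4 enters through two inequalities: s \<le> \<alpha> turns a
  bound on \<alpha> times the noise energy into one on the energy itself, and d^4 \<le> \<alpha>
  does the same for the bias, whose functional value contains the interpolation error \<beta> d^4
  F^2. The weight 4 in the noise energy is the ratio of the two bounds wanted, 4 s / \<delta> for
  the mean square and s / \<delta> for \<alpha> times the energy; a single use of Markov's
  inequality then yields both without splitting \<delta>. Weak derivatives are given by test
  functions and point values by C^1 representatives. W^{2,2} is therefore identified with the
  functions whose classical derivative is an indefinite integral of an L^2 function, which requires
  explicit smooth bumps. The quadratic forms on coefficient vectors are only semidefinite, so the
  linear algebra is done modulo null vectors: an orthonormal system represents those linear
  functionals that vanish on null vectors, and minimizers are compared only on I', where null
  splines vanish.\<close>

abbreviation sq_integral :: "real \<Rightarrow> real \<Rightarrow> (real \<Rightarrow> real) \<Rightarrow> real" where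
  "sq_integral a b u \<equiv> integral {a..b} (\<lambda>t. (u t)\<^sup>2)"

text \<open>Bridge between the two integrals in use: \<open>L2_on\<close> speaks of the Lebesgue
  integral on the open interval, the estimates of the gauge integral on the closed one, where the
  fundamental theorem of calculus applies. The end points form a null set, and |u v| \<le> u^2 + v^2
  supplies an integrable majorant.\<close>

lemma L2_on_mult:
  assumes "L2_on {a<..<b} u" "L2_on {a<..<b} v"
  shows "(\<lambda>t. u t * v t) absolutely_integrable_on {a..b}"
proof -
  let ?S = "{a<..<b::real}"
  have m: "u \<in> borel_measurable (lebesgue_on ?S)" "v \<in> borel_measurable (lebesgue_on ?S)"
    using assms by (auto simp: L2_on_def)
  have "(\<lambda>t. u t * v t) absolutely_integrable_on ?S"
  proof (rule measurable_bounded_by_integrable_imp_absolutely_integrable)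
    show "(\<lambda>t. u t * v t) \<in> borel_measurable (lebesgue_on ?S)" using m by measurable
    show "(\<lambda>t. (u t)\<^sup>2 + (v t)\<^sup>2) integrable_on ?S"
      using assms by (intro integrable_add integrable_on_lebesgue_on) (auto simp: L2_on_def)
    show "norm (u t * v t) \<le> (u t)\<^sup>2 + (v t)\<^sup>2" for t
    proof -
      have "0 \<le> (\<bar>u t\<bar> - \<bar>v t\<bar>)\<^sup>2" "0 \<le> \<bar>u t\<bar> * \<bar>v t\<bar>" by auto
      then have "\<bar>u t\<bar> * \<bar>v t\<bar> \<le> (u t)\<^sup>2 + (v t)\<^sup>2" by (simp only: power2_diff power2_abs)
      then show ?thesis by (simp add: abs_mult)
    qed
  qed auto
  then show ?thesis by (simp add: absolutely_integrable_on_Icc_iff_Ioo)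
qed

lemmas L2_on_mult_integrable = L2_on_mult[THEN set_lebesgue_integral_eq_integral(1)]

lemma L2_on_continuous:
  assumes "continuous_on {a..b} u"
  shows "L2_on {a<..<b} u"
proof -
  have "u \<in> borel_measurable (lebesgue_on {a<..<b})"
    using assms by (intro continuous_imp_measurable_on_sets_lebesgue continuous_on_subset[OF assms]) auto
  moreover have "(\<lambda>t. (u t)\<^sup>2) absolutely_integrable_on {a..b}"
    by (intro absolutely_integrable_continuous_real continuous_intros assms)
  then have "(\<lambda>t. (u t)\<^sup>2) absolutely_integrable_on {a<..<b}"
    by (simp add: absolutely_integrable_on_Icc_iff_Ioo)
  then have "integrable (lebesgue_on {a<..<b}) (\<lambda>t. (u t)\<^sup>2)"
    by (intro absolutely_integrable_imp_integrable) auto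
  ultimately show ?thesis by (simp add: L2_on_def)
qed

lemma L2_on_abs_integrable:
  assumes "L2_on {a<..<b} u"
  shows "u absolutely_integrable_on {a..b}"
  using L2_on_mult[OF assms L2_on_continuous[of a b "\<lambda>_. 1"]] by simp

lemma L2_on_linear:
  assumes "L2_on {a<..<b} u" "L2_on {a<..<b} v"
  shows "L2_on {a<..<b} (\<lambda>t. u t + c * v t)"
proof -
  have "(\<lambda>t. u t * u t) absolutely_integrable_on {a..b}" "(\<lambda>t. u t * v t) absolutely_integrable_on {a..b}"
    "(\<lambda>t. v t * v t) absolutely_integrable_on {a..b}"
    using assms by (auto intro: L2_on_mult)
  then have "(\<lambda>t. u t * u t + (2 * c) * (u t * v t) + c\<^sup>2 * (v t * v t)) absolutely_integrable_on {a..b}"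
    by (intro set_integral_add set_integrable_mult_right) auto
  then have "(\<lambda>t. (u t + c * v t)\<^sup>2) absolutely_integrable_on {a<..<b}"
    by (simp add: absolutely_integrable_on_Icc_iff_Ioo power2_eq_square algebra_simps)
  then have "integrable (lebesgue_on {a<..<b}) (\<lambda>t. (u t + c * v t)\<^sup>2)"
    by (intro absolutely_integrable_imp_integrable) auto
  moreover have "u \<in> borel_measurable (lebesgue_on {a<..<b})" "v \<in> borel_measurable (lebesgue_on {a<..<b})"
    using assms by (auto simp: L2_on_def)
  ultimately show ?thesis unfolding L2_on_def by simp
qed

lemma L2_on_subinterval:
  assumes "L2_on {a<..<b} u" "a \<le> a'" "b' \<le> b"
  shows "L2_on {a'<..<b'} u"
proof -
  have s: "{a'<..<b'} \<subseteq> {a<..<b}" using assms by auto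
  have "u \<in> borel_measurable (lebesgue_on {a'<..<b'})"
    using assms(1) s measurable_restrict_mono unfolding L2_on_def by blast
  moreover have "(\<lambda>t. (u t)\<^sup>2) absolutely_integrable_on {a..b}"
    using L2_on_mult[OF assms(1) assms(1)] by (simp add: power2_eq_square)
  then have "(\<lambda>t. (u t)\<^sup>2) absolutely_integrable_on {a'<..<b'}"
    using absolutely_integrable_on_subinterval[of "{a..b}" _ a' b'] assms
    by (cases "a' \<le> b'") (auto simp: absolutely_integrable_on_Icc_iff_Ioo[symmetric])
  then have "integrable (lebesgue_on {a'<..<b'}) (\<lambda>t. (u t)\<^sup>2)"
    by (intro absolutely_integrable_imp_integrable) auto
  ultimately show ?thesis by (simp add: L2_on_def)
qed

lemma L2_norm_on_eq:
  assumes "L2_on {a<..<b} u"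
  shows "L2_norm_on {a<..<b} u = sqrt (sq_integral a b u)"
  using assms by (simp add: L2_norm_on_def L2_on_def lebesgue_integral_eq_integral integral_open_interval_real)

lemma L2_norm_on_cong:
  assumes "\<And>t. t \<in> S \<Longrightarrow> u t = w t"
  shows "L2_norm_on S u = L2_norm_on S w"
  unfolding L2_norm_on_def using assms by (auto intro!: arg_cong[where f=sqrt] Bochner_Integration.integral_cong)

text \<open>Cauchy-Schwarz in the abstract: the bound is read off at the minimum c = -B/C. The
  degenerate case C = 0 is included, since it governs the null vectors of semidefinite
  forms.\<close>

lemma quadratic_discriminant:
  fixes A B C :: real
  assumes "\<And>c. 0 \<le> A + 2 * c * B + c\<^sup>2 * C" "0 \<le> C"
  shows "B\<^sup>2 \<le> A * C"
proof (cases "C = 0")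
  case True
  have "B = 0"
  proof (rule ccontr)
    assume "B \<noteq> 0"
    \<comment> \<open>At this \<open>c\<close> the affine expression A + 2 c B equals -1.\<close>
    then show False using assms(1)[of "- (A + 1) / (2 * B)"] True by (simp add: field_simps)
  qed
  then show ?thesis using True by simp
next
  case False
  then have "C > 0" using assms(2) by simp
  have "0 \<le> A + 2 * (- B / C) * B + (- B / C)\<^sup>2 * C" using assms(1) .
  also have "\<dots> = (A * C - B\<^sup>2) / C" using \<open>C > 0\<close> by (simp add: field_simps power2_eq_square)
  finally show ?thesis using \<open>C > 0\<close> by (simp add: zero_le_divide_iff)
qed

lemma L2_on_integral_square_expand:
  assumes "L2_on {a<..<b} u" "L2_on {a<..<b} v"
  shows "integral {a..b} (\<lambda>t. (u t + c * v t)\<^sup>2) = sq_integral a b u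
     + 2 * c * integral {a..b} (\<lambda>t. u t * v t) + c\<^sup>2 * sq_integral a b v"
proof -
  have i: "(\<lambda>t. u t * u t) integrable_on {a..b}" "(\<lambda>t. u t * v t) integrable_on {a..b}"
    "(\<lambda>t. v t * v t) integrable_on {a..b}"
    using assms by (auto intro: L2_on_mult_integrable)
  have "integral {a..b} (\<lambda>t. (u t + c * v t)\<^sup>2)
      = integral {a..b} (\<lambda>t. u t * u t + ((2 * c) * (u t * v t) + c\<^sup>2 * (v t * v t)))"
    by (simp add: power2_eq_square algebra_simps)
  also have "\<dots> = integral {a..b} (\<lambda>t. u t * u t) + integral {a..b} (\<lambda>t. (2 * c) * (u t * v t) + c\<^sup>2 * (v t * v t))"
    using i by (intro integral_add integrable_add integrable_on_mult_right)
  also have "integral {a..b} (\<lambda>t. (2 * c) * (u t * v t) + c\<^sup>2 * (v t * v t))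
     = integral {a..b} (\<lambda>t. (2 * c) * (u t * v t)) + integral {a..b} (\<lambda>t. c\<^sup>2 * (v t * v t))"
    using i by (intro integral_add integrable_on_mult_right)
  finally show ?thesis by (simp add: power2_eq_square)
qed

lemma L2_on_Cauchy_Schwarz:
  assumes "L2_on {a<..<b} u" "L2_on {a<..<b} v"
  shows "(integral {a..b} (\<lambda>t. u t * v t))\<^sup>2
     \<le> sq_integral a b u * sq_integral a b v"
proof (rule quadratic_discriminant)
  show "0 \<le> sq_integral a b u + 2 * c * integral {a..b} (\<lambda>t. u t * v t)
      + c\<^sup>2 * sq_integral a b v" for c
    unfolding L2_on_integral_square_expand[OF assms, symmetric]
    using L2_on_mult_integrable[OF L2_on_linear[OF assms] L2_on_linear[OF assms]]
    by (intro integral_nonneg) (auto simp: power2_eq_square)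
  show "0 \<le> sq_integral a b v"
    using L2_on_mult_integrable[OF assms(2) assms(2)]
    by (intro integral_nonneg) (auto simp: power2_eq_square)
qed

lemma L2_on_integral_abs_le:
  assumes "L2_on {a<..<b} u" "a \<le> b"
  shows "(integral {a..b} u)\<^sup>2 \<le> (b - a) * sq_integral a b u"
  using L2_on_Cauchy_Schwarz[OF L2_on_continuous[of a b "\<lambda>_. 1"] assms(1)] assms(2) by simp

lemma L2_on_integral_square_nonneg:
  assumes "L2_on {a<..<b} u"
  shows "0 \<le> sq_integral a b u"
  using L2_on_mult_integrable[OF assms assms]
  by (intro integral_nonneg) (auto simp: power2_eq_square)

lemma L2_norm_on_triangle:
  assumes "L2_on {a<..<b} u" "L2_on {a<..<b} v"
  shows "L2_norm_on {a<..<b} (\<lambda>t. u t + v t) \<le> L2_norm_on {a<..<b} u + L2_norm_on {a<..<b} v"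
proof -
  let ?A = "sq_integral a b u" and ?C = "sq_integral a b v"
  let ?B = "integral {a..b} (\<lambda>t. u t * v t)"
  have n: "0 \<le> ?A" "0 \<le> ?C" using assms L2_on_integral_square_nonneg by blast+
  have "\<bar>?B\<bar> \<le> sqrt ?A * sqrt ?C"
    using L2_on_Cauchy_Schwarz[OF assms] by (metis real_le_rsqrt real_sqrt_mult abs_le_square_iff power2_abs real_sqrt_abs real_sqrt_le_iff)
  then have "?A + 2 * ?B + ?C \<le> (sqrt ?A + sqrt ?C)\<^sup>2"
    using n by (simp add: power2_sum)
  then have "sqrt (?A + 2 * ?B + ?C) \<le> sqrt ?A + sqrt ?C"
    using n by (intro real_le_lsqrt) auto
  moreover have "L2_on {a<..<b} (\<lambda>t. u t + v t)" using L2_on_linear[OF assms, of 1] by simp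
  ultimately show ?thesis
    using L2_on_integral_square_expand[OF assms, of 1] assms by (simp add: L2_norm_on_eq)
qed

text \<open>Half-lines form an intersection-stable generator of the Borel sets, so the integral of
  \<open>v\<close> vanishes over every Borel set by a Dynkin argument. This is what makes the second
  weak derivative unique almost everywhere.\<close>

lemma AE_zero_if_indefinite_integral_zero:
  fixes v :: "real \<Rightarrow> real"
  assumes v: "v absolutely_integrable_on {a..b}"
    and z: "\<And>x. x \<in> {a..b} \<Longrightarrow> integral {a..x} v = 0"
  shows "AE t in lebesgue. t \<in> {a..b} \<longrightarrow> v t = 0"
proof (cases "a \<le> b")
  case ab: True
  define h where "h t = indicator {a..b} t * v t" for t
  have hi: "integrable lebesgue h" using v unfolding set_integrable_def h_def by simp
  \<comment> \<open>\<open>h\<close> is only Lebesgue measurable; the Dynkin argument runs over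
    Borel sets and needs a Borel function that agrees with \<open>h\<close> almost
    everywhere.\<close>
  obtain w where w: "w \<in> borel_measurable lborel" "AE t in lborel. h t = w t"
    using completion_ex_borel_measurable_real[of h lborel] hi by auto
  have aeq: "AE t in lebesgue. h t = w t" using w(2) AE_completion by blast
  have wi': "integrable lebesgue w"
    using integrable_cong_AE_imp[OF hi _ aeq] w(1) measurable_completion by blast
  then have wi: "integrable lborel w" using w(1) integrable_completion by blast
  have *: "(LINT t:{..x}|lborel. w t) = 0" for x
  proof -
    have "(LINT t:{..x}|lborel. w t) = (LINT t:{..x}|lebesgue. w t)"
      unfolding set_lebesgue_integral_def using w(1) by (intro integral_completion[symmetric]) auto
    also have "\<dots> = (LINT t:{..x}|lebesgue. h t)"
      unfolding set_lebesgue_integral_def using aeq w(1) hi measurable_completion[OF w(1)]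
      by (intro integral_cong_AE borel_measurable_scaleR borel_measurable_indicator) auto
    also have "\<dots> = (LINT t:{a..min x b}|lebesgue. v t)"
      unfolding set_lebesgue_integral_def h_def
      by (intro Bochner_Integration.integral_cong) (auto simp: indicator_def)
    also have "\<dots> = integral {a..min x b} v"
      using absolutely_integrable_on_subinterval[OF v, of a "min x b"]
      by (intro set_lebesgue_integral_eq_integral(2)) (cases "a \<le> min x b"; simp)
    also have "\<dots> = 0" using z[of "min x b"] by (cases "a \<le> min x b") auto
    finally show ?thesis .
  qed
  \<comment> \<open>The integral over the whole line settles the passage to complements.\<close>
  have tot: "(LINT t|lborel. w t) = 0"
  proof -
    have "(LINT t|lborel. w t) = (LINT t|lebesgue. w t)" using w(1) by (simp add: integral_completion)
    also have "\<dots> = (LINT t|lebesgue. h t)"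
      using aeq w(1) hi measurable_completion[OF w(1)] by (intro integral_cong_AE) auto
    also have "\<dots> = (LINT t:{a..b}|lebesgue. v t)"
      unfolding set_lebesgue_integral_def h_def by simp
    also have "\<dots> = 0" using z[of b] ab set_lebesgue_integral_eq_integral(2)[OF v] by simp
    finally show ?thesis .
  qed
  have "(LINT t:A|lborel. w t) = 0" if "A \<in> sets lborel" for A
  proof -
    have int: "Int_stable (range (\<lambda>x::real. {..x}))" by (auto simp: Int_stable_def)
    have pow: "range (\<lambda>x::real. {..x}) \<subseteq> Pow UNIV" by auto
    have "A \<in> sigma_sets UNIV (range (\<lambda>x::real. {..x}))"
      using that by (simp add: borel_eq_atMost sets_measure_of)
    from sigma_sets_induct_disjoint[where P="\<lambda>A. (LINT t:A|lborel. w t) = 0", OF int pow this]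
    show ?thesis
    proof this
      fix A assume "A \<in> range (\<lambda>x::real. {..x})"
      then show "(LINT t:A|lborel. w t) = 0" using * by auto
    next
      show "(LINT t:{}|lborel. w t) = 0" by (simp add: set_lebesgue_integral_def)
    next
      fix A assume "A \<in> sigma_sets UNIV (range (\<lambda>x::real. {..x}))" and z: "(LINT t:A|lborel. w t) = 0"
      then have A: "A \<in> sets lborel" by (simp add: borel_eq_atMost sets_measure_of)
      have "(LINT t:UNIV - A|lborel. w t) = (LINT t|lborel. w t - indicator A t * w t)"
        unfolding set_lebesgue_integral_def
        by (intro Bochner_Integration.integral_cong) (auto simp: indicator_def)
      also have "\<dots> = (LINT t|lborel. w t) - (LINT t|lborel. indicator A t * w t)"
        using wi integrable_real_mult_indicator[OF A wi]
        by (intro Bochner_Integration.integral_diff) (auto simp: mult.commute)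
      finally show "(LINT t:UNIV - A|lborel. w t) = 0" using tot z unfolding set_lebesgue_integral_def by simp
    next
      fix A :: "nat \<Rightarrow> real set"
      assume dj: "disjoint_family A" and "range A \<subseteq> sigma_sets UNIV (range (\<lambda>x::real. {..x}))"
        and z: "\<And>i. (LINT t:A i|lborel. w t) = 0"
      then have A: "A i \<in> sets lborel" for i by (auto simp: borel_eq_atMost sets_measure_of)
      have "(LINT t:(\<Union>i. A i)|lborel. w t) = (\<Sum>i. LINT t:A i|lborel. w t)"
        using A dj integrable_mult_indicator[OF _ wi, of "\<Union>i. A i"]
        by (intro lebesgue_integral_countable_add) (auto simp: disjoint_family_on_def set_integrable_def)
      then show "(LINT t:(\<Union>i. A i)|lborel. w t) = 0" using z by simp
    qed
  qed
  then have "AE t in lborel. w t = 0" using sigma_finite_measure.density_zero[OF lborel.sigma_finite_measure_axioms wi] by simp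
  then have "AE t in lebesgue. w t = 0" using AE_completion by blast
  with aeq show ?thesis by eventually_elim (auto simp: h_def indicator_def split: if_splits)
qed auto

section \<open>Weak second derivatives\<close>

lemma DERIV_within_closed_integral:
  assumes "\<And>t. t \<in> {a..b} \<Longrightarrow> (u has_real_derivative u' t) (at t within {a..b})" "x \<in> {a..b}" "y \<in> {a..b}" "x \<le> y"
  shows "(u' has_integral (u y - u x)) {x..y}"
  using assms
  by (intro fundamental_theorem_of_calculus)
    (auto simp flip: has_real_derivative_iff_has_vector_derivative intro: DERIV_subset[where s="{a..b}"])

text \<open>No Fubini is needed here: the difference of the two sides, as a function of the right end
  point, changes by \<open>o(y - x)\<close> between \<open>x\<close> and \<open>y\<close>.\<close>

lemma integral_by_parts_indefinite:
  fixes U v \<phi> \<phi>' :: "real \<Rightarrow> real"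
  assumes ab: "a \<le> b" and v: "v absolutely_integrable_on {a..b}"
    and U: "\<And>t. t \<in> {a..b} \<Longrightarrow> U t = U a + integral {a..t} v"
    and \<phi>: "\<And>t. t \<in> {a..b} \<Longrightarrow> (\<phi> has_real_derivative \<phi>' t) (at t within {a..b})"
    and \<phi>': "continuous_on {a..b} \<phi>'"
  shows "integral {a..b} (\<lambda>t. U t * \<phi>' t) = U b * \<phi> b - U a * \<phi> a - integral {a..b} (\<lambda>t. v t * \<phi> t)"
proof -
  have vi: "v integrable_on {a..b}" using v by (rule set_lebesgue_integral_eq_integral(1))
  have avi: "(\<lambda>t. \<bar>v t\<bar>) integrable_on {a..b}" using v by (simp add: absolutely_integrable_on_def)
  have U_cont: "continuous_on {a..b} U"
  proof -
    have "continuous_on {a..b} (\<lambda>t. U a + integral {a..t} v)"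
      by (intro continuous_intros indefinite_integral_continuous_1 vi)
    then show ?thesis by (rule continuous_on_eq) (rule U[symmetric])
  qed
  have \<phi>_cont: "continuous_on {a..b} \<phi>" using \<phi> by (rule DERIV_continuous_on)
  \<comment> \<open>The variation of \<open>U\<close>: its increments are integrals of |v| and
    dominate the increments of \<open>U\<close>. Its continuity is what makes the error below o(y -
    x).\<close>
  define W where "W t = integral {a..t} (\<lambda>t. \<bar>v t\<bar>)" for t
  have W_cont: "continuous_on {a..b} W"
    unfolding W_def by (intro indefinite_integral_continuous_1 avi)
  have "\<exists>C. \<forall>t\<in>{a..b}. \<bar>\<phi>' t\<bar> \<le> C"
    using compact_continuous_image[OF \<phi>' compact_Icc, THEN compact_imp_bounded]
    by (auto simp: bounded_iff)
  then obtain C where C: "\<And>t. t \<in> {a..b} \<Longrightarrow> \<bar>\<phi>' t\<bar> \<le> C" by blast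
  have C0: "0 \<le> C" using C[of a] ab by force
  have i1: "(\<lambda>t. U t * \<phi>' t) integrable_on {a..b}"
    by (intro integrable_continuous_interval continuous_intros U_cont \<phi>')
  have vphi: "(\<lambda>t. v t * \<psi> t) integrable_on {a..b}" if "continuous_on {a..b} \<psi>" for \<psi>
  proof -
    have "(\<lambda>t. \<psi> t * v t) absolutely_integrable_on {a..b}"
      using that v by (intro absolutely_integrable_bounded_measurable_product_real
          continuous_imp_measurable_on_sets_lebesgue compact_imp_bounded compact_continuous_image) auto
    then show ?thesis by (simp add: mult.commute set_lebesgue_integral_eq_integral(1))
  qed
  define \<Phi> where "\<Phi> x = integral {a..x} (\<lambda>t. U t * \<phi>' t + v t * \<phi> t) - U x * \<phi> x" for x
  have bnd: "\<bar>\<Phi> y - \<Phi> x\<bar> \<le> 2 * C * (y - x) * (W y - W x)"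
    if xy: "x \<in> {a..b}" "y \<in> {a..b}" "x \<le> y" for x y
  proof -
    have s: "{x..y} \<subseteq> {a..b}" using xy by auto
    have ii: "(\<lambda>t. U t * \<phi>' t + v t * \<phi> t) integrable_on {a..b}"
      by (intro integrable_add i1 vphi \<phi>_cont)
    have comb: "integral {a..y} g - integral {a..x} g = integral {x..y} g"
      if "g integrable_on {a..b}" for g :: "real \<Rightarrow> real"
      using Henstock_Kurzweil_Integration.integral_combine[of a x y g] xy
        integrable_on_subinterval[OF that, of a y] by auto
    have WW: "W y - W x = integral {x..y} (\<lambda>t. \<bar>v t\<bar>)" unfolding W_def by (rule comb[OF avi])
    have j0: "(\<phi>' has_integral (\<phi> y - \<phi> x)) {x..y}"
      using DERIV_within_closed_integral[of a b \<phi> \<phi>'] \<phi> xy by blast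
    have jv: "(v has_integral (U y - U x)) {x..y}"
      using integrable_integral[OF integrable_on_subinterval[OF vi s]] comb[OF vi] U[of x] U[of y] xy by simp
    have j1: "((\<lambda>t. U t * \<phi>' t + v t * \<phi> t) has_integral (integral {x..y} (\<lambda>t. U t * \<phi>' t + v t * \<phi> t))) {x..y}"
      using integrable_on_subinterval[OF ii s] by (rule integrable_integral)
    \<comment> \<open>Subtracting two terms with known integrals leaves an increment of
      \<open>U\<close> times \<open>\<phi>'\<close> plus an increment of \<open>\<phi>\<close> times
      \<open>v\<close>. The former increment is bounded by that of \<open>W\<close>, the latter by C
      (y - x).\<close>
    have "((\<lambda>t. (U t * \<phi>' t + v t * \<phi> t) - U y * \<phi>' t - \<phi> x * v t) has_integral
       (integral {x..y} (\<lambda>t. U t * \<phi>' t + v t * \<phi> t) - U y * (\<phi> y - \<phi> x) - \<phi> x * (U y - U x))) {x..y}"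
      by (intro has_integral_diff j1 has_integral_mult_right j0 jv)
    moreover have "integral {x..y} (\<lambda>t. U t * \<phi>' t + v t * \<phi> t) - U y * (\<phi> y - \<phi> x) - \<phi> x * (U y - U x) = \<Phi> y - \<Phi> x"
      unfolding \<Phi>_def comb[OF ii, symmetric] by (simp add: algebra_simps)
    moreover have "(\<lambda>t. (U t * \<phi>' t + v t * \<phi> t) - U y * \<phi>' t - \<phi> x * v t)
       = (\<lambda>t. (U t - U y) * \<phi>' t + v t * (\<phi> t - \<phi> x))" by (auto simp: algebra_simps)
    ultimately have h: "((\<lambda>t. (U t - U y) * \<phi>' t + v t * (\<phi> t - \<phi> x)) has_integral (\<Phi> y - \<Phi> x)) {x..y}"
      by simp
    have avi': "(\<lambda>t. \<bar>v t\<bar>) integrable_on {x..y}" using integrable_on_subinterval[OF avi s] .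
    have "norm (\<Phi> y - \<Phi> x) \<le> integral {x..y} (\<lambda>t. (W y - W x) * C + \<bar>v t\<bar> * (C * (y - x)))"
    proof (subst integral_unique[OF h, symmetric], rule integral_norm_bound_integral)
      show "(\<lambda>t. (U t - U y) * \<phi>' t + v t * (\<phi> t - \<phi> x)) integrable_on {x..y}" using h by blast
      show "(\<lambda>t. (W y - W x) * C + \<bar>v t\<bar> * (C * (y - x))) integrable_on {x..y}"
        using avi' by (intro integrable_add integrable_on_mult_left) auto
      fix t assume t: "t \<in> {x..y}"
      then have tin: "t \<in> {a..b}" using s by auto
      have "U y - U t = integral {t..y} v"
        using Henstock_Kurzweil_Integration.integral_combine[of a t y v] t xy
        integrable_on_subinterval[OF vi, of a y] U[of t] U[of y] tin by auto
      moreover have "norm (integral {t..y} v) \<le> integral {t..y} (\<lambda>t. \<bar>v t\<bar>)"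
        using t xy by (intro integral_norm_bound_integral integrable_on_subinterval[OF vi] integrable_on_subinterval[OF avi]) auto
      moreover have "integral {t..y} (\<lambda>t. \<bar>v t\<bar>) \<le> integral {x..y} (\<lambda>t. \<bar>v t\<bar>)"
        using t xy by (intro integral_subset_le integrable_on_subinterval[OF avi]) auto
      ultimately have 1: "\<bar>U t - U y\<bar> \<le> W y - W x" using WW by simp
      have "norm (\<phi> t - \<phi> x) \<le> C * norm (t - x)"
        using \<phi> C t xy by (intro field_differentiable_bound[where S="{a..b}" and f'=\<phi>']) auto
      also have "\<dots> \<le> C * (y - x)" using t C0 by (intro mult_left_mono) auto
      finally have 2: "\<bar>\<phi> t - \<phi> x\<bar> \<le> C * (y - x)" by simp
      have "norm ((U t - U y) * \<phi>' t + v t * (\<phi> t - \<phi> x)) \<le> \<bar>U t - U y\<bar> * \<bar>\<phi>' t\<bar> + \<bar>v t\<bar> * \<bar>\<phi> t - \<phi> x\<bar>"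
        using abs_triangle_ineq[of "(U t - U y) * \<phi>' t" "v t * (\<phi> t - \<phi> x)"] by (simp add: abs_mult)
      also have "\<dots> \<le> (W y - W x) * C + \<bar>v t\<bar> * (C * (y - x))"
        using 1 2 C[OF tin] by (intro add_mono mult_mono) auto
      finally show "norm ((U t - U y) * \<phi>' t + v t * (\<phi> t - \<phi> x)) \<le> (W y - W x) * C + \<bar>v t\<bar> * (C * (y - x))" .
    qed
    also have "\<dots> = (W y - W x) * C * (y - x) + (W y - W x) * (C * (y - x))"
      using avi' xy(3) by (subst integral_add) (auto simp: WW intro: integrable_on_mult_left)
    also have "\<dots> = 2 * C * (y - x) * (W y - W x)" by algebra
    finally show ?thesis by simp
  qed
  have "(\<Phi> has_real_derivative 0) (at x within {a..b})" if x: "x \<in> {a..b}" for x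
    unfolding has_field_derivative_iff
  proof (rule Lim_null_comparison)
    show "eventually (\<lambda>y. norm ((\<Phi> y - \<Phi> x) / (y - x)) \<le> 2 * C * \<bar>W y - W x\<bar>) (at x within {a..b})"
    proof (unfold eventually_at_filter, intro always_eventually allI impI)
      fix y assume y: "y \<noteq> x" "y \<in> {a..b}"
      have "\<bar>\<Phi> y - \<Phi> x\<bar> \<le> 2 * C * \<bar>y - x\<bar> * \<bar>W y - W x\<bar>"
      proof (cases "x \<le> y")
        case True
        have "\<bar>\<Phi> y - \<Phi> x\<bar> \<le> 2 * C * (y - x) * (W y - W x)" using bnd[OF x y(2) True] .
        also have "\<dots> \<le> 2 * C * (y - x) * \<bar>W y - W x\<bar>" using True C0 by (intro mult_left_mono) auto
        finally show ?thesis using True by simp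
      next
        case False
        have "\<bar>\<Phi> x - \<Phi> y\<bar> \<le> 2 * C * (x - y) * (W x - W y)" using bnd[OF y(2) x] False by simp
        also have "\<dots> \<le> 2 * C * (x - y) * \<bar>W x - W y\<bar>" using False C0 by (intro mult_left_mono) auto
        finally show ?thesis using False by (simp add: abs_minus_commute)
      qed
      then show "norm ((\<Phi> y - \<Phi> x) / (y - x)) \<le> 2 * C * \<bar>W y - W x\<bar>"
        using y by (simp add: field_simps)
    qed
    have "(W \<longlongrightarrow> W x) (at x within {a..b})" using W_cont x by (simp add: continuous_on)
    then have "((\<lambda>y. 2 * C * \<bar>W y - W x\<bar>) \<longlongrightarrow> 2 * C * \<bar>W x - W x\<bar>) (at x within {a..b})"
      by (intro tendsto_intros)
    then show "((\<lambda>y. 2 * C * \<bar>W y - W x\<bar>) \<longlongrightarrow> 0) (at x within {a..b})" by simp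
  qed
  then obtain c where "\<And>x. x \<in> {a..b} \<Longrightarrow> \<Phi> x = c"
    using has_field_derivative_zero_constant[of "{a..b}" \<Phi>] convex_real_interval(5) by blast
  then have "\<Phi> b = \<Phi> a" using ab by simp
  then show ?thesis
    using integral_add[OF i1 vphi[OF \<phi>_cont]] by (simp add: \<Phi>_def)
qed

text \<open>The classical description of \<open>u \<in> W\<^sup>2\<^sup>,\<^sup>2(a,b)\<close>: \<open>u'\<close> is absolutely continuous on \<open>[a,b]\<close> and \<open>v\<close>,
  in \<open>L\<^sup>2\<close>, is its derivative.\<close>

definition ac2 :: "real \<Rightarrow> real \<Rightarrow> (real \<Rightarrow> real) \<Rightarrow> (real \<Rightarrow> real) \<Rightarrow> (real \<Rightarrow> real) \<Rightarrow> bool" where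
  "ac2 a b u u' v \<longleftrightarrow> a < b \<and> L2_on {a<..<b} v \<and>
     (\<forall>t\<in>{a..b}. (u has_real_derivative u' t) (at t within {a..b})) \<and>
     (\<forall>t\<in>{a..b}. u' t = u' a + integral {a..t} v)"

lemma ac2D:
  assumes "ac2 a b u u' v"
  shows "a < b" "L2_on {a<..<b} v"
    "\<And>t. t \<in> {a..b} \<Longrightarrow> (u has_real_derivative u' t) (at t within {a..b})"
    "\<And>t. t \<in> {a..b} \<Longrightarrow> u' t = u' a + integral {a..t} v"
  using assms unfolding ac2_def by blast+

lemma ac2_continuous:
  assumes "ac2 a b u u' v"
  shows "continuous_on {a..b} u" "continuous_on {a..b} u'"
proof -
  show "continuous_on {a..b} u" using ac2D(3)[OF assms] by (rule DERIV_continuous_on)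
  have "continuous_on {a..b} (\<lambda>t. u' a + integral {a..t} v)"
    using L2_on_abs_integrable[OF ac2D(2)[OF assms]]
    by (intro continuous_intros indefinite_integral_continuous_1 set_lebesgue_integral_eq_integral(1))
  then show "continuous_on {a..b} u'"
    by (rule continuous_on_eq) (rule ac2D(4)[OF assms, symmetric])
qed

lemma ac2_L2:
  assumes "ac2 a b u u' v"
  shows "L2_on {a<..<b} u" "L2_on {a<..<b} u'" "L2_on {a<..<b} v"
  using ac2_continuous[OF assms] ac2D(2)[OF assms] by (auto intro: L2_on_continuous)

lemma ac2_linear:
  assumes u: "ac2 a b u u' v" and w: "ac2 a b w w' z"
  shows "ac2 a b (\<lambda>t. u t + c * w t) (\<lambda>t. u' t + c * w' t) (\<lambda>t. v t + c * z t)"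
  unfolding ac2_def
proof (intro conjI ballI)
  show "a < b" by (rule ac2D(1)[OF u])
  show "L2_on {a<..<b} (\<lambda>t. v t + c * z t)" using u w by (intro L2_on_linear ac2D)
  fix t assume t: "t \<in> {a..b}"
  show "((\<lambda>t. u t + c * w t) has_real_derivative u' t + c * w' t) (at t within {a..b})"
    using ac2D(3)[OF u t] ac2D(3)[OF w t] by (auto intro!: derivative_eq_intros)
  have i: "v integrable_on {a..t}" "z integrable_on {a..t}"
    using t ac2_L2(3)[OF u] ac2_L2(3)[OF w]
    by (auto intro!: set_lebesgue_integral_eq_integral(1) L2_on_abs_integrable intro: L2_on_subinterval[of a b])
  have "integral {a..t} (\<lambda>t. v t + c * z t) = integral {a..t} v + integral {a..t} (\<lambda>t. c * z t)"
    using i by (intro integral_add integrable_on_mult_right)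
  then show "u' t + c * w' t = u' a + c * w' a + integral {a..t} (\<lambda>t. v t + c * z t)"
    using ac2D(4)[OF u t] ac2D(4)[OF w t] by (simp add: algebra_simps)
qed

lemma ac2_integral:
  assumes "ac2 a b u u' v" "x \<in> {a..b}" "y \<in> {a..b}" "x \<le> y"
  shows "(v has_integral (u' y - u' x)) {x..y}"
proof -
  have vi: "v integrable_on {a..b}"
    using L2_on_abs_integrable[OF ac2D(2)[OF assms(1)]] by (rule set_lebesgue_integral_eq_integral(1))
  then have "integral {a..x} v + integral {x..y} v = integral {a..y} v"
    using assms by (intro Henstock_Kurzweil_Integration.integral_combine integrable_on_subinterval[OF vi]) auto
  then have "integral {x..y} v = u' y - u' x"
    using ac2D(4)[OF assms(1), of x] ac2D(4)[OF assms(1), of y] assms by simp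
  moreover have "v integrable_on {x..y}" using assms by (intro integrable_on_subinterval[OF vi]) auto
  ultimately show ?thesis by (metis integrable_integral)
qed

lemma ac2_subinterval:
  assumes u: "ac2 a b u u' v" and "a \<le> a'" "a' < b'" "b' \<le> b"
  shows "ac2 a' b' u u' v"
  unfolding ac2_def
proof (intro conjI ballI)
  show "a' < b'" by fact
  show "L2_on {a'<..<b'} v" using L2_on_subinterval[OF ac2D(2)[OF u]] assms by simp
  fix t assume t: "t \<in> {a'..b'}"
  then show "(u has_real_derivative u' t) (at t within {a'..b'})"
    using assms by (intro DERIV_subset[OF ac2D(3)[OF u]]) auto
  show "u' t = u' a' + integral {a'..t} v"
    using integral_unique[OF ac2_integral[OF u, of a' t]] t assms by simp
qed

lemma ac2_cong:
  assumes "ac2 a b u u' v" "\<And>t. t \<in> {a..b} \<Longrightarrow> w t = u t"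
  shows "ac2 a b w u' v"
proof -
  have "(w has_real_derivative u' t) (at t within {a..b})" if t: "t \<in> {a..b}" for t
    using has_field_derivative_transform_within[OF ac2D(3)[OF assms(1) t] zero_less_one t] assms(2) by simp
  then show ?thesis using assms(1) unfolding ac2_def by blast
qed

lemma ac2_by_parts:
  assumes u: "ac2 a b u u' v"
    and \<phi>: "\<And>t. t \<in> {a..b} \<Longrightarrow> (\<phi> has_real_derivative \<phi>' t) (at t within {a..b})"
    and \<phi>': "continuous_on {a..b} \<phi>'"
  shows "integral {a..b} (\<lambda>t. u t * \<phi>' t) = u b * \<phi> b - u a * \<phi> a - integral {a..b} (\<lambda>t. u' t * \<phi> t)"
    and "integral {a..b} (\<lambda>t. u' t * \<phi>' t) = u' b * \<phi> b - u' a * \<phi> a - integral {a..b} (\<lambda>t. v t * \<phi> t)"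
proof -
  note ab = ac2D(1)[OF u, THEN less_imp_le]
  show "integral {a..b} (\<lambda>t. u' t * \<phi>' t) = u' b * \<phi> b - u' a * \<phi> a - integral {a..b} (\<lambda>t. v t * \<phi> t)"
    by (rule integral_by_parts_indefinite[OF ab L2_on_abs_integrable[OF ac2D(2)[OF u]] ac2D(4)[OF u] \<phi> \<phi>'])
  have "u t = u a + integral {a..t} u'" if "t \<in> {a..b}" for t
    using DERIV_within_closed_integral[of a b u u' a t] ac2D(3)[OF u] that ab by (simp add: integral_unique)
  then show "integral {a..b} (\<lambda>t. u t * \<phi>' t) = u b * \<phi> b - u a * \<phi> a - integral {a..b} (\<lambda>t. u' t * \<phi> t)"
    using ab ac2_continuous[OF u]
    by (intro integral_by_parts_indefinite \<phi> \<phi>' absolutely_integrable_continuous_real)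
qed

section \<open>Test functions and weak derivatives of functions with absolutely continuous
  derivative\<close>

lemma test_function_deriv:
  assumes "test_function a b \<phi>"
  shows "test_function a b (deriv \<phi>)"
proof -
  obtain c e where ce: "a < c" "c < e" "e < b" "\<And>t. t \<notin> {c..e} \<Longrightarrow> \<phi> t = 0"
    and d: "\<And>k t. (deriv ^^ k) \<phi> field_differentiable (at t)"
    using assms unfolding test_function_def by blast
  have "deriv \<phi> t = 0" if t: "t \<notin> {c..e}" for t
  proof -
    have "((\<lambda>_. 0) has_field_derivative 0) (at t)" by simp
    then have "(\<phi> has_field_derivative 0) (at t)"
      by (rule has_field_derivative_transform_within_open[where S="- {c..e}"]) (use ce(4) t in auto)
    then show ?thesis by (rule DERIV_imp_deriv)
  qed
  moreover have "(deriv ^^ k) (deriv \<phi>) field_differentiable (at t)" for k t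
    using d[of "Suc k" t] by (simp add: funpow_swap1)
  ultimately show ?thesis using ce unfolding test_function_def by blast
qed

lemma test_functionD:
  assumes "test_function a b \<phi>"
  shows "(\<phi> has_real_derivative deriv \<phi> t) (at t within S)" "continuous_on S \<phi>" "\<phi> a = 0" "\<phi> b = 0" "a < b"
proof -
  have d: "\<phi> field_differentiable (at t)" for t
    using assms unfolding test_function_def by (metis funpow_0)
  then show "(\<phi> has_real_derivative deriv \<phi> t) (at t within S)"
    using DERIV_deriv_iff_field_differentiable has_field_derivative_at_within by blast
  show "continuous_on S \<phi>"
    using d by (auto intro!: continuous_at_imp_continuous_on field_differentiable_imp_continuous_at)
  show "\<phi> a = 0" "\<phi> b = 0" "a < b" using assms unfolding test_function_def by force+
qed

lemma weak_deriv_L2_iff: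
  assumes "L2_on {a<..<b} u" "L2_on {a<..<b} v"
  shows "weak_deriv k a b u v \<longleftrightarrow> (\<forall>\<phi>. test_function a b \<phi> \<longrightarrow>
     integral {a..b} (\<lambda>t. u t * (deriv ^^ k) \<phi> t) = (-1) ^ k * integral {a..b} (\<lambda>t. v t * \<phi> t))"
proof -
  have *: "(LINT t|lebesgue_on {a<..<b}. w t * \<psi> t) = integral {a..b} (\<lambda>t. w t * \<psi> t)"
    if "L2_on {a<..<b} w" "continuous_on {a..b} \<psi>" for w \<psi>
    using L2_on_mult[OF that(1) L2_on_continuous[OF that(2)]]
    by (simp add: lebesgue_integral_eq_integral absolutely_integrable_imp_integrable integral_open_interval_real
        absolutely_integrable_on_Icc_iff_Ioo)
  have t: "test_function a b ((deriv ^^ k) \<phi>)" if "test_function a b \<phi>" for \<phi> k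
    using that by (induction k) (auto intro: test_function_deriv)
  show ?thesis unfolding weak_deriv_def
    using *[OF assms(1) test_functionD(2)[OF t[of _ k]]] *[OF assms(2) test_functionD(2)] by auto
qed

lemma ac2_weak_deriv:
  assumes u: "ac2 a b u u' v"
  shows "weak_deriv 0 a b u u" "weak_deriv 1 a b u u'" "weak_deriv 2 a b u v"
proof -
  note L = ac2_L2[OF u]
  show "weak_deriv 0 a b u u" by (simp add: weak_deriv_def)
  show "weak_deriv 1 a b u u'"
    unfolding weak_deriv_L2_iff[OF L(1,2)]
  proof (intro allI impI)
    fix \<phi> assume t: "test_function a b \<phi>"
    note d1 = test_functionD[OF t] and d2 = test_functionD[OF test_function_deriv[OF t]]
    show "integral {a..b} (\<lambda>t. u t * (deriv ^^ 1) \<phi> t) = (- 1) ^ 1 * integral {a..b} (\<lambda>t. u' t * \<phi> t)"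
      using ac2_by_parts(1)[OF u d1(1) d2(2)] d1(3,4) by simp
  qed
  show "weak_deriv 2 a b u v"
    unfolding weak_deriv_L2_iff[OF L(1,3)]
  proof (intro allI impI)
    fix \<phi> assume t: "test_function a b \<phi>"
    note d1 = test_functionD[OF t] and d2 = test_functionD[OF test_function_deriv[OF t]]
      and d3 = test_functionD[OF test_function_deriv[OF test_function_deriv[OF t]]]
    show "integral {a..b} (\<lambda>t. u t * (deriv ^^ 2) \<phi> t) = (- 1) ^ 2 * integral {a..b} (\<lambda>t. v t * \<phi> t)"
      using ac2_by_parts(1)[OF u d2(1) d3(2)] ac2_by_parts(2)[OF u d1(1) d2(2)] d1(3,4) d2(3,4)
      by (simp add: numeral_2_eq_2)
  qed
qed

lemma ac2_imp_W22:
  assumes u: "ac2 a b u u' v"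
  shows "u \<in> W22 a b"
proof -
  have "C1_on a b u" unfolding C1_on_def using ac2D(3)[OF u] ac2_continuous(2)[OF u] by blast
  moreover have "\<exists>v. L2_on {a<..<b} v \<and> weak_deriv k a b u v" if "k \<le> 2" for k
  proof -
    from that have "k = 0 \<or> k = 1 \<or> k = 2" by auto
    then show ?thesis using ac2_weak_deriv[OF u] ac2_L2[OF u] by metis
  qed
  ultimately show ?thesis by (simp add: W22_def)
qed

section \<open>The fundamental lemma of the calculus of variations\<close>

text \<open>The polynomial argument closes this family of functions, flat at 0, under
  differentiation: the derivative replaces p by X^2 (p - p').\<close>

definition flat_exp :: "real poly \<Rightarrow> real \<Rightarrow> real" where
  "flat_exp p t = (if t > 0 then poly p (1 / t) * exp (- (1 / t)) else 0)"

text \<open>The free exponent \<open>k\<close> is for the induction: splitting off the constant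
  coefficient of the polynomial costs one more factor \<open>u\<close>.\<close>

lemma power_poly_over_exp_tendsto_0:
  "((\<lambda>u::real. u ^ k * poly p u / exp u) \<longlongrightarrow> 0) at_top"
proof (induction p arbitrary: k)
  case 0
  then show ?case by simp
next
  case (pCons a p)
  have "((\<lambda>u. a * (u ^ k / exp u) + u ^ Suc k * poly p u / exp u) \<longlongrightarrow> a * 0 + 0) at_top"
    by (intro tendsto_intros tendsto_power_div_exp_0 pCons.IH)
  then show ?case by (simp add: field_simps)
qed

text \<open>Only 0 is delicate: from the right, with u = 1/h, the difference quotient is u p(u)
  exp(-u), which tends to 0; from the left it is 0.\<close>

lemma flat_exp_deriv:
  "(flat_exp p has_real_derivative flat_exp ([:0, 0, 1:] * (p - pderiv p)) t) (at t)"
proof -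
  consider "t > 0" | "t < 0" | "t = 0" by linarith
  then show ?thesis
  proof cases
    case 1
    have "((\<lambda>s. poly p (1 / s) * exp (- (1 / s))) has_real_derivative
        flat_exp ([:0, 0, 1:] * (p - pderiv p)) t) (at t)"
      using 1 by (auto intro!: derivative_eq_intros DERIV_chain2[OF poly_DERIV]
          simp: flat_exp_def field_simps power2_eq_square)
    then show ?thesis
      by (rule has_field_derivative_transform_within_open[where S="{0<..}"]) (use 1 in \<open>auto simp: flat_exp_def\<close>)
  next
    case 2
    have "((\<lambda>s. 0) has_real_derivative 0) (at t)" by simp
    then have "(flat_exp p has_real_derivative 0) (at t)"
      by (rule has_field_derivative_transform_within_open[where S="{..<0}"]) (use 2 in \<open>auto simp: flat_exp_def\<close>)
    then show ?thesis using 2 by (simp add: flat_exp_def)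
  next
    case 3
    have "((\<lambda>h. (1 / h) ^ 1 * poly p (1 / h) / exp (1 / h)) \<longlongrightarrow> 0) (at_right (0::real))"
      using filterlim_compose[OF power_poly_over_exp_tendsto_0 filterlim_inverse_at_top_right, of 1 p]
      by (simp add: inverse_eq_divide)
    then have "((\<lambda>h. flat_exp p h / h) \<longlongrightarrow> 0) (at_right 0)"
      by (rule Lim_transform_eventually)
        (auto simp: eventually_at_filter flat_exp_def exp_minus field_simps)
    moreover have "((\<lambda>h. flat_exp p h / h) \<longlongrightarrow> 0) (at_left 0)"
      by (rule Lim_transform_eventually[OF tendsto_const]) (auto simp: eventually_at_filter flat_exp_def)
    ultimately have "((\<lambda>h. flat_exp p h / h) \<longlongrightarrow> 0) (at 0)"
      by (simp add: filterlim_split_at)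
    then show ?thesis using 3 by (simp add: has_field_derivative_iff flat_exp_def)
  qed
qed

text \<open>A test function needs all its iterated derivatives to be differentiable. It is enough
  that its first derivative lies in a class of differentiable functions closed under
  \<open>deriv\<close>; this algebra is such a class and contains the shifted bumps.\<close>

inductive smooth_alg :: "(real \<Rightarrow> real) \<Rightarrow> bool" where
  flat: "smooth_alg (\<lambda>t. flat_exp p (c * t + e))"
| const: "smooth_alg (\<lambda>t. c)"
| add: "smooth_alg f \<Longrightarrow> smooth_alg g \<Longrightarrow> smooth_alg (\<lambda>t. f t + g t)"
| mult: "smooth_alg f \<Longrightarrow> smooth_alg g \<Longrightarrow> smooth_alg (\<lambda>t. f t * g t)"

lemma smooth_alg_has_deriv:
  assumes "smooth_alg f"
  shows "\<exists>g. smooth_alg g \<and> (\<forall>t. (f has_real_derivative g t) (at t))"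
  using assms
proof induction
  case (flat p c e)
  let ?q = "[:0, 0, 1:] * (p - pderiv p)"
  have "((\<lambda>t. flat_exp p (c * t + e)) has_real_derivative flat_exp ?q (c * t + e) * c) (at t)" for t
    by (rule DERIV_chain2[OF flat_exp_deriv]) (auto intro!: derivative_eq_intros)
  moreover have "smooth_alg (\<lambda>t. flat_exp ?q (c * t + e) * c)"
    by (intro smooth_alg.intros)
  ultimately show ?case by blast
next
  case (const c)
  have "smooth_alg (\<lambda>t. 0)" "\<forall>t. ((\<lambda>t. c) has_real_derivative 0) (at t)" by (auto intro: smooth_alg.intros)
  then show ?case by blast
next
  case (add f g)
  then obtain f' g' where "smooth_alg f'" "smooth_alg g'"
    "\<And>t. (f has_real_derivative f' t) (at t)" "\<And>t. (g has_real_derivative g' t) (at t)" by blast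
  then have "smooth_alg (\<lambda>t. f' t + g' t)" "\<forall>t. ((\<lambda>t. f t + g t) has_real_derivative f' t + g' t) (at t)"
    by (auto intro!: smooth_alg.intros derivative_intros)
  then show ?case by blast
next
  case (mult f g)
  then obtain f' g' where "smooth_alg f'" "smooth_alg g'"
    "\<And>t. (f has_real_derivative f' t) (at t)" "\<And>t. (g has_real_derivative g' t) (at t)" by blast
  then have "smooth_alg (\<lambda>t. f' t * g t + g' t * f t)"
    "\<forall>t. ((\<lambda>t. f t * g t) has_real_derivative f' t * g t + g' t * f t) (at t)"
    using mult.hyps by (auto intro!: smooth_alg.intros derivative_eq_intros)
  then show ?case by blast
qed

lemma smooth_alg_deriv:
  assumes "smooth_alg f"
  shows "smooth_alg (deriv f)" "f field_differentiable (at t)"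
proof -
  obtain g where g: "smooth_alg g" "\<And>t. (f has_real_derivative g t) (at t)"
    using smooth_alg_has_deriv[OF assms] by blast
  then have "deriv f = g" by (auto intro!: DERIV_imp_deriv)
  then show "smooth_alg (deriv f)" using g by simp
  show "f field_differentiable (at t)" using g(2) field_differentiable_def by blast
qed

lemma smooth_alg_funpow_deriv: "smooth_alg f \<Longrightarrow> smooth_alg ((deriv ^^ k) f)"
  by (induction k) (auto intro: smooth_alg_deriv)

definition bump :: "real \<Rightarrow> real \<Rightarrow> real" where
  "bump r t = flat_exp 1 (t + r) * flat_exp 1 (r - t)"

lemma bump_nonneg: "0 \<le> bump r t" by (simp add: bump_def flat_exp_def)

lemma bump_pos: "- r < t \<Longrightarrow> t < r \<Longrightarrow> 0 < bump r t" by (simp add: bump_def flat_exp_def)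

lemma bump_zero: "t \<le> - r \<or> r \<le> t \<Longrightarrow> bump r t = 0" by (auto simp: bump_def flat_exp_def)

lemma smooth_alg_bump: "smooth_alg (\<lambda>t. bump r (t - x))"
proof -
  have "smooth_alg (\<lambda>t. flat_exp 1 (1 * t + (r - x)) * flat_exp 1 ((- 1) * t + (r + x)))"
    by (intro smooth_alg.intros)
  then show ?thesis by (simp add: bump_def algebra_simps)
qed

lemma continuous_on_bump: "continuous_on S (\<lambda>t. bump r (t - x))"
  by (intro continuous_at_imp_continuous_on ballI field_differentiable_imp_continuous_at
      smooth_alg_deriv(2) smooth_alg_bump)

text \<open>\<open>H\<close> is a smooth step from 0 up to \<open>H r\<close>. A difference of two
  shifted steps has compact support, and its derivative is a difference of two bumps.\<close>

lemma bump_antiderivative: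
  assumes "r > 0"
  obtains H where "\<And>t. (H has_real_derivative bump r t) (at t)" "\<And>t. t \<le> - r \<Longrightarrow> H t = 0"
    "\<And>t. r \<le> t \<Longrightarrow> H t = H r" "H r > 0"
proof -
  \<comment> \<open>Starting the integral at -r - 1 keeps t = -r in the interior, so the derivative
    there is two-sided.\<close>
  define H where "H t = integral {- r - 1..t} (bump r)" for t
  have c: "continuous_on S (bump r)" for S using continuous_on_bump[of S r 0] by simp
  have H0: "H t = 0" if "t \<le> - r" for t
  proof -
    have "H t = integral {- r - 1..t} (\<lambda>_. 0)"
      unfolding H_def using that by (intro Henstock_Kurzweil_Integration.integral_cong bump_zero) auto
    then show ?thesis by simp
  qed
  have d: "(H has_real_derivative bump r t) (at t)" for t
  proof (cases "t < - r")
    case True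
    have "((\<lambda>s. 0) has_real_derivative 0) (at t)" by simp
    then have "(H has_real_derivative 0) (at t)"
      by (rule has_field_derivative_transform_within_open[where S="{..< - r}"]) (use True H0 in auto)
    then show ?thesis using True bump_zero[of t r] by simp
  next
    case False
    have "(H has_real_derivative bump r t) (at t within {- r - 1..t + 1})"
      unfolding H_def using False by (intro integral_has_real_derivative c) auto
    then have "(H has_real_derivative bump r t) (at t within {- r - 1<..<t + 1})"
      by (rule DERIV_subset) auto
    then show ?thesis using False by (subst (asm) at_within_open) auto
  qed
  moreover have "H t = H r" if "r \<le> t" for t
  proof (cases "t = r")
    case False
    then have "r < t" using that by simp
    then obtain z where "r < z" "z < t" "H t - H r = (t - r) * bump r z"
      using MVT2[of r t H "bump r"] d by blast
    then show ?thesis using bump_zero[of z r] by simp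
  qed simp
  moreover have "H r > 0"
  proof -
    obtain z where "- r < z" "z < r" "H r - H (- r) = (r - - r) * bump r z"
      using MVT2[of "- r" r H "bump r"] d assms by auto
    then show ?thesis using bump_pos[of r z] H0[of "- r"] assms by simp
  qed
  ultimately show ?thesis using H0 that by blast
qed

text \<open>The shifted bump has integral \<open>H r\<close> and vanishes at distance
  \<open>r\<close> or more from \<open>x\<close>, so only values of \<open>k\<close> close to
  \<open>k x\<close> are averaged.\<close>

lemma bump_average:
  assumes k: "continuous_on {a..b} k" and H: "\<And>t. (H has_real_derivative bump r t) (at t)"
    "\<And>t. t \<le> - r \<Longrightarrow> H t = 0" "\<And>t. r \<le> t \<Longrightarrow> H t = H r"
    and x: "a \<le> x - r" "x + r \<le> b" "r > 0"
    and close: "\<And>t. t \<in> {a..b} \<Longrightarrow> \<bar>t - x\<bar> < r \<Longrightarrow> \<bar>k t - k x\<bar> \<le> \<eta>"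
  shows "\<bar>integral {a..b} (\<lambda>t. k t * bump r (t - x)) - k x * H r\<bar> \<le> \<eta> * H r"
proof -
  have "((\<lambda>t. H (t - x)) has_real_derivative bump r (t - x) * (1 - 0)) (at t within {a..b})" for t
    by (intro DERIV_chain2[OF H(1)] derivative_intros)
  then have "((\<lambda>t. bump r (t - x)) has_integral (H (b - x) - H (a - x))) {a..b}"
    using x by (intro fundamental_theorem_of_calculus)
      (auto simp flip: has_real_derivative_iff_has_vector_derivative)
  moreover have "H (b - x) - H (a - x) = H r" using H(2)[of "a - x"] H(3)[of "b - x"] x by simp
  ultimately have I: "((\<lambda>t. bump r (t - x)) has_integral H r) {a..b}" by simp
  have i: "(\<lambda>t. k t * bump r (t - x)) integrable_on {a..b}"
    by (intro integrable_continuous_interval continuous_intros k continuous_on_bump)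
  have D: "((\<lambda>t. k t * bump r (t - x) - k x * bump r (t - x)) has_integral
      (integral {a..b} (\<lambda>t. k t * bump r (t - x)) - k x * H r)) {a..b}"
    by (intro has_integral_diff has_integral_mult_right I integrable_integral i)
  have "norm (integral {a..b} (\<lambda>t. k t * bump r (t - x) - k x * bump r (t - x)))
      \<le> integral {a..b} (\<lambda>t. \<eta> * bump r (t - x))"
  proof (rule integral_norm_bound_integral)
    show "(\<lambda>t. k t * bump r (t - x) - k x * bump r (t - x)) integrable_on {a..b}" using D by blast
    show "(\<lambda>t. \<eta> * bump r (t - x)) integrable_on {a..b}" using I by (intro integrable_on_mult_right) blast
    fix t assume t: "t \<in> {a..b}"
    show "norm (k t * bump r (t - x) - k x * bump r (t - x)) \<le> \<eta> * bump r (t - x)"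
    proof (cases "\<bar>t - x\<bar> < r")
      case True
      have "norm (k t * bump r (t - x) - k x * bump r (t - x)) = \<bar>k t - k x\<bar> * bump r (t - x)"
        using bump_nonneg[of r "t - x"] by (simp add: left_diff_distrib[symmetric] abs_mult)
      also have "\<dots> \<le> \<eta> * bump r (t - x)"
        using close[OF t True] by (intro mult_right_mono bump_nonneg)
      finally show ?thesis .
    next
      case False
      then have "bump r (t - x) = 0" by (intro bump_zero) auto
      then show ?thesis by simp
    qed
  qed
  then show ?thesis using D I by (simp add: integral_unique)
qed

text \<open>Since \<open>k\<close> is continuous, testing with a difference of two smooth steps
  suffices: the hypothesis then equates the bump averages of \<open>k\<close> around
  \<open>x\<close> and \<open>y\<close>, and these approximate multiples of \<open>k x\<close> and
  \<open>k y\<close> with the same factor.\<close>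

lemma du_Bois_Reymond:
  assumes k: "continuous_on {a..b} k"
    and test: "\<And>\<phi>. test_function a b \<phi> \<Longrightarrow> integral {a..b} (\<lambda>t. k t * deriv \<phi> t) = 0"
    and xy: "x \<in> {a<..<b}" "y \<in> {a<..<b}"
  shows "k x = k y"
proof -
  have "\<bar>k x - k y\<bar> \<le> 2 * \<eta>" if \<eta>: "\<eta> > 0" for \<eta>
  proof -
    obtain d1 where d1: "d1 > 0" "\<And>t. t \<in> {a..b} \<Longrightarrow> \<bar>t - x\<bar> < d1 \<Longrightarrow> \<bar>k t - k x\<bar> < \<eta>"
      using k xy(1) \<eta> unfolding continuous_on_iff dist_real_def by (metis greaterThanLessThan_subseteq_atLeastAtMost_iff in_mono order_refl)
    obtain d2 where d2: "d2 > 0" "\<And>t. t \<in> {a..b} \<Longrightarrow> \<bar>t - y\<bar> < d2 \<Longrightarrow> \<bar>k t - k y\<bar> < \<eta>"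
      using k xy(2) \<eta> unfolding continuous_on_iff dist_real_def by (metis greaterThanLessThan_subseteq_atLeastAtMost_iff in_mono order_refl)
    \<comment> \<open>Half the minimum, so that both bumps lie strictly inside the interval and
      within the radii of continuity.\<close>
    define r where "r = Min {d1, d2, x - a, b - x, y - a, b - y} / 2"
    have e0: "0 < r" using d1 d2 xy by (simp add: r_def)
    have e: "r < d1" "r < d2" "r < x - a" "r < b - x" "r < y - a" "r < b - y"
      using d1(1) d2(1) xy unfolding r_def by (auto simp: min_def)
    obtain H where H: "\<And>t. (H has_real_derivative bump r t) (at t)" "\<And>t. t \<le> - r \<Longrightarrow> H t = 0"
      "\<And>t. r \<le> t \<Longrightarrow> H t = H r" "H r > 0" using bump_antiderivative[OF e0] by blast
    define \<phi> where "\<phi> t = H (t - x) - H (t - y)" for t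
    have "(\<phi> has_real_derivative (bump r (t - x) * (1 - 0) - bump r (t - y) * (1 - 0))) (at t)" for t
      unfolding \<phi>_def by (intro DERIV_diff DERIV_chain2[OF H(1)] derivative_intros)
    then have d\<phi>: "(\<phi> has_real_derivative (bump r (t - x) - bump r (t - y))) (at t)" for t by simp
    then have der: "deriv \<phi> = (\<lambda>t. bump r (t - x) + (- 1) * bump r (t - y))"
      by (auto intro!: DERIV_imp_deriv)
    have "smooth_alg (deriv \<phi>)" unfolding der by (intro smooth_alg.intros smooth_alg_bump)
    then have "(deriv ^^ Suc k) \<phi> field_differentiable (at t)" for k t
      unfolding funpow_Suc_right o_def by (intro smooth_alg_deriv(2) smooth_alg_funpow_deriv)
    moreover have "\<phi> field_differentiable (at t)" for t using d\<phi> field_differentiable_def by blast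
    ultimately have "(deriv ^^ k) \<phi> field_differentiable (at t)" for k t by (cases k) auto
    moreover have "a < min x y - r" "min x y - r < max x y + r" "max x y + r < b"
      using e e0 by (auto simp: min_def max_def)
    moreover have "\<phi> t = 0" if "t \<notin> {min x y - r..max x y + r}" for t
    proof -
      have "(t - x \<le> - r \<and> t - y \<le> - r) \<or> (r \<le> t - x \<and> r \<le> t - y)" using that by auto
      then show ?thesis unfolding \<phi>_def using H(2)[of "t - x"] H(2)[of "t - y"] H(3)[of "t - x"] H(3)[of "t - y"] by auto
    qed
    ultimately have "test_function a b \<phi>" unfolding test_function_def by blast
    then have "integral {a..b} (\<lambda>t. k t * deriv \<phi> t) = 0" by (rule test)
    then have "integral {a..b} (\<lambda>t. k t * bump r (t - x) - k t * bump r (t - y)) = 0"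
      by (simp add: der algebra_simps)
    moreover have i: "(\<lambda>t. k t * bump r (t - z)) integrable_on {a..b}" for z
      by (intro integrable_continuous_interval continuous_intros k continuous_on_bump)
    ultimately have eq: "integral {a..b} (\<lambda>t. k t * bump r (t - x)) = integral {a..b} (\<lambda>t. k t * bump r (t - y))"
      using integral_diff[OF i i, of x y] by simp
    have "\<bar>integral {a..b} (\<lambda>t. k t * bump r (t - x)) - k x * H r\<bar> \<le> \<eta> * H r"
      using e d1(2) e0 by (intro bump_average k H) (auto intro: less_imp_le)
    moreover have "\<bar>integral {a..b} (\<lambda>t. k t * bump r (t - y)) - k y * H r\<bar> \<le> \<eta> * H r"
      using e d2(2) e0 by (intro bump_average k H) (auto intro: less_imp_le)
    ultimately have "\<bar>k x * H r - k y * H r\<bar> \<le> (2 * \<eta>) * H r" using eq by linarith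
    then have "\<bar>k x - k y\<bar> * H r \<le> (2 * \<eta>) * H r"
      using H(4) by (simp add: left_diff_distrib[symmetric] abs_mult)
    then show ?thesis using H(4) by simp
  qed
  \<comment> \<open>With this tolerance the bound reads |k x - k y| \<le> |k x - k y| / 2.\<close>
  from this[of "\<bar>k x - k y\<bar> / 4"] show ?thesis by (cases "k x = k y") auto
qed

text \<open>With \<open>V\<close> the indefinite integral of the weak second derivative, integration
  by parts turns the weak identity into a vanishing integral of (u' - V) \<phi>' for every test
  function \<phi>. So u' - V is constant on the open interval, and by continuity also up to the end
  points.\<close>

lemma W22_imp_ac2:
  assumes u: "u \<in> W22 a b" and ab: "a < b"
  shows "\<exists>u'. ac2 a b u u' (second_weak_deriv a b u)"
proof -
  let ?v = "second_weak_deriv a b u"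
  have "\<exists>v. L2_on {a<..<b} v \<and> weak_deriv 2 a b u v" using u by (simp add: W22_def)
  then have v: "L2_on {a<..<b} ?v" "weak_deriv 2 a b u ?v"
    unfolding second_weak_deriv_def by (metis (mono_tags, lifting) someI_ex)+
  obtain u' where u': "\<And>t. t \<in> {a..b} \<Longrightarrow> (u has_real_derivative u' t) (at t within {a..b})"
    "continuous_on {a..b} u'" using u unfolding W22_def C1_on_def by blast
  have uc: "continuous_on {a..b} u" using u'(1) by (rule DERIV_continuous_on)
  have va: "?v absolutely_integrable_on {a..b}" by (rule L2_on_abs_integrable[OF v(1)])
  define V where "V x = integral {a..x} ?v" for x
  have Vc: "continuous_on {a..b} V"
    unfolding V_def by (intro indefinite_integral_continuous_1 set_lebesgue_integral_eq_integral(1)[OF va])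
  define k where "k x = u' x - V x" for x
  have kc: "continuous_on {a..b} k" unfolding k_def by (intro continuous_intros u' Vc)
  have "integral {a..b} (\<lambda>t. k t * deriv \<phi> t) = 0" if t: "test_function a b \<phi>" for \<phi>
  proof -
    note d1 = test_functionD[OF t] and d2 = test_functionD[OF test_function_deriv[OF t]]
      and d3 = test_functionD[OF test_function_deriv[OF test_function_deriv[OF t]]]
    have uI: "u t = u a + integral {a..t} u'" if "t \<in> {a..b}" for t
      using DERIV_within_closed_integral[of a b u u' a t] u'(1) that ab by (simp add: integral_unique)
    have "integral {a..b} (\<lambda>t. u t * deriv (deriv \<phi>) t)
        = u b * deriv \<phi> b - u a * deriv \<phi> a - integral {a..b} (\<lambda>t. u' t * deriv \<phi> t)"
      by (intro integral_by_parts_indefinite absolutely_integrable_continuous_real d2 d3 uI u'(2) less_imp_le[OF ab])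
    moreover have "integral {a..b} (\<lambda>t. V t * deriv \<phi> t) = V b * \<phi> b - V a * \<phi> a - integral {a..b} (\<lambda>t. ?v t * \<phi> t)"
      using ab va by (intro integral_by_parts_indefinite d1 d2) (auto simp: V_def)
    moreover have "integral {a..b} (\<lambda>t. u t * (deriv ^^ 2) \<phi> t) = (- 1) ^ 2 * integral {a..b} (\<lambda>t. ?v t * \<phi> t)"
      using v(2) t unfolding weak_deriv_L2_iff[OF L2_on_continuous[OF uc] v(1)] by blast
    ultimately have "integral {a..b} (\<lambda>t. u' t * deriv \<phi> t) = integral {a..b} (\<lambda>t. V t * deriv \<phi> t)"
      using d1 d2 by (simp add: numeral_2_eq_2)
    moreover have "(\<lambda>t. u' t * deriv \<phi> t) integrable_on {a..b}" "(\<lambda>t. V t * deriv \<phi> t) integrable_on {a..b}"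
      by (intro integrable_continuous_interval continuous_intros u' Vc d2)+
    ultimately show ?thesis by (simp add: k_def left_diff_distrib integral_diff)
  qed
  then have const: "k x = k y" if "x \<in> {a<..<b}" "y \<in> {a<..<b}" for x y
    using du_Bois_Reymond[OF kc _ that] by blast
  let ?m = "(a + b) / 2"
  have "k x = k ?m" if "x \<in> {a..b}" for x
  proof (rule continuous_constant_on_closure[of "{a<..<b}" k "k ?m" x])
    show "continuous_on (closure {a<..<b}) k" using kc ab by simp
    show "k y = k ?m" if "y \<in> {a<..<b}" for y using const[OF that, of ?m] ab by simp
    show "x \<in> closure {a<..<b}" using that ab by simp
  qed
  then have "k x = k a" if "x \<in> {a..b}" for x using that ab by (metis atLeastAtMost_iff less_imp_le order_refl)
  moreover have "V a = 0" by (simp add: V_def)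
  ultimately have "u' x = u' a + V x" if "x \<in> {a..b}" for x using that unfolding k_def by fastforce
  then show ?thesis unfolding ac2_def V_def using ab v(1) u'(1) by blast
qed

text \<open>\<open>second_weak_deriv\<close> is an arbitrary choice. The chosen function and
  \<open>v\<close> have the same indefinite integral, because the classical derivative of
  \<open>u\<close> is unique; hence they agree almost everywhere.\<close>

lemma ac2_L2_norm_second_weak_deriv:
  assumes u: "ac2 a b u u' v"
  shows "L2_norm_on {a<..<b} (second_weak_deriv a b u) = L2_norm_on {a<..<b} v"
proof -
  let ?v = "second_weak_deriv a b u"
  obtain w where w: "ac2 a b u w ?v"
    using W22_imp_ac2[OF ac2_imp_W22[OF u] ac2D(1)[OF u]] by blast
  note ab = ac2D(1)[OF u]
  have "w t = u' t" if "t \<in> {a..b}" for t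
  proof -
    have "(u has_vector_derivative w t) (at t within {a..b})" "(u has_vector_derivative u' t) (at t within {a..b})"
      using ac2D(3)[OF u that] ac2D(3)[OF w that] by (auto simp flip: has_real_derivative_iff_has_vector_derivative)
    then show ?thesis using vector_derivative_unique_within_closed_interval[OF ab] that by (metis box_real(2))
  qed
  then have "integral {a..x} (\<lambda>t. ?v t - v t) = 0" if "x \<in> {a..b}" for x
    using has_integral_diff[OF ac2_integral[OF w, of a x] ac2_integral[OF u, of a x]] that by (auto intro!: integral_unique)
  then have "AE t in lebesgue. t \<in> {a..b} \<longrightarrow> ?v t - v t = 0"
    using L2_on_abs_integrable[OF ac2D(2)[OF u]] L2_on_abs_integrable[OF ac2D(2)[OF w]]
    by (intro AE_zero_if_indefinite_integral_zero set_integral_diff) auto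
  then have "AE t in lebesgue_on {a<..<b}. ?v t = v t"
    by (subst AE_restrict_space_iff) (auto elim!: eventually_mono)
  then have "(LINT t|lebesgue_on {a<..<b}. (?v t)\<^sup>2) = (LINT t|lebesgue_on {a<..<b}. (v t)\<^sup>2)"
    using ac2D(2)[OF u] ac2D(2)[OF w] by (intro integral_cong_AE) (auto simp: L2_on_def)
  then show ?thesis by (simp add: L2_norm_on_def)
qed

section \<open>Orthonormal systems and the truncated power basis\<close>

text \<open>Coefficient vectors are total functions on the naturals, while the forms in use read
  finitely many coordinates; such forms have null vectors and are only semidefinite.\<close>

definition psd_form :: "((nat \<Rightarrow> real) \<Rightarrow> (nat \<Rightarrow> real) \<Rightarrow> real) \<Rightarrow> bool" where
  "psd_form A \<longleftrightarrow> (\<forall>u v. A u v = A v u) \<and> (\<forall>u. 0 \<le> A u u) \<and>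
     (\<forall>u v w c. A (\<lambda>i. u i + c * v i) w = A u w + c * A v w)"

definition linear_functional :: "((nat \<Rightarrow> real) \<Rightarrow> real) \<Rightarrow> bool" where
  "linear_functional l \<longleftrightarrow> (\<forall>u v c. l (\<lambda>i. u i + c * v i) = l u + c * l v)"

lemma psd_formD:
  assumes "psd_form A"
  shows "A u v = A v u" "0 \<le> A u u" "A (\<lambda>i. u i + c * v i) w = A u w + c * A v w"
    "A w (\<lambda>i. u i + c * v i) = A w u + c * A w v" "linear_functional (A u)"
  using assms unfolding psd_form_def linear_functional_def by metis+

lemma linear_functional_add: "linear_functional l \<Longrightarrow> l (\<lambda>i. u i + c * v i) = l u + c * l v"
  by (simp add: linear_functional_def)

lemma linear_functional_zero: "linear_functional l \<Longrightarrow> l (\<lambda>i. 0) = 0"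
  using linear_functional_add[of l "\<lambda>i. 0" "- 1" "\<lambda>i. 0"] by simp

lemma linear_functional_sum:
  assumes "linear_functional l" "finite K"
  shows "l (\<lambda>i. \<Sum>k\<in>K. x k * c k i) = (\<Sum>k\<in>K. x k * l (c k))"
  using assms(2)
proof (induction K)
  case empty
  then show ?case using linear_functional_zero[OF assms(1)] by simp
next
  case (insert k K)
  then have "l (\<lambda>i. \<Sum>k\<in>insert k K. x k * c k i) = l (\<lambda>i. (\<Sum>k\<in>K. x k * c k i) + x k * c k i)"
    by (simp add: add.commute)
  also have "\<dots> = (\<Sum>k\<in>K. x k * l (c k)) + x k * l (c k)"
    using linear_functional_add[OF assms(1), of "\<lambda>i. \<Sum>k\<in>K. x k * c k i"] insert.IH by simp
  finally show ?case using insert.hyps by simp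
qed

lemma psd_form_expand:
  assumes "psd_form A"
  shows "A (\<lambda>i. u i + c * v i) (\<lambda>i. u i + c * v i) = A u u + 2 * c * A u v + c\<^sup>2 * A v v"
  using psd_formD(1)[OF assms, of v u]
  by (simp add: psd_formD(3,4)[OF assms] power2_eq_square algebra_simps)

lemma psd_form_null:
  assumes "psd_form A" "A r r = 0"
  shows "A v r = 0"
proof -
  have "(A v r)\<^sup>2 \<le> A v v * A r r"
    using psd_form_expand[OF assms(1), of v _ r] psd_formD(2)[OF assms(1)]
    by (intro quadratic_discriminant) metis+
  then show ?thesis using assms(2) by simp
qed

text \<open>With a semidefinite form a vector equals its expansion only up to a null vector. The
  expansion is therefore stated after applying a linear functional that vanishes on null vectors,
  for which the difference is invisible.\<close>

lemma gram_schmidt: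
  fixes b :: "nat \<Rightarrow> nat \<Rightarrow> real" and n :: nat
  assumes A: "psd_form A"
  shows "\<exists>m\<le>n. \<exists>c. (\<forall>k<m. \<forall>l<m. A (c k) (c l) = (if k = l then 1 else 0)) \<and>
    (\<forall>l. linear_functional l \<longrightarrow> (\<forall>r. A r r = 0 \<longrightarrow> l r = 0) \<longrightarrow>
       (\<forall>j<n. l (b j) = (\<Sum>k<m. A (b j) (c k) * l (c k))))"
proof (induction n)
  case 0
  show ?case by (intro exI[of _ 0]) simp
next
  case (Suc n)
  then obtain m c where m: "m \<le> n"
    and orth: "\<And>k l. k < m \<Longrightarrow> l < m \<Longrightarrow> A (c k) (c l) = (if k = l then 1 else 0)"
    and rep: "\<And>l j. linear_functional l \<Longrightarrow> (\<And>r. A r r = 0 \<Longrightarrow> l r = 0) \<Longrightarrow> j < n \<Longrightarrow>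
       l (b j) = (\<Sum>k<m. A (b j) (c k) * l (c k))" by blast
  \<comment> \<open>Residual of the new vector after projection onto the earlier ones. If it is null
    the system stays as it is, otherwise it is normalized and appended.\<close>
  define r where "r i = b n i + (- 1) * (\<Sum>k<m. A (b n) (c k) * c k i)" for i
  have lr: "l r = l (b n) - (\<Sum>k<m. A (b n) (c k) * l (c k))" if l: "linear_functional l" for l
    unfolding r_def linear_functional_add[OF l] linear_functional_sum[OF l finite_lessThan] by simp
  show ?case
  proof (cases "A r r = 0")
    case True
    have "l (b j) = (\<Sum>k<m. A (b j) (c k) * l (c k))"
      if "linear_functional l" "\<And>r. A r r = 0 \<Longrightarrow> l r = 0" "j < Suc n" for l j
      using rep[OF that(1,2), of j] lr[OF that(1)] that(2)[OF True] that(3) by (cases "j = n") auto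
    then show ?thesis using m orth by (intro exI[of _ m] conjI exI[of _ c]) auto
  next
    case False
    then have pos: "A r r > 0" using psd_formD(2)[OF A, of r] by simp
    define s where "s = sqrt (A r r)"
    have s: "s > 0" "s * s = A r r" using pos by (auto simp: s_def)
    define c' where "c' = c(m := (\<lambda>i. 0 + (1 / s) * r i))"
    have c'm: "l (c' m) = l r / s" if "linear_functional l" for l
      using linear_functional_add[OF that, of "\<lambda>i. 0" "1 / s" r] linear_functional_zero[OF that] by (simp add: c'_def)
    have c'k: "c' k = c k" if "k < m" for k using that by (simp add: c'_def)
    have Ar: "A (c k) r = 0" if "k < m" for k
    proof -
      have "A (c k) r = A (c k) (b n) - (\<Sum>l<m. A (b n) (c l) * A (c k) (c l))"
        by (rule lr[OF psd_formD(5)[OF A]])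
      also have "(\<Sum>l<m. A (b n) (c l) * A (c k) (c l)) = (\<Sum>l<m. if l = k then A (b n) (c l) else 0)"
        using orth that by (intro sum.cong) auto
      finally show ?thesis using that psd_formD(1)[OF A, of "b n"] by simp
    qed
    have Arr: "A r (c' m) = s" using c'm[OF psd_formD(5)[OF A, of r]] s(1) by (simp add: s(2)[symmetric])
    have "A (c' k) (c' l) = (if k = l then 1 else 0)" if kl: "k < Suc m" "l < Suc m" for k l
    proof -
      have 1: "A (c k) (c' m) = 0" if "k < m" for k
        using c'm[OF psd_formD(5)[OF A, of "c k"]] Ar[OF that] by simp
      have 2: "A (c' m) (c' m) = 1"
        using c'm[OF psd_formD(5)[OF A, of "c' m"]] psd_formD(1)[OF A, of "c' m" r] Arr s by simp
      have 3: "A (c' m) (c k) = 0" if "k < m" for k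
        using 1[OF that] psd_formD(1)[OF A, of "c' m" "c k"] by simp
      consider "k < m" "l < m" | "k < m" "l = m" | "k = m" "l < m" | "k = m" "l = m"
        using kl by (auto simp: less_Suc_eq)
      then show ?thesis using 1 2 3 orth c'k by cases auto
    qed
    moreover have "l (b j) = (\<Sum>k<Suc m. A (b j) (c' k) * l (c' k))"
      if l: "linear_functional l" "\<And>r. A r r = 0 \<Longrightarrow> l r = 0" and j: "j < Suc n" for l j
    proof (cases "j = n")
      case True
      have "A (c' m) r = A (c' m) (b n) - (\<Sum>k<m. A (b n) (c k) * A (c' m) (c k))"
        by (rule lr[OF psd_formD(5)[OF A]])
      moreover have "A (c' m) (c k) = 0" if "k < m" for k
        using c'm[OF psd_formD(5)[OF A, of "c k"]] Ar[OF that] psd_formD(1)[OF A, of "c' m" "c k"] by simp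
      ultimately have "A (b n) (c' m) = s"
        using Arr psd_formD(1)[OF A, of "c' m" r] psd_formD(1)[OF A, of "c' m" "b n"] by simp
      then have "A (b n) (c' m) * l (c' m) = l r" using c'm[OF l(1)] s(1) by simp
      then show ?thesis using lr[OF l(1)] True c'k by simp
    next
      case False
      then have jn: "j < n" using j by simp
      \<comment> \<open>Earlier vectors expand in the \<open>c k\<close> with k < m, to which
        \<open>r\<close> is orthogonal, so the new member adds nothing to their expansions.\<close>
      have "A r (b j) = (\<Sum>k<m. A (b j) (c k) * A r (c k))"
        by (rule rep[OF psd_formD(5)[OF A] _ jn]) (rule psd_form_null[OF A])
      then have "A (b j) r = 0" using Ar psd_formD(1)[OF A, of r "c _"] psd_formD(1)[OF A, of r "b j"] by simp
      then have "A (b j) (c' m) = 0" using c'm[OF psd_formD(5)[OF A, of "b j"]] by simp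
      then show ?thesis using rep[OF l jn] c'k by simp
    qed
    ultimately show ?thesis using m by (intro exI[of _ "Suc m"] conjI exI[of _ c']) auto
  qed
qed

text \<open>The second conjunct is completeness modulo null vectors; with the functional
  \<open>A u\<close> it becomes Parseval's identity.\<close>

definition orthonormal_system ::
    "((nat \<Rightarrow> real) \<Rightarrow> (nat \<Rightarrow> real) \<Rightarrow> real) \<Rightarrow> nat \<Rightarrow> (nat \<Rightarrow> nat \<Rightarrow> real) \<Rightarrow> bool" where
  "orthonormal_system A m c \<longleftrightarrow> (\<forall>k<m. \<forall>l<m. A (c k) (c l) = (if k = l then 1 else 0)) \<and>
    (\<forall>l. linear_functional l \<longrightarrow> (\<forall>r. A r r = 0 \<longrightarrow> l r = 0) \<longrightarrow>
       (\<forall>v. l v = (\<Sum>k<m. A v (c k) * l (c k))))"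

lemma orthonormal_systemD:
  assumes "orthonormal_system A m c"
  shows "k < m \<Longrightarrow> l < m \<Longrightarrow> A (c k) (c l) = (if k = l then 1 else 0)"
    "linear_functional h \<Longrightarrow> (\<And>r. A r r = 0 \<Longrightarrow> h r = 0) \<Longrightarrow> h v = (\<Sum>k<m. A v (c k) * h (c k))"
  using assms unfolding orthonormal_system_def by simp_all

text \<open>By \<open>dep\<close>, vectors that vanish in the first \<open>n\<close> coordinates are
  null, so the first \<open>n\<close> unit vectors span everything up to null vectors. The bound on
  \<open>m\<close> later limits the trace in the noise estimate.\<close>

lemma orthonormal_system_exists:
  assumes A: "psd_form A" and dep: "\<And>u. (\<And>i. i < n \<Longrightarrow> u i = 0) \<Longrightarrow> A u u = 0"
  obtains m c where "m \<le> n" "orthonormal_system A m c"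
proof -
  define e :: "nat \<Rightarrow> nat \<Rightarrow> real" where "e j i = (if i = j then 1 else 0)" for i j
  obtain m c where m: "m \<le> n"
    and orth: "\<forall>k<m. \<forall>l<m. A (c k) (c l) = (if k = l then 1 else 0)"
    and rep: "\<And>l j. linear_functional l \<Longrightarrow> (\<And>r. A r r = 0 \<Longrightarrow> l r = 0) \<Longrightarrow> j < n \<Longrightarrow>
       l (e j) = (\<Sum>k<m. A (e j) (c k) * l (c k))"
    using gram_schmidt[OF A, of n e] by blast
  have "l v = (\<Sum>k<m. A v (c k) * l (c k))"
    if l: "linear_functional l" "\<And>r. A r r = 0 \<Longrightarrow> l r = 0" for l v
  proof -
    have coord: "h v = (\<Sum>j<n. v j * h (e j))" if h: "linear_functional h" "\<And>r. A r r = 0 \<Longrightarrow> h r = 0" for h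
    proof -
      define w where "w i = v i + (- 1) * (\<Sum>j<n. v j * e j i)" for i
      have "w i = 0" if "i < n" for i
      proof -
        have "(\<Sum>j<n. v j * e j i) = (\<Sum>j<n. if j = i then v j else 0)" by (intro sum.cong) (auto simp: e_def)
        then show ?thesis using that by (simp add: w_def)
      qed
      then have "A w w = 0" by (rule dep)
      then have "h w = 0" by (rule h(2))
      then show ?thesis
        unfolding w_def linear_functional_add[OF h(1)] linear_functional_sum[OF h(1) finite_lessThan] by simp
    qed
    have "A (c k) v = (\<Sum>j<n. v j * A (c k) (e j))" for k
      by (rule coord[OF psd_formD(5)[OF A]]) (rule psd_form_null[OF A])
    then have Ac: "A v (c k) = (\<Sum>j<n. v j * A (e j) (c k))" for k
      using psd_formD(1)[OF A, of "c k" v] psd_formD(1)[OF A, of "c k" "e _"] by simp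
    have "l v = (\<Sum>j<n. v j * (\<Sum>k<m. A (e j) (c k) * l (c k)))"
      by (rule trans[OF coord[OF l]]) (auto intro!: sum.cong rep[OF l])
    also have "\<dots> = (\<Sum>j<n. \<Sum>k<m. v j * A (e j) (c k) * l (c k))"
      by (simp add: sum_distrib_left mult.assoc)
    also have "\<dots> = (\<Sum>k<m. \<Sum>j<n. v j * A (e j) (c k) * l (c k))" by (rule sum.swap)
    also have "\<dots> = (\<Sum>k<m. A v (c k) * l (c k))" by (simp add: Ac sum_distrib_right)
    finally show ?thesis .
  qed
  then show ?thesis using that m orth unfolding orthonormal_system_def by blast
qed

section \<open>Cubic splines in the truncated power basis\<close>

definition spline_basis :: "nat \<Rightarrow> nat \<Rightarrow> real \<Rightarrow> real" where
  "spline_basis M k t = (if k < 4 then t ^ k else (max 0 (t - real (k - 3) / real M)) ^ 3)"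

definition spline_basis1 :: "nat \<Rightarrow> nat \<Rightarrow> real \<Rightarrow> real" where
  "spline_basis1 M k t = (if k < 4 then real k * t ^ (k - 1) else 3 * (max 0 (t - real (k - 3) / real M))\<^sup>2)"

definition spline_basis2 :: "nat \<Rightarrow> nat \<Rightarrow> real \<Rightarrow> real" where
  "spline_basis2 M k t = (if k < 4 then real k * (real (k - 1) * t ^ (k - 2)) else 6 * max 0 (t - real (k - 3) / real M))"

text \<open>The indices count four monomials and one truncated cube for each interior knot 1/M, ...,
  (M-1)/M: M + 3 functions in all.\<close>

definition spl :: "nat \<Rightarrow> (nat \<Rightarrow> real) \<Rightarrow> real \<Rightarrow> real" where
  "spl M a t = (\<Sum>k<M + 3. a k * spline_basis M k t)"

definition spl1 :: "nat \<Rightarrow> (nat \<Rightarrow> real) \<Rightarrow> real \<Rightarrow> real" where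
  "spl1 M a t = (\<Sum>k<M + 3. a k * spline_basis1 M k t)"

definition spl2 :: "nat \<Rightarrow> (nat \<Rightarrow> real) \<Rightarrow> real \<Rightarrow> real" where
  "spl2 M a t = (\<Sum>k<M + 3. a k * spline_basis2 M k t)"

text \<open>The exponent is at least 2, so the difference quotient at the kink is O(|h|^(n+1)) and
  tends to 0. The cases n = 1 and n = 0 serve the cube and the square.\<close>

lemma truncated_power_deriv:
  "((\<lambda>t. (max 0 (t - p)) ^ (n + 2)) has_real_derivative real (n + 2) * (max 0 (t - p)) ^ (n + 1)) (at t)"
proof -
  consider "t > p" | "t < p" | "t = p" by linarith
  then show ?thesis
  proof cases
    case 1
    have "((\<lambda>t. (t - p) ^ (n + 2)) has_real_derivative real (n + 2) * (max 0 (t - p)) ^ (n + 1)) (at t)"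
      using DERIV_power[of "\<lambda>t. t - p" 1 t UNIV "n + 2"] 1 by (simp add: max_def DERIV_diff[of "\<lambda>t. t" 1 t UNIV "\<lambda>_. p" 0, simplified])
    then show ?thesis
      by (rule has_field_derivative_transform_within_open[where S="{p<..}"]) (use 1 in \<open>auto simp: max_def\<close>)
  next
    case 2
    have "((\<lambda>t. 0) has_real_derivative real (n + 2) * (max 0 (t - p)) ^ (n + 1)) (at t)"
      using 2 by (simp add: max_def)
    then show ?thesis
      by (rule has_field_derivative_transform_within_open[where S="{..<p}"]) (use 2 in \<open>auto simp: max_def\<close>)
  next
    case 3
    have "((\<lambda>h::real. (max 0 h) ^ (n + 2) / h) \<longlongrightarrow> 0) (at 0)"
    proof (rule Lim_null_comparison)
      have "norm ((max 0 h) ^ (n + 2) / h) \<le> \<bar>h\<bar> ^ (n + 1)" for h :: real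
      proof (cases "h \<ge> 0")
        case True
        then show ?thesis by (cases "h = 0") (auto simp: max_def)
      next
        case False
        then have "max 0 h = 0" by simp
        then show ?thesis by (simp del: power_Suc add: power_0_left)
      qed
      then show "eventually (\<lambda>h::real. norm ((max 0 h) ^ (n + 2) / h) \<le> \<bar>h\<bar> ^ (n + 1)) (at 0)" by simp
      have "((\<lambda>h::real. \<bar>h\<bar> ^ (n + 1)) \<longlongrightarrow> \<bar>0\<bar> ^ (n + 1)) (at 0)" by (intro tendsto_intros)
      then show "((\<lambda>h::real. \<bar>h\<bar> ^ (n + 1)) \<longlongrightarrow> 0) (at 0)" by simp
    qed
    then show ?thesis using 3 by (simp add: DERIV_def)
  qed
qed

lemma spline_basis_deriv:
  "(spline_basis M k has_real_derivative spline_basis1 M k t) (at t)"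
  "(spline_basis1 M k has_real_derivative spline_basis2 M k t) (at t)"
proof -
  let ?p = "real (k - 3) / real M"
  show "(spline_basis M k has_real_derivative spline_basis1 M k t) (at t)"
  proof (cases "k < 4")
    case True
    have "((\<lambda>t. t ^ k) has_real_derivative real k * t ^ (k - 1)) (at t)"
      by (auto intro!: derivative_eq_intros)
    then show ?thesis using True by (simp add: spline_basis_def[abs_def] spline_basis1_def)
  next
    case False
    then show ?thesis using truncated_power_deriv[of ?p 1 t]
      by (simp add: spline_basis_def[abs_def] spline_basis1_def numeral_3_eq_3 numeral_2_eq_2)
  qed
  show "(spline_basis1 M k has_real_derivative spline_basis2 M k t) (at t)"
  proof (cases "k < 4")
    case True
    have "((\<lambda>t. real k * t ^ (k - 1)) has_real_derivative real k * (real (k - 1) * t ^ (k - 2))) (at t)"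
      by (auto intro!: derivative_eq_intros simp: numeral_2_eq_2)
    then show ?thesis using True by (simp add: spline_basis1_def[abs_def] spline_basis2_def)
  next
    case False
    then show ?thesis using DERIV_cmult[OF truncated_power_deriv[of ?p 0 t], of 3]
      by (simp add: spline_basis1_def[abs_def] spline_basis2_def numeral_2_eq_2)
  qed
qed

lemma continuous_on_spline_basis2: "continuous_on S (spline_basis2 M k)"
  unfolding spline_basis2_def[abs_def] by (cases "k < 4") (auto intro!: continuous_intros)

lemma spl_deriv:
  "(spl M a has_real_derivative spl1 M a t) (at t within S)"
  "(spl1 M a has_real_derivative spl2 M a t) (at t within S)"
  unfolding spl_def[abs_def] spl1_def[abs_def] spl2_def[abs_def]
  by (auto intro!: DERIV_sum DERIV_cmult has_field_derivative_at_within[OF spline_basis_deriv(1)]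
      has_field_derivative_at_within[OF spline_basis_deriv(2)])

lemma continuous_on_spl2: "continuous_on S (spl2 M a)"
  unfolding spl2_def[abs_def] by (intro continuous_intros continuous_on_spline_basis2)

lemma ac2_classical:
  assumes "a < b" "\<And>t. t \<in> {a..b} \<Longrightarrow> (u has_real_derivative u' t) (at t within {a..b})"
    "\<And>t. t \<in> {a..b} \<Longrightarrow> (u' has_real_derivative u'' t) (at t within {a..b})" "continuous_on {a..b} u''"
  shows "ac2 a b u u' u''"
proof -
  have "u' t = u' a + integral {a..t} u''" if "t \<in> {a..b}" for t
    using DERIV_within_closed_integral[of a b u' u'' a t] assms(1,3) that by (simp add: integral_unique)
  then show ?thesis unfolding ac2_def using assms L2_on_continuous by blast
qed

lemma ac2_spl: "ac2 0 1 (spl M a) (spl1 M a) (spl2 M a)"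
  by (intro ac2_classical spl_deriv continuous_on_spl2) simp

lemma spl_linear:
  "spl M (\<lambda>i. a i + c * b i) t = spl M a t + c * spl M b t"
  "spl1 M (\<lambda>i. a i + c * b i) t = spl1 M a t + c * spl1 M b t"
  "spl2 M (\<lambda>i. a i + c * b i) t = spl2 M a t + c * spl2 M b t"
  by (simp_all add: spl_def spl1_def spl2_def sum.distrib sum_distrib_left algebra_simps)

text \<open>On a nondegenerate interval one-sided information determines the derivative. At a knot,
  an end point of both neighbouring cells, this reads off derivatives from either side.\<close>

lemma derivative_unique_closed_interval:
  fixes f :: "real \<Rightarrow> real"
  assumes "c < d" "t \<in> {c..d}" "{c..d} \<subseteq> S" "(f has_real_derivative D) (at t within S)"
    "(g has_real_derivative D') (at t within {c..d})" "\<And>s. s \<in> {c..d} \<Longrightarrow> f s = g s"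
  shows "D = D'"
proof -
  have "(f has_real_derivative D) (at t within {c..d})" using assms(3,4) by (rule DERIV_subset[rotated])
  then have "(g has_real_derivative D) (at t within {c..d})"
    by (rule has_field_derivative_transform_within[OF _ zero_less_one assms(2)]) (use assms(6) in auto)
  then show ?thesis
    using vector_derivative_unique_within_closed_interval[OF assms(1), of t g D D'] assms(2,5)
    by (simp add: has_real_derivative_iff_has_vector_derivative)
qed

text \<open>Vanishing to second order at \<open>p\<close> leaves a cubic one degree of freedom. This
  is how C^2 smoothness at a knot forces a single truncated cube.\<close>

lemma cubic_triple_root:
  fixes Q :: "real poly"
  assumes "degree Q \<le> 3" "poly Q p = 0" "poly (pderiv Q) p = 0" "poly (pderiv (pderiv Q)) p = 0"
  shows "poly Q t = coeff Q 3 * (t - p) ^ 3"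
proof -
  define q0 q1 q2 q3 where "q0 = coeff Q 0" and "q1 = coeff Q 1" and "q2 = coeff Q 2" and "q3 = coeff Q 3"
  have Q: "Q = [:q0, q1, q2, q3:]"
  proof (rule poly_eqI)
    fix n :: nat
    consider "n = 0" | "n = 1" | "n = 2" | "n = 3" | "n > 3" by linarith
    then show "coeff Q n = coeff [:q0, q1, q2, q3:] n"
      using assms(1) by cases (auto simp: q0_def q1_def q2_def q3_def coeff_eq_0 coeff_pCons numeral_2_eq_2 numeral_3_eq_3 split: nat.splits)
  qed
  have "2 * q2 + 6 * q3 * p = 0" using assms(4) by (simp add: Q pderiv_pCons algebra_simps)
  then have e2: "q2 = - 3 * q3 * p" by simp
  have "q1 + 2 * q2 * p + 3 * q3 * p ^ 2 = 0" using assms(3) by (simp add: Q pderiv_pCons algebra_simps power2_eq_square)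
  then have e1: "q1 = 3 * q3 * p ^ 2" using e2 by (simp add: power2_eq_square)
  have "q0 + q1 * p + q2 * p ^ 2 + q3 * p ^ 3 = 0" using assms(2) by (simp add: Q algebra_simps power2_eq_square power3_eq_cube)
  then have e0: "q0 = - q3 * p ^ 3" using e1 e2 by (simp add: power2_eq_square power3_eq_cube)
  have "poly Q t = q0 + q1 * t + q2 * t ^ 2 + q3 * t ^ 3" by (simp add: Q algebra_simps power2_eq_square power3_eq_cube)
  also have "\<dots> = q3 * (t - p) ^ 3" unfolding e0 e1 e2 by (simp add: algebra_simps power2_eq_square power3_eq_cube)
  finally show ?thesis by (simp add: q3_def)
qed

lemma spline_basis_poly_right:
  assumes "k \<le> j + 3" "M > 0"
  shows "\<exists>R. degree R \<le> 3 \<and> (\<forall>t. real j / real M \<le> t \<longrightarrow> spline_basis M k t = poly R t)"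
proof (cases "k < 4")
  case True
  then show ?thesis
    by (intro exI[of _ "monom 1 k"]) (auto simp: spline_basis_def poly_monom degree_monom_eq)
next
  case False
  let ?p = "real (k - 3) / real M"
  have "?p \<le> real j / real M" using assms by (intro divide_right_mono) auto
  moreover have "degree ([:- ?p, 1:] ^ 3) \<le> 3" using degree_power_le[of "[:- ?p, 1:]" 3] by simp
  ultimately show ?thesis using False
    by (intro exI[of _ "[:- ?p, 1:] ^ 3"]) (auto simp: spline_basis_def poly_power max_def)
qed

lemma spline_basis_poly_left:
  assumes "j + 3 \<le> k" "t \<le> real j / real M" "4 \<le> k"
  shows "spline_basis M k t = 0"
proof -
  have "real j / real M \<le> real (k - 3) / real M" using assms by (intro divide_right_mono) auto
  then show ?thesis using assms by (simp add: spline_basis_def)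
qed

lemma spline_sum_poly:
  assumes "\<And>k. k < n \<Longrightarrow> \<exists>R. degree R \<le> 3 \<and> (\<forall>t\<in>S. spline_basis M k t = poly R t)"
  shows "\<exists>R. degree R \<le> 3 \<and> (\<forall>t\<in>S. (\<Sum>k<n. a k * spline_basis M k t) = poly R t)"
proof -
  from assms have "\<forall>k. \<exists>R. k < n \<longrightarrow> degree R \<le> 3 \<and> (\<forall>t\<in>S. spline_basis M k t = poly R t)" by blast
  then obtain R where R: "\<And>k. k < n \<Longrightarrow> degree (R k) \<le> 3"
    "\<And>k t. k < n \<Longrightarrow> t \<in> S \<Longrightarrow> spline_basis M k t = poly (R k) t" by metis
  have "degree (\<Sum>k<n. smult (a k) (R k)) \<le> 3"
    using R(1) by (intro degree_sum_le) (auto intro: order_trans[OF degree_smult_le])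
  then show ?thesis using R(2) by (intro exI[of _ "\<Sum>k<n. smult (a k) (R k)"]) (auto simp: poly_sum)
qed

lemma spl_in_spline_space:
  assumes "M > 0"
  shows "spl M a \<in> spline_space M"
proof -
  have "\<exists>P. degree P \<le> 3 \<and> (\<forall>t\<in>{(real j - 1) / real M..real j / real M}. spl M a t = poly P t)"
    if j: "j \<in> {1..M}" for j
    unfolding spl_def
  proof (rule spline_sum_poly)
    fix k
    show "\<exists>R. degree R \<le> 3 \<and> (\<forall>t\<in>{(real j - 1) / real M..real j / real M}. spline_basis M k t = poly R t)"
    proof (cases "k \<le> j - 1 + 3")
      case True
      then show ?thesis using spline_basis_poly_right[OF True assms] j by (auto simp: of_nat_diff)
    next
      case False
      then show ?thesis using j by (intro exI[of _ 0]) (auto intro!: spline_basis_poly_left[of j])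
    qed
  qed
  moreover have "(\<forall>t\<in>{0..1}. (spl M a has_real_derivative spl1 M a t) (at t within {0..1})) \<and>
               (\<forall>t\<in>{0..1}. (spl1 M a has_real_derivative spl2 M a t) (at t within {0..1})) \<and>
               continuous_on {0..1} (spl2 M a)"
    by (intro conjI ballI spl_deriv continuous_on_spl2)
  ultimately show ?thesis unfolding spline_space_def by blast
qed

text \<open>Right of the knot, \<open>g\<close> and the polynomial continuation of its
  representation from the left agree to second order at the knot, so they differ by a multiple of (t
  - j/M)^3; that multiple is the coefficient of index j + 3.\<close>

lemma spline_space_step:
  assumes M: "M > 0" and j: "j < M" "j \<ge> 1"
    and g1: "\<And>t. t \<in> {0..1} \<Longrightarrow> (g has_real_derivative g' t) (at t within {0..1})"
    and g2: "\<And>t. t \<in> {0..1} \<Longrightarrow> (g' has_real_derivative g'' t) (at t within {0..1})"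
    and P: "degree P \<le> 3" "\<And>t. t \<in> {real j / real M..real (Suc j) / real M} \<Longrightarrow> g t = poly P t"
    and IH: "\<And>t. t \<in> {0..real j / real M} \<Longrightarrow> g t = (\<Sum>k<j + 3. a k * spline_basis M k t)"
  shows "\<exists>q. \<forall>t\<in>{0..real (Suc j) / real M}. g t = (\<Sum>k<Suc j + 3. (a(j + 3 := q)) k * spline_basis M k t)"
proof -
  define S S' S'' where "S t = (\<Sum>k<j + 3. a k * spline_basis M k t)"
    and "S' t = (\<Sum>k<j + 3. a k * spline_basis1 M k t)" and "S'' t = (\<Sum>k<j + 3. a k * spline_basis2 M k t)" for t
  let ?p = "real j / real M" and ?q = "real (Suc j) / real M"
  have pq: "0 < ?p" "?p < ?q" "?q \<le> 1" using M j by (auto simp: divide_simps)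
  have S: "(S has_real_derivative S' t) (at t within {0..1})" "(S' has_real_derivative S'' t) (at t within {0..1})" for t
    unfolding S_def[abs_def] S'_def[abs_def] S''_def
    by (auto intro!: DERIV_sum DERIV_cmult has_field_derivative_at_within[OF spline_basis_deriv(1)]
      has_field_derivative_at_within[OF spline_basis_deriv(2)])
  have "\<exists>R. degree R \<le> 3 \<and> (\<forall>t\<in>{?p..}. S t = poly R t)"
    unfolding S_def by (rule spline_sum_poly) (use spline_basis_poly_right[OF _ M, of _ j] in \<open>auto simp: Ball_def\<close>)
  then obtain R where R: "degree R \<le> 3" "\<And>t. ?p \<le> t \<Longrightarrow> S t = poly R t" by auto
  define Q where "Q = P - R"
  define h h' h'' where "h t = g t - S t" and "h' t = g' t - S' t" and "h'' t = g'' t - S'' t" for t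
  have h: "(h has_real_derivative h' t) (at t within {0..1})" "(h' has_real_derivative h'' t) (at t within {0..1})"
    if "t \<in> {0..1}" for t
    unfolding h_def[abs_def] h'_def[abs_def] h''_def using g1 g2 S that by (auto intro!: DERIV_diff)
  have hQ: "h t = poly Q t" if "t \<in> {?p..?q}" for t using P(2) R(2) that by (simp add: h_def Q_def)
  have h0: "h t = 0" if "t \<in> {0..?p}" for t using IH that by (simp add: h_def S_def)
  have h'0: "h' t = 0" if "t \<in> {0..?p}" for t
    using that pq by (intro derivative_unique_closed_interval[OF pq(1) that _ h(1), of "\<lambda>_. 0"] h0) auto
  have h'Q: "h' t = poly (pderiv Q) t" if "t \<in> {?p..?q}" for t
    using that pq by (intro derivative_unique_closed_interval[OF pq(2) that _ h(1), of "poly Q"] hQ)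
      (auto intro: has_field_derivative_at_within[OF poly_DERIV])
  \<comment> \<open>The second derivative at the knot is computed from both sides: 0 from the left,
    that of \<open>Q\<close> from the right.\<close>
  have "h'' ?p = 0"
    using pq by (intro derivative_unique_closed_interval[OF pq(1) _ _ h(2), of ?p "\<lambda>_. 0"] h'0) auto
  moreover have "h'' ?p = poly (pderiv (pderiv Q)) ?p"
    using pq by (intro derivative_unique_closed_interval[OF pq(2) _ _ h(2), of ?p "poly (pderiv Q)"] h'Q)
      (auto intro: has_field_derivative_at_within[OF poly_DERIV])
  ultimately have "poly (pderiv (pderiv Q)) ?p = 0" by simp
  moreover have "poly (pderiv Q) ?p = 0" "poly Q ?p = 0" using h'Q[of ?p] h'0[of ?p] hQ[of ?p] h0[of ?p] pq by auto
  moreover have "degree Q \<le> 3" unfolding Q_def using P(1) R(1) by (rule degree_diff_le)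
  ultimately have Q: "poly Q t = coeff Q 3 * (t - ?p) ^ 3" for t by (intro cubic_triple_root)
  have "g t = (\<Sum>k<Suc j + 3. (a(j + 3 := coeff Q 3)) k * spline_basis M k t)" if t: "t \<in> {0..?q}" for t
  proof -
    have "(\<Sum>k<Suc j + 3. (a(j + 3 := coeff Q 3)) k * spline_basis M k t)
       = S t + coeff Q 3 * spline_basis M (j + 3) t"
      by (simp only: add_Suc sum.lessThan_Suc) (auto simp: S_def intro!: sum.cong)
    also have "\<dots> = g t"
    proof (cases "t \<le> ?p")
      case True
      then show ?thesis using h0[of t] t j by (simp add: h_def spline_basis_def)
    next
      case False
      then show ?thesis using hQ[of t] Q[of t] t j by (simp add: h_def spline_basis_def)
    qed
    finally show ?thesis by simp
  qed
  then show ?thesis by blast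
qed

text \<open>Cells are added from left to right. The first carries an arbitrary cubic, hence the four
  monomials, and every later cell adds one truncated cube.\<close>

lemma spline_space_imp_spl:
  assumes M: "M > 0" and g: "g \<in> spline_space M"
  shows "\<exists>a. \<forall>t\<in>{0..1}. g t = spl M a t"
proof -
  obtain g' g'' where g1: "\<And>t. t \<in> {0..1} \<Longrightarrow> (g has_real_derivative g' t) (at t within {0..1})"
    and g2: "\<And>t. t \<in> {0..1} \<Longrightarrow> (g' has_real_derivative g'' t) (at t within {0..1})"
    using g unfolding spline_space_def by blast
  have P: "\<exists>P. degree P \<le> 3 \<and> (\<forall>t\<in>{(real j - 1) / real M..real j / real M}. g t = poly P t)"
    if "j \<in> {1..M}" for j using g that unfolding spline_space_def by blast
  have "\<exists>a. \<forall>t\<in>{0..real (Suc i) / real M}. g t = (\<Sum>k<Suc i + 3. a k * spline_basis M k t)" if "Suc i \<le> M" for i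
    using that
  proof (induction i)
    case 0
    then obtain P where P: "degree P \<le> 3" "\<And>t. t \<in> {0..1 / real M} \<Longrightarrow> g t = poly P t" using P[of 1] by auto
    have "poly P t = (\<Sum>k<4. coeff P k * t ^ k)" for t
      unfolding poly_altdef using P(1) by (intro sum.mono_neutral_left) (auto simp: coeff_eq_0)
    then show ?case using P(2) by (intro exI[of _ "coeff P"]) (simp add: spline_basis_def)
  next
    case (Suc i)
    then obtain a where a: "\<And>t. t \<in> {0..real (Suc i) / real M} \<Longrightarrow> g t = (\<Sum>k<Suc i + 3. a k * spline_basis M k t)"
      by auto
    obtain P where "degree P \<le> 3" "\<And>t. t \<in> {real (Suc i) / real M..real (Suc (Suc i)) / real M} \<Longrightarrow> g t = poly P t"
      using P[of "Suc (Suc i)"] Suc.prems by auto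
    then show ?case using spline_space_step[OF M _ _ g1 g2 _ _ a, of P] Suc.prems by auto
  qed
  from this[of "M - 1"] M show ?thesis by (auto simp: spl_def)
qed

section \<open>Interpolation inequality and sampling\<close>

lemma L2_integral_subinterval_le:
  assumes "L2_on {a<..<b} v" "a \<le> x" "x \<le> y" "y \<le> b"
  shows "sq_integral x y v \<le> sq_integral a b v"
proof (rule integral_subset_le)
  have *: "(\<lambda>t. (v t)\<^sup>2) integrable_on {a..b}" using L2_on_mult_integrable[OF assms(1,1)] by (simp add: power2_eq_square)
  then show "(\<lambda>t. (v t)\<^sup>2) integrable_on {a..b}" .
  show "(\<lambda>t. (v t)\<^sup>2) integrable_on {x..y}" using assms by (intro integrable_on_subinterval[OF *]) auto
qed (use assms in auto)

lemma L2_integral_combine: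
  assumes "L2_on {a<..<b} v" "a \<le> c" "c \<le> b"
  shows "sq_integral a c v + sq_integral c b v = sq_integral a b v"
  using assms L2_on_mult_integrable[OF assms(1,1)]
  by (intro Henstock_Kurzweil_Integration.integral_combine) (auto simp: power2_eq_square)

lemma oscillation_le_L2:
  assumes v: "L2_on {a<..<b} v"
    and U: "\<And>x y. x \<in> {a..b} \<Longrightarrow> y \<in> {a..b} \<Longrightarrow> x \<le> y \<Longrightarrow> (v has_integral (U y - U x)) {x..y}"
    and xy: "x \<in> {a..b}" "y \<in> {a..b}"
  shows "(U x - U y)\<^sup>2 \<le> (b - a) * sq_integral a b v"
proof -
  have *: "(U y - U x)\<^sup>2 \<le> (b - a) * sq_integral a b v"
    if xy: "x \<in> {a..b}" "y \<in> {a..b}" "x \<le> y" for x y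
  proof -
    have vs: "L2_on {x<..<y} v" using L2_on_subinterval[OF v] xy by auto
    have "(U y - U x)\<^sup>2 \<le> (y - x) * sq_integral x y v"
      using L2_on_integral_abs_le[OF vs xy(3)] integral_unique[OF U[OF xy]] by simp
    also have "\<dots> \<le> (b - a) * sq_integral a b v"
      using xy by (intro mult_mono L2_integral_subinterval_le[OF v] L2_on_integral_square_nonneg[OF vs]) auto
    finally show ?thesis .
  qed
  show ?thesis
    using *[OF xy] *[OF xy(2,1)] by (cases "x \<le> y") (auto simp: power2_commute)
qed

lemma ac2_oscillation:
  assumes u: "ac2 a b u u' v" and xy: "x \<in> {a..b}" "y \<in> {a..b}"
  shows "(u x - u y)\<^sup>2 \<le> (b - a) * sq_integral a b u'"
    and "(u' x - u' y)\<^sup>2 \<le> (b - a) * sq_integral a b v"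
proof -
  show "(u x - u y)\<^sup>2 \<le> (b - a) * sq_integral a b u'"
    by (rule oscillation_le_L2[OF ac2_L2(2)[OF u] DERIV_within_closed_integral[OF ac2D(3)[OF u]] xy])
  show "(u' x - u' y)\<^sup>2 \<le> (b - a) * sq_integral a b v"
    by (rule oscillation_le_L2[OF ac2_L2(3)[OF u] ac2_integral[OF u] xy])
qed

lemma power2_sum_le: "(x + y)\<^sup>2 \<le> 2 * x\<^sup>2 + 2 * (y::real)\<^sup>2"
  using zero_le_power2[of "x - y"] by (simp add: power2_sum power2_diff)

text \<open>The weight \<open>w\<close> is the parabola with unit integral vanishing at both end points: it compares
  \<open>u' x\<close> with \<open>\<integral>u' w = - \<integral>u w'\<close>.\<close>

lemma derivative_L2_interpolation_single:
  assumes u: "ac2 a b u u' v"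
  shows "sq_integral a b u' \<le> 24 / (b - a)\<^sup>2 * sq_integral a b u
     + 2 * (b - a)\<^sup>2 * sq_integral a b v"
proof -
  define l where "l = b - a"
  have l: "l > 0" using ac2D(1)[OF u] by (simp add: l_def)
  define w where "w t = 6 / l ^ 3 * ((t - a) * (b - t))" for t
  define w' where "w' t = 6 / l ^ 3 * (a + b - 2 * t)" for t
  have dw: "(w has_real_derivative w' t) (at t within S)" for t S
    unfolding w_def[abs_def] w'_def by (rule DERIV_cmult) (auto intro!: derivative_eq_intros)
  have w'c: "continuous_on S w'" for S unfolding w'_def[abs_def] by (intro continuous_intros)
  have wc: "continuous_on S w" for S using dw by (rule DERIV_continuous_on)
  have w_nonneg: "0 \<le> w t" if "t \<in> {a..b}" for t using that l by (simp add: w_def)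
  have "((\<lambda>t. (t - a) * (b - t)) has_integral
      ((b - a) * (b - a)\<^sup>2 / 2 - (b - a) ^ 3 / 3 - ((b - a) * (a - a)\<^sup>2 / 2 - (a - a) ^ 3 / 3))) {a..b}"
    using ac2D(1)[OF u]
    by (intro fundamental_theorem_of_calculus)
      (auto simp flip: has_real_derivative_iff_has_vector_derivative intro!: derivative_eq_intros
        simp: power2_eq_square field_simps)
  moreover have "(b - a) * (b - a)\<^sup>2 / 2 - (b - a) ^ 3 / 3 - ((b - a) * (a - a)\<^sup>2 / 2 - (a - a) ^ 3 / 3) = l ^ 3 / 6"
    by (simp add: l_def power2_eq_square power3_eq_cube)
  ultimately have "(w has_integral (6 / l ^ 3 * (l ^ 3 / 6))) {a..b}"
    unfolding w_def[abs_def] by (intro has_integral_mult_right) (simp only:)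
  then have Iw: "(w has_integral 1) {a..b}" using l by simp
  have "((\<lambda>t. (a + b - 2 * t)\<^sup>2) has_integral (- ((a + b - 2 * b) ^ 3) / 6 - (- ((a + b - 2 * a) ^ 3) / 6))) {a..b}"
    using ac2D(1)[OF u]
    by (intro fundamental_theorem_of_calculus)
      (auto simp flip: has_real_derivative_iff_has_vector_derivative intro!: derivative_eq_intros)
  moreover have "- ((a + b - 2 * b) ^ 3) / 6 - (- ((a + b - 2 * a) ^ 3) / 6) = l ^ 3 / 3"
  proof -
    have 1: "a + b - 2 * b = - l" "a + b - 2 * a = l" by (auto simp: l_def)
    show ?thesis unfolding 1 by simp
  qed
  ultimately have "((\<lambda>t. (6 / l ^ 3)\<^sup>2 * (a + b - 2 * t)\<^sup>2) has_integral ((6 / l ^ 3)\<^sup>2 * (l ^ 3 / 3))) {a..b}"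
    by (intro has_integral_mult_right) (simp only:)
  then have "((\<lambda>t. (w' t)\<^sup>2) has_integral ((6 / l ^ 3)\<^sup>2 * (l ^ 3 / 3))) {a..b}"
    by (simp only: w'_def power_mult_distrib)
  moreover have "(6 / l ^ 3)\<^sup>2 * (l ^ 3 / 3) = 12 / l ^ 3"
  proof -
    have "(6 / k)\<^sup>2 * (k / 3) = 12 / k" if "k \<noteq> 0" for k :: real using that by (simp add: power2_eq_square)
    then show ?thesis using l by simp
  qed
  ultimately have Iw': "sq_integral a b w' = 12 / l ^ 3" by (simp add: integral_unique)
  define m where "m = integral {a..b} (\<lambda>t. u' t * w t)"
  let ?U = "sq_integral a b u" and ?V = "sq_integral a b v"
  have V0: "0 \<le> ?V" using L2_on_integral_square_nonneg[OF ac2_L2(3)[OF u]] .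
  have "integral {a..b} (\<lambda>t. u t * w' t) = - m"
    using ac2_by_parts(1)[OF u dw w'c] by (simp add: w_def m_def)
  \<comment> \<open>Cauchy-Schwarz with the squared norm 12 / l^3 of \<open>w'\<close>; the factor 2
    of \<open>power2_sum_le\<close> makes it 24.\<close>
  then have m2: "m\<^sup>2 \<le> ?U * (12 / l ^ 3)"
    using L2_on_Cauchy_Schwarz[OF ac2_L2(1)[OF u] L2_on_continuous[OF w'c]] by (simp add: Iw')
  \<comment> \<open>\<open>u' x\<close> differs from the weighted average \<open>m\<close> by at
    most the oscillation of \<open>u'\<close>, which \<open>ac2_oscillation\<close>
    controls.\<close>
  have pt: "(u' x)\<^sup>2 \<le> 24 / l ^ 3 * ?U + 2 * l * ?V" if x: "x \<in> {a..b}" for x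
  proof -
    have i: "(\<lambda>t. u' t * w t) integrable_on {a..b}"
      by (intro integrable_continuous_interval continuous_intros wc ac2_continuous[OF u])
    have h: "((\<lambda>t. u' x * w t - u' t * w t) has_integral (u' x * 1 - m)) {a..b}"
      unfolding m_def by (intro has_integral_diff has_integral_mult_right Iw integrable_integral i)
    have "norm (integral {a..b} (\<lambda>t. u' x * w t - u' t * w t)) \<le> integral {a..b} (\<lambda>t. sqrt (l * ?V) * w t)"
    proof (rule integral_norm_bound_integral)
      show "(\<lambda>t. u' x * w t - u' t * w t) integrable_on {a..b}" using h by blast
      show "(\<lambda>t. sqrt (l * ?V) * w t) integrable_on {a..b}" using Iw by (intro integrable_on_mult_right) blast
      fix t assume t: "t \<in> {a..b}"
      have "\<bar>u' x - u' t\<bar> \<le> sqrt (l * ?V)"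
        using ac2_oscillation(2)[OF u x t] by (simp add: l_def real_le_rsqrt)
      then have "\<bar>u' x - u' t\<bar> * w t \<le> sqrt (l * ?V) * w t" by (intro mult_right_mono w_nonneg[OF t])
      then show "norm (u' x * w t - u' t * w t) \<le> sqrt (l * ?V) * w t"
        using w_nonneg[OF t] by (simp add: left_diff_distrib[symmetric] abs_mult)
    qed
    also have "\<dots> = sqrt (l * ?V)" using Iw by (simp add: integral_unique)
    finally have "\<bar>u' x - m\<bar> \<le> sqrt (l * ?V)" using integral_unique[OF h] by simp
    then have "(u' x - m)\<^sup>2 \<le> l * ?V" using V0 l by (metis abs_ge_zero power2_abs power_mono real_sqrt_pow2 mult_nonneg_nonneg less_imp_le)
    moreover have "(u' x)\<^sup>2 \<le> 2 * (u' x - m)\<^sup>2 + 2 * m\<^sup>2" using power2_sum_le[of "u' x - m" m] by simp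
    ultimately show ?thesis using m2 by simp
  qed
  have "sq_integral a b u' \<le> integral {a..b} (\<lambda>t. 24 / l ^ 3 * ?U + 2 * l * ?V)"
    using pt L2_on_mult_integrable[OF ac2_L2(2,2)[OF u]]
    by (intro integral_le) (auto simp: power2_eq_square)
  also have "\<dots> = l * (24 / l ^ 3 * ?U + 2 * l * ?V)" using l by (simp add: l_def)
  also have "\<dots> = 24 / l\<^sup>2 * ?U + 2 * l\<^sup>2 * ?V" using l by (simp add: field_simps power2_eq_square power3_eq_cube)
  finally show ?thesis by (simp add: l_def)
qed

text \<open>The interval is halved until its length lies in \<open>[\<epsilon>, 2 \<epsilon>)\<close>.\<close>

lemma derivative_L2_interpolation:
  assumes "ac2 a b u u' v" "0 < \<epsilon>" "\<epsilon> \<le> b - a"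
  shows "sq_integral a b u' \<le> 24 / \<epsilon>\<^sup>2 * sq_integral a b u
     + 8 * \<epsilon>\<^sup>2 * sq_integral a b v"
proof -
  have base: "sq_integral a b u' \<le> 24 / \<epsilon>\<^sup>2 * sq_integral a b u
     + 8 * \<epsilon>\<^sup>2 * sq_integral a b v"
    if u: "ac2 a b u u' v" and e: "\<epsilon> \<le> b - a" "b - a \<le> 2 * \<epsilon>" for a b
  proof -
    \<comment> \<open>A length between \<epsilon> and 2 \<epsilon> turns 24 / (b - a)^2 into at most
      24 / \<epsilon>^2 and 2 (b - a)^2 into at most 8 \<epsilon>^2.\<close>
    have "24 / (b - a)\<^sup>2 \<le> 24 / \<epsilon>\<^sup>2" using e assms(2) by (intro divide_left_mono power_mono mult_pos_pos zero_less_power) auto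
    moreover have "(b - a)\<^sup>2 \<le> (2 * \<epsilon>)\<^sup>2" using e assms(2) by (intro power_mono) auto
    then have "2 * (b - a)\<^sup>2 \<le> 8 * \<epsilon>\<^sup>2" by (simp add: power_mult_distrib)
    ultimately show ?thesis
      using derivative_L2_interpolation_single[OF u]
        L2_on_integral_square_nonneg[OF ac2_L2(1)[OF u]] L2_on_integral_square_nonneg[OF ac2_L2(3)[OF u]]
      by (smt (verit) mult_right_mono)
  qed
  have "sq_integral a b u' \<le> 24 / \<epsilon>\<^sup>2 * sq_integral a b u
     + 8 * \<epsilon>\<^sup>2 * sq_integral a b v"
    if "ac2 a b u u' v" "\<epsilon> \<le> b - a" "b - a \<le> 2 ^ n * \<epsilon>" for a b n
    using that
  proof (induction n arbitrary: a b)
    case 0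
    then show ?case using assms(2) by (intro base) auto
  next
    case (Suc n)
    note u = Suc.prems(1)
    show ?case
    proof (cases "b - a \<le> 2 * \<epsilon>")
      case True
      then show ?thesis using Suc.prems by (intro base) auto
    next
      case False
      define c where "c = (a + b) / 2"
      have c: "a < c" "c < b" "\<epsilon> \<le> c - a" "\<epsilon> \<le> b - c" "c - a \<le> 2 ^ n * \<epsilon>" "b - c \<le> 2 ^ n * \<epsilon>"
        using False Suc.prems(3) assms(2) by (auto simp: c_def field_simps)
      have "ac2 a c u u' v" "ac2 c b u u' v" using c by (auto intro!: ac2_subinterval[OF u])
      then have *: "sq_integral a c u' \<le> 24 / \<epsilon>\<^sup>2 * sq_integral a c u
          + 8 * \<epsilon>\<^sup>2 * sq_integral a c v"
        "sq_integral c b u' \<le> 24 / \<epsilon>\<^sup>2 * sq_integral c b u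
          + 8 * \<epsilon>\<^sup>2 * sq_integral c b v"
        using Suc.IH c by blast+
      show ?thesis
        using add_mono[OF *] c
        unfolding L2_integral_combine[OF ac2_L2(1)[OF u], of c, symmetric, OF less_imp_le less_imp_le, OF c(1,2)]
          L2_integral_combine[OF ac2_L2(2)[OF u], of c, symmetric, OF less_imp_le less_imp_le, OF c(1,2)]
          L2_integral_combine[OF ac2_L2(3)[OF u], of c, symmetric, OF less_imp_le less_imp_le, OF c(1,2)]
        by (simp add: distrib_left algebra_simps)
    qed
  qed
  moreover obtain n where "(b - a) / \<epsilon> < 2 ^ n" using real_arch_pow[of 2 "(b - a) / \<epsilon>"] by auto
  then have "b - a \<le> 2 ^ n * \<epsilon>" using assms(2) by (simp add: divide_simps)
  ultimately show ?thesis using assms by blast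
qed

section \<open>Observation points by cells and sampling inequalities\<close>

definition cell_obs :: "nat \<Rightarrow> nat \<Rightarrow> (nat \<Rightarrow> real) \<Rightarrow> nat \<Rightarrow> nat set" where
  "cell_obs M N x j = {i\<in>{1..N}. x i \<in> cell M j}"

lemma cell_bounds:
  assumes "t \<in> cell M j"  "j \<ge> 1"
  shows "t \<in> {(real j - 1) / real M..real j / real M}"
  using assms by (auto simp: cell_def split: if_splits)

lemma cell_disjoint:
  assumes "t \<in> cell M j" "t \<in> cell M k" "j \<ge> 1" "k \<ge> 1" "M > 0"
  shows "j = k"
proof -
  have *: False if "t \<in> cell M j" "t \<in> cell M k" "j < k" "j \<ge> 1" for j k
  proof -
    have "t \<le> real j / real M" using cell_bounds[OF that(1,4)] by simp
    moreover have "(real k - 1) / real M < t" using that by (auto simp: cell_def)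
    moreover have "real j / real M \<le> (real k - 1) / real M" using that(3) by (intro divide_right_mono) auto
    ultimately show False by simp
  qed
  show ?thesis using *[OF assms(1,2) _ assms(3)] *[OF assms(2,1) _ assms(4)] by (cases j k rule: linorder_cases) auto
qed

lemma cell_cover:
  assumes "t \<in> {0..1}" "M > 0"
  shows "\<exists>j\<in>{1..M}. t \<in> cell M j"
proof (cases "t \<le> 1 / real M")
  case True
  then show ?thesis using assms by (intro bexI[of _ 1]) (auto simp: cell_def)
next
  case False
  \<comment> \<open>Cells are closed on the right, which is why the index is a ceiling.\<close>
  define j where "j = nat \<lceil>t * real M\<rceil>"
  have tM: "1 < t * real M" using False assms(2) by (simp add: field_simps)
  have c: "real j - 1 < t * real M" "t * real M \<le> real j"
    using tM by (auto simp: j_def) linarith+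
  have "t * real M \<le> 1 * real M" using assms by (intro mult_right_mono) auto
  then have "real j < real M + 1" using c by linarith
  then have "j \<le> M" by linarith
  moreover have "j > 1" using c tM by linarith
  ultimately show ?thesis using c assms(2) by (intro bexI[of _ j]) (auto simp: cell_def field_simps)
qed

lemma cell_obs_disjoint:
  assumes "j \<ge> 1" "k \<ge> 1" "M > 0" "j \<noteq> k"
  shows "cell_obs M N x j \<inter> cell_obs M N x k = {}"
  using cell_disjoint[OF _ _ assms(1,2,3)] assms(4) by (auto simp: cell_obs_def)

lemma finite_cell_obs: "finite (cell_obs M N x j)"
  by (simp add: cell_obs_def)

lemma sum_cell_obs_subset_le:
  assumes "M > 0" "\<And>i. 0 \<le> h i" "J \<subseteq> {1..}" "finite J"
  shows "(\<Sum>j\<in>J. \<Sum>i\<in>cell_obs M N x j. h i) \<le> (\<Sum>i=1..N. h i :: real)"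
proof -
  have "(\<Sum>j\<in>J. \<Sum>i\<in>cell_obs M N x j. h i) = sum h (\<Union>j\<in>J. cell_obs M N x j)"
    using assms
    by (intro sum.UNION_disjoint[symmetric] ballI impI cell_obs_disjoint finite_cell_obs) auto
  also have "\<dots> \<le> (\<Sum>i=1..N. h i)" using assms by (intro sum_mono2) (auto simp: cell_obs_def)
  finally show ?thesis .
qed

lemma sum_cell_obs:
  assumes "M > 0" "\<And>i. i \<in> {1..N} \<Longrightarrow> x i \<in> {0..1}"
  shows "(\<Sum>i=1..N. h i :: real) = (\<Sum>j=1..M. \<Sum>i\<in>cell_obs M N x j. h i)"
proof -
  have "(\<Sum>j=1..M. \<Sum>i\<in>cell_obs M N x j. h i) = sum h (\<Union>j\<in>{1..M}. cell_obs M N x j)"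
    using assms
    by (intro sum.UNION_disjoint[symmetric] ballI impI cell_obs_disjoint finite_cell_obs) auto
  also have "(\<Union>j\<in>{1..M}. cell_obs M N x j) = {1..N}"
    using assms cell_cover[OF _ assms(1)] by (auto simp: cell_obs_def)
  finally show ?thesis by simp
qed

lemma obs_density_cell:
  assumes "j \<in> {1..M}" "t \<in> cell M j"
  shows "obs_density M N x t = real (card (cell_obs M N x j)) / (real N * (1 / real M))"
proof -
  have "indicator (cell M k) t = (if k = j then 1 else 0 :: real)" if "k \<in> {1..M}" for k
  proof (cases "k = j")
    case True
    then show ?thesis using assms(2) by simp
  next
    case False
    have "M > 0" using assms(1) by auto
    then have "t \<notin> cell M k" using cell_disjoint[OF assms(2)] assms(1) that False by auto
    then show ?thesis using False by simp
  qed
  then have "obs_density M N x t = (\<Sum>k=1..M. if k = j then real (card (cell_obs M N x k)) / (real N * (1 / real M)) else 0)"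
    unfolding obs_density_def cell_obs_def[symmetric] by (intro sum.cong) auto
  then show ?thesis using assms(1) by simp
qed

lemma obs_density_nonneg: "0 \<le> obs_density M N x t"
  unfolding obs_density_def by (intro sum_nonneg) (auto simp: indicator_def)

lemma obs_density_bdd: "obs_density M N x t \<le> (\<Sum>j=1..M. real (card (cell_obs M N x j)) / (real N * (1 / real M)))"
  unfolding obs_density_def cell_obs_def by (intro sum_mono) (auto simp: indicator_def)

lemma card_cell_obs_le:
  assumes "(SUP t\<in>{0..1}. obs_density M N x t) \<le> \<beta>" "j \<in> {1..M}" "N > 0"
  shows "real (card (cell_obs M N x j)) \<le> \<beta> * real N / real M"
proof -
  \<comment> \<open>The right end point belongs to every cell, the first included.\<close>
  let ?t = "real j / real M"
  have t: "?t \<in> cell M j" "?t \<in> {0..1}" using assms(2) by (auto simp: cell_def divide_simps)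
  have "obs_density M N x ?t \<le> (SUP t\<in>{0..1}. obs_density M N x t)"
    using t(2) obs_density_bdd by (intro cSUP_upper bdd_aboveI2) auto
  then have "real (card (cell_obs M N x j)) / (real N * (1 / real M)) \<le> \<beta>"
    using assms(1) obs_density_cell[OF assms(2) t(1)] by simp
  then show ?thesis using assms(2,3) by (simp add: field_simps)
qed

lemma card_cell_obs_ge:
  assumes "(INF t\<in>{real p / real M<..<real q / real M}. obs_density M N x t) \<ge> \<gamma>"
    "p < j" "j \<le> q" "q \<le> M" "N > 0"
  shows "\<gamma> * real N / real M \<le> real (card (cell_obs M N x j))"
proof -
  \<comment> \<open>The midpoint is taken, because the right end point of the last cell lies outside
    the open interval.\<close>
  let ?t = "(real j - 1 / 2) / real M"
  have M: "0 < real M" using assms by simp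
  have t: "?t \<in> cell M j" using assms M by (auto simp: cell_def divide_simps)
  have "real p / real M < ?t" "?t < real q / real M" using assms(2,3) M by (auto simp: divide_simps)
  then have t': "?t \<in> {real p / real M<..<real q / real M}" by simp
  have "(INF t\<in>{real p / real M<..<real q / real M}. obs_density M N x t) \<le> obs_density M N x ?t"
    using t' obs_density_nonneg by (intro cINF_lower bdd_belowI2) auto
  then have "\<gamma> \<le> real (card (cell_obs M N x j)) / (real N * (1 / real M))"
    using assms(1) obs_density_cell[OF _ t, of N x] assms by simp
  then show ?thesis using M assms(5) by (simp add: field_simps)
qed

text \<open>Each sample point compares u^2 on the cell with its value there, up to the oscillation
  of \<open>u\<close>. These inequalities are summed over the sample points, and the lower bound on
  their number enters only at the end.\<close>

lemma cell_sampling: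
  assumes u: "ac2 a b u u' v" and X: "finite X" "\<And>i. i \<in> X \<Longrightarrow> x i \<in> {a..b}"
    and card: "\<gamma> * N * (b - a) \<le> real (card X)" and pos: "\<gamma> > 0" "N > 0"
  shows "sq_integral a b u \<le> 2 / (\<gamma> * N) * (\<Sum>i\<in>X. (u (x i))\<^sup>2)
    + 2 * (b - a)\<^sup>2 * sq_integral a b u'"
proof -
  define l where "l = b - a"
  have l: "l > 0" using ac2D(1)[OF u] by (simp add: l_def)
  let ?U = "sq_integral a b u" and ?D = "sq_integral a b u'"
  \<comment> \<open>The part of the integral that oscillation does not account for. Its sign
    matters: the lower bound on the number of points can be inserted only if \<open>Z\<close> is
    positive.\<close>
  define Z where "Z = ?U - 2 * l\<^sup>2 * ?D"
  have "Z \<le> 2 * l * (u (x i))\<^sup>2" if i: "i \<in> X" for i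
  proof -
    have "(u t)\<^sup>2 \<le> 2 * (u (x i))\<^sup>2 + 2 * l * ?D" if "t \<in> {a..b}" for t
      using power2_sum_le[of "u t - u (x i)" "u (x i)"] ac2_oscillation(1)[OF u that X(2)[OF i]]
      by (simp add: l_def algebra_simps)
    then have "?U \<le> integral {a..b} (\<lambda>t. 2 * (u (x i))\<^sup>2 + 2 * l * ?D)"
      using L2_on_mult_integrable[OF ac2_L2(1,1)[OF u]]
      by (intro integral_le) (auto simp: power2_eq_square)
    also have "\<dots> = l * (2 * (u (x i))\<^sup>2 + 2 * l * ?D)" using l by (simp add: l_def)
    finally show ?thesis by (simp add: Z_def algebra_simps power2_eq_square)
  qed
  then have sum: "real (card X) * Z \<le> 2 * l * (\<Sum>i\<in>X. (u (x i))\<^sup>2)"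
    unfolding sum_distrib_left by (rule sum_bounded_below)
  have "Z \<le> 2 / (\<gamma> * N) * (\<Sum>i\<in>X. (u (x i))\<^sup>2)"
  proof (cases "Z \<le> 0")
    case True
    also have "0 \<le> 2 / (\<gamma> * N) * (\<Sum>i\<in>X. (u (x i))\<^sup>2)" using pos by (intro mult_nonneg_nonneg sum_nonneg) auto
    finally show ?thesis .
  next
    case False
    then have "(\<gamma> * N * l) * Z \<le> real (card X) * Z" using card by (intro mult_right_mono) (auto simp: l_def)
    then have "l * (\<gamma> * N * Z) \<le> l * (2 * (\<Sum>i\<in>X. (u (x i))\<^sup>2))" using sum by (simp add: algebra_simps)
    then have "\<gamma> * N * Z \<le> 2 * (\<Sum>i\<in>X. (u (x i))\<^sup>2)" using l by simp
    then show ?thesis using pos by (simp add: field_simps)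
  qed
  then show ?thesis by (simp add: Z_def l_def)
qed

lemma interval_sampling:
  assumes u: "ac2 (real p / real M) (real q / real M) u u' v" and pq: "p < q" and M: "M > 0" and N: "N > 0"
    and \<gamma>: "\<gamma> > 0" and card: "\<And>j. p < j \<Longrightarrow> j \<le> q \<Longrightarrow> \<gamma> * real N / real M \<le> real (card (cell_obs M N x j))"
  shows "integral {real p / real M..real q / real M} (\<lambda>t. (u t)\<^sup>2)
    \<le> 2 / \<gamma> * (1 / real N * (\<Sum>i=1..N. (u (x i))\<^sup>2))
      + 2 * (1 / real M)\<^sup>2 * integral {real p / real M..real q / real M} (\<lambda>t. (u' t)\<^sup>2)"
proof -
  let ?p = "real p / real M"
  have "integral {?p..real j / real M} (\<lambda>t. (u t)\<^sup>2)
    \<le> 2 / (\<gamma> * real N) * (\<Sum>k\<in>{p<..j}. \<Sum>i\<in>cell_obs M N x k. (u (x i))\<^sup>2)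
      + 2 * (1 / real M)\<^sup>2 * integral {?p..real j / real M} (\<lambda>t. (u' t)\<^sup>2)" if "p \<le> j" "j \<le> q" for j
    using that
  proof (induction rule: dec_induct)
    case base
    then show ?case by simp
  next
    case (step j)
    let ?a = "real j / real M" and ?b = "real (Suc j) / real M"
    have le: "?p \<le> ?a" "?a < ?b" "?b \<le> real q / real M"
      using step M by (auto intro!: divide_right_mono divide_strict_right_mono)
    have uj: "ac2 ?a ?b u u' v" using le by (intro ac2_subinterval[OF u])
    have len: "?b - ?a = 1 / real M" using M by (simp add: field_simps)
    have A: "integral {?a..?b} (\<lambda>t. (u t)\<^sup>2) \<le> 2 / (\<gamma> * real N) * (\<Sum>i\<in>cell_obs M N x (Suc j). (u (x i))\<^sup>2)
      + 2 * (?b - ?a)\<^sup>2 * integral {?a..?b} (\<lambda>t. (u' t)\<^sup>2)"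
    proof (rule cell_sampling[OF uj])
      show "x i \<in> {?a..?b}" if "i \<in> cell_obs M N x (Suc j)" for i
        using cell_bounds[of "x i" M "Suc j"] that by (auto simp: cell_obs_def)
      show "\<gamma> * real N * (?b - ?a) \<le> real (card (cell_obs M N x (Suc j)))"
        using card[of "Suc j"] step unfolding len by simp
    qed (use \<gamma> N in \<open>auto simp: cell_obs_def\<close>)
    have comb: "integral {?p..?b} (\<lambda>t. (w t)\<^sup>2) = integral {?p..?a} (\<lambda>t. (w t)\<^sup>2) + integral {?a..?b} (\<lambda>t. (w t)\<^sup>2)"
      if "L2_on {?p<..<real q / real M} w" for w
      using le by (intro L2_integral_combine[symmetric] L2_on_subinterval[OF that]) auto
    have "{p<..Suc j} = insert (Suc j) {p<..j}" using step by auto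
    then have sum: "(\<Sum>k\<in>{p<..Suc j}. h k) = h (Suc j) + (\<Sum>k\<in>{p<..j}. h k)" for h :: "nat \<Rightarrow> real" by simp
    show ?case
      unfolding comb[OF ac2_L2(1)[OF u]] comb[OF ac2_L2(2)[OF u]] sum distrib_left
      using A[unfolded len] step.IH step.prems by linarith
  qed
  from this[of q] pq have "integral {?p..real q / real M} (\<lambda>t. (u t)\<^sup>2)
    \<le> 2 / (\<gamma> * real N) * (\<Sum>k\<in>{p<..q}. \<Sum>i\<in>cell_obs M N x k. (u (x i))\<^sup>2)
      + 2 * (1 / real M)\<^sup>2 * integral {?p..real q / real M} (\<lambda>t. (u' t)\<^sup>2)" by simp
  moreover have "2 / (\<gamma> * real N) * (\<Sum>k\<in>{p<..q}. \<Sum>i\<in>cell_obs M N x k. (u (x i))\<^sup>2)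
      \<le> 2 / (\<gamma> * real N) * (\<Sum>i=1..N. (u (x i))\<^sup>2)"
    using \<gamma> N by (intro mult_left_mono sum_cell_obs_subset_le M) auto
  ultimately show ?thesis by (simp add: field_simps)
qed

section \<open>The complete spline interpolant\<close>

text \<open>Because (p - t)_+ = p - t + (t - p)_+. The ramp is the kernel of Taylor's formula at 0
  for the value at the knot.\<close>

lemma spl2_ramp:
  assumes "1 \<le> j" "j \<le> M"
  shows "\<exists>b. \<forall>t\<in>{0..1}. spl2 M b t = max 0 (real j / real M - t)"
proof -
  let ?p = "real j / real M"
  \<comment> \<open>The second derivatives of t^2, t^3 and the truncated cube are 2, 6 t and 6 (t -
    p)_+, hence these coefficients. For j = M the last index lies outside the sum, but then (t -
    1)_+ vanishes on the interval.\<close>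
  define b where "b k = (if k = 2 then ?p / 2 else 0) + (if k = 3 then - 1 / 6 else 0) + (if k = j + 3 then 1 / 6 else 0)" for k :: nat
  have "spl2 M b t = max 0 (?p - t)" if t: "t \<in> {0..1}" for t
  proof -
    have e: "spl2 M b t = (\<Sum>k<M + 3. if k = 2 then ?p / 2 * spline_basis2 M k t else 0)
       + (\<Sum>k<M + 3. if k = 3 then - 1 / 6 * spline_basis2 M k t else 0)
       + (\<Sum>k<M + 3. if k = j + 3 then 1 / 6 * spline_basis2 M k t else 0)"
      unfolding spl2_def sum.distrib[symmetric] by (intro sum.cong) (auto simp: b_def distrib_right)
    have 1: "spline_basis2 M 2 t = 2" "spline_basis2 M 3 t = 6 * t" "spline_basis2 M (j + 3) t = 6 * max 0 (t - ?p)"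
      using assms by (auto simp: spline_basis2_def)
    show ?thesis
    proof (cases "j = M")
      case True
      then show ?thesis unfolding e using assms t 1 by (simp add: max_def)
    next
      case False
      then show ?thesis unfolding e using assms t 1 by (simp add: max_def)
    qed
  qed
  then show ?thesis by blast
qed

lemma spl_at_0: "spl M a 0 = a 0" "spl1 M a 0 = a 1"
proof -
  have 0: "spline_basis M k 0 = (if k = 0 then 1 else 0)" for k
    by (auto simp: spline_basis_def)
  show "spl M a 0 = a 0" unfolding spl_def 0 by (simp add: if_distrib cong: if_cong)
  have 1: "spline_basis1 M k 0 = (if k = 1 then 1 else 0)" for k
    by (auto simp: spline_basis1_def power_0_left)
  show "spl1 M a 0 = a 1" unfolding spl1_def 1 by (simp add: if_distrib cong: if_cong)
qed

text \<open>Taylor's formula at 0 writes e(p) as the integral of (p - t) v over [0, p]. The kernel,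
  extended by 0, is the second derivative of a spline, so this integral vanishes by
  orthogonality.\<close>

lemma zero_at_knots:
  assumes e: "ac2 0 1 e e' v" "e 0 = 0" "e' 0 = 0"
    and orth: "\<And>b. integral {0..1} (\<lambda>t. spl2 M b t * v t) = 0" and j: "j \<le> M" and M: "M > 0"
  shows "e (real j / real M) = 0"
proof (cases "j = 0")
  case False
  let ?p = "real j / real M"
  have p: "0 < ?p" "?p \<le> 1" using False j M by auto
  have ep: "ac2 0 ?p e e' v" using p by (intro ac2_subinterval[OF e(1)]) auto
  have "integral {0..?p} (\<lambda>t. e' t * 1) = e' ?p * (?p - ?p) - e' 0 * (0 - ?p) - integral {0..?p} (\<lambda>t. v t * (t - ?p))"
    by (rule ac2_by_parts(2)[OF ep]) (auto intro!: derivative_eq_intros)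
  moreover have "integral {0..?p} e' = e ?p - e 0"
    using DERIV_within_closed_integral[OF ac2D(3)[OF ep], of 0 ?p] p by (simp add: integral_unique)
  ultimately have ep': "e ?p = - integral {0..?p} (\<lambda>t. v t * (t - ?p))" using e by simp
  obtain b where b: "\<And>t. t \<in> {0..1} \<Longrightarrow> spl2 M b t = max 0 (?p - t)"
    using spl2_ramp[of j M] False j by (metis One_nat_def Suc_leI neq0_conv)
  have int: "(\<lambda>t. spl2 M b t * v t) integrable_on {0..1}"
    by (intro L2_on_mult_integrable L2_on_continuous continuous_on_spl2 ac2_L2(3)[OF e(1)])
  have "integral {0..1} (\<lambda>t. spl2 M b t * v t) = integral {0..?p} (\<lambda>t. spl2 M b t * v t) + integral {?p..1} (\<lambda>t. spl2 M b t * v t)"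
    using p by (intro Henstock_Kurzweil_Integration.integral_combine[symmetric] int) auto
  also have "integral {0..?p} (\<lambda>t. spl2 M b t * v t) = integral {0..?p} (\<lambda>t. - (v t * (t - ?p)))"
    using b p by (intro Henstock_Kurzweil_Integration.integral_cong) (auto simp: algebra_simps)
  also have "integral {?p..1} (\<lambda>t. spl2 M b t * v t) = integral {?p..1} (\<lambda>t. 0)"
    using b p by (intro Henstock_Kurzweil_Integration.integral_cong) auto
  finally show ?thesis using orth ep' by simp
qed (use e in simp)

text \<open>By Rolle, e' has a zero. The oscillation estimates for e' and for e cost a factor b - a
  each, and the integration of (e')^2 in between costs the third.\<close>

lemma cell_error:
  assumes e: "ac2 a b e e' v" "e a = 0" "e b = 0" and t: "t \<in> {a..b}"
  shows "(e t)\<^sup>2 \<le> (b - a) ^ 3 * sq_integral a b v"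
proof -
  let ?V = "sq_integral a b v"
  note ab = ac2D(1)[OF e(1)]
  have "\<exists>z\<in>{a<..<b}. e b - e a = (\<lambda>h. e' z * h) (b - a)"
    using ab ac2D(3)[OF e(1)] by (intro mvt_simple) (auto simp: has_field_derivative_def)
  then obtain z where "z \<in> {a<..<b}" "e b - e a = e' z * (b - a)" by blast
  then have z: "z \<in> {a..b}" "e' z = 0" using e ab by auto
  have "(e' s)\<^sup>2 \<le> (b - a) * ?V" if "s \<in> {a..b}" for s
    using ac2_oscillation(2)[OF e(1) that z(1)] z(2) by simp
  then have "sq_integral a b e' \<le> integral {a..b} (\<lambda>t. (b - a) * ?V)"
    using L2_on_mult_integrable[OF ac2_L2(2,2)[OF e(1)]]
    by (intro integral_le) (auto simp: power2_eq_square)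
  also have "\<dots> = (b - a) * ((b - a) * ?V)" using ab by simp
  finally have *: "(b - a) * sq_integral a b e' \<le> (b - a) * ((b - a) * ((b - a) * ?V))"
    using ab by (intro mult_left_mono) auto
  have "(e t)\<^sup>2 \<le> (b - a) * sq_integral a b e'"
    using ac2_oscillation(1)[OF e(1) t, of a] ab e(2) by simp
  then show ?thesis using * by (simp add: power3_eq_cube mult.assoc)
qed

lemma sum_cells_L2:
  assumes "L2_on {0<..<1} v" "M > 0"
  shows "(\<Sum>j=1..M. integral {(real j - 1) / real M..real j / real M} (\<lambda>t. (v t)\<^sup>2)) = sq_integral 0 1 v"
proof -
  have "(\<Sum>j=1..n. integral {(real j - 1) / real M..real j / real M} (\<lambda>t. (v t)\<^sup>2)) = integral {0..real n / real M} (\<lambda>t. (v t)\<^sup>2)"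
    if "n \<le> M" for n
    using that
  proof (induction n)
    case (Suc n)
    have b: "real n / real M \<le> real (Suc n) / real M" "real (Suc n) / real M \<le> 1"
      using Suc.prems assms(2) by (auto simp: divide_simps)
    have "L2_on {0<..<real (Suc n) / real M} v" using b by (intro L2_on_subinterval[OF assms(1)]) auto
    then have "integral {0..real n / real M} (\<lambda>t. (v t)\<^sup>2) + integral {real n / real M..real (Suc n) / real M} (\<lambda>t. (v t)\<^sup>2)
       = integral {0..real (Suc n) / real M} (\<lambda>t. (v t)\<^sup>2)"
      using b by (intro L2_integral_combine) auto
    then show ?case using Suc by simp
  qed simp
  from this[of M] show ?thesis using assms(2) by simp
qed

text \<open>Each point in a cell costs d^3 times the cell's share of the squared norm of
  \<open>v\<close>, and a cell holds at most \<beta> N d points; division by N leaves d^4.\<close>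

lemma knot_interpolation_sample_error:
  assumes e: "ac2 0 1 e e' v" and knots: "\<And>j. j \<le> M \<Longrightarrow> e (real j / real M) = 0"
    and M: "M > 0" and N: "N > 0" and x: "\<And>i. i \<in> {1..N} \<Longrightarrow> x i \<in> {0..1}"
    and card: "\<And>j. j \<in> {1..M} \<Longrightarrow> real (card (cell_obs M N x j)) \<le> \<beta> * real N / real M"
  shows "1 / real N * (\<Sum>i=1..N. (e (x i))\<^sup>2) \<le> \<beta> * (1 / real M) ^ 4 * sq_integral 0 1 v"
proof -
  define V where "V j = integral {(real j - 1) / real M..real j / real M} (\<lambda>t. (v t)\<^sup>2)" for j
  have "(\<Sum>i\<in>cell_obs M N x j. (e (x i))\<^sup>2) \<le> (\<beta> * real N / real M) * ((1 / real M) ^ 3 * V j)"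
    if j: "j \<in> {1..M}" for j
  proof -
    let ?a = "(real j - 1) / real M" and ?b = "real j / real M"
    have ab: "0 \<le> ?a" "?a < ?b" "?b \<le> 1" using j M by (auto simp: divide_simps)
    have ej: "ac2 ?a ?b e e' v" using ab by (intro ac2_subinterval[OF e])
    have z: "e ?a = 0" "e ?b = 0" using knots[of "j - 1"] knots[of j] j by (auto simp: of_nat_diff)
    have len: "?b - ?a = 1 / real M" using M by (simp add: field_simps)
    have "(e (x i))\<^sup>2 \<le> (1 / real M) ^ 3 * V j" if "i \<in> cell_obs M N x j" for i
      using cell_error[OF ej z, of "x i"] cell_bounds[of "x i" M j] that j unfolding len V_def
      by (auto simp: cell_obs_def)
    then have "(\<Sum>i\<in>cell_obs M N x j. (e (x i))\<^sup>2) \<le> real (card (cell_obs M N x j)) * ((1 / real M) ^ 3 * V j)"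
      by (rule sum_bounded_above)
    also have "\<dots> \<le> (\<beta> * real N / real M) * ((1 / real M) ^ 3 * V j)"
      using card[OF j] L2_on_integral_square_nonneg[OF ac2_L2(3)[OF ej]] by (intro mult_right_mono) (auto simp: V_def)
    finally show ?thesis .
  qed
  then have "(\<Sum>i=1..N. (e (x i))\<^sup>2) \<le> (\<Sum>j=1..M. (\<beta> * real N / real M) * ((1 / real M) ^ 3 * V j))"
    by (subst sum_cell_obs[OF M x]) (assumption, auto intro: sum_mono)
  also have "\<dots> = (\<beta> * real N / real M) * ((1 / real M) ^ 3 * sq_integral 0 1 v)"
    unfolding sum_cells_L2[OF ac2_L2(3)[OF e] M, symmetric] V_def sum_distrib_left ..
  finally have "1 / real N * (\<Sum>i=1..N. (e (x i))\<^sup>2)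
      \<le> 1 / real N * ((\<beta> * real N / real M) * ((1 / real M) ^ 3 * sq_integral 0 1 v))"
    by (intro mult_left_mono) auto
  also have "\<dots> = \<beta> * (1 / real M) ^ 4 * sq_integral 0 1 v"
    using N M by (simp add: field_simps power_def numeral_eq_Suc)
  finally show ?thesis .
qed

definition energy_form :: "nat \<Rightarrow> (nat \<Rightarrow> real) \<Rightarrow> (nat \<Rightarrow> real) \<Rightarrow> real" where
  "energy_form M a b = integral {0..1} (\<lambda>t. spl2 M a t * spl2 M b t)"

lemma linear_functional_integral_spl2:
  assumes "L2_on {0<..<1} v"
  shows "linear_functional (\<lambda>b. integral {0..1} (\<lambda>t. spl2 M b t * v t))"
  unfolding linear_functional_def
proof (intro allI)
  fix u w c
  have i: "(\<lambda>t. spl2 M b t * v t) integrable_on {0..1}" for b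
    by (intro L2_on_mult_integrable L2_on_continuous continuous_on_spl2 assms)
  have "integral {0..1} (\<lambda>t. spl2 M (\<lambda>i. u i + c * w i) t * v t)
      = integral {0..1} (\<lambda>t. spl2 M u t * v t + c * (spl2 M w t * v t))"
    by (simp add: spl_linear algebra_simps)
  also have "\<dots> = integral {0..1} (\<lambda>t. spl2 M u t * v t) + integral {0..1} (\<lambda>t. c * (spl2 M w t * v t))"
    by (intro integral_add integrable_on_mult_right i)
  finally show "integral {0..1} (\<lambda>t. spl2 M (\<lambda>i. u i + c * w i) t * v t)
    = integral {0..1} (\<lambda>t. spl2 M u t * v t) + c * integral {0..1} (\<lambda>t. spl2 M w t * v t)" by simp
qed

lemma psd_form_energy: "psd_form (energy_form M)"
proof -
  have L: "L2_on {0<..<1} (spl2 M w)" for w by (intro L2_on_continuous continuous_on_spl2)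
  have "energy_form M (\<lambda>i. u i + c * v i) w = energy_form M u w + c * energy_form M v w" for u v w c
    using linear_functional_add[OF linear_functional_integral_spl2[OF L[of w]]] unfolding energy_form_def .
  moreover have "energy_form M u v = energy_form M v u" for u v by (simp add: energy_form_def mult.commute)
  moreover have "0 \<le> energy_form M u u" for u
    using L2_on_integral_square_nonneg[OF L[of u]] by (simp add: energy_form_def power2_eq_square)
  ultimately show ?thesis unfolding psd_form_def by blast
qed

lemma spl_zero_coeffs:
  assumes "\<And>i. i < M + 3 \<Longrightarrow> u i = 0"
  shows "spl M u t = 0" "spl2 M u t = 0"
  using assms by (auto simp: spl_def spl2_def)

text \<open>The second derivative of the complete spline interpolant is the \<open>L\<^sup>2\<close> projection of the
  second derivative of the function.\<close>

lemma complete_spline: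
  assumes f: "ac2 0 1 f f' v" and M: "M > 0"
  obtains a where "\<And>j. j \<le> M \<Longrightarrow> spl M a (real j / real M) = f (real j / real M)"
    "integral {0..1} (\<lambda>t. (spl2 M a t)\<^sup>2) + integral {0..1} (\<lambda>t. (spl2 M a t - v t)\<^sup>2) = sq_integral 0 1 v"
proof -
  have L: "L2_on {0<..<1} (spl2 M w)" for w by (intro L2_on_continuous continuous_on_spl2)
  note Lv = ac2_L2(3)[OF f]
  define l where "l b = integral {0..1} (\<lambda>t. spl2 M b t * v t)" for b
  have ll: "linear_functional l" unfolding l_def by (rule linear_functional_integral_spl2[OF Lv])
  have "energy_form M u u = 0" if "\<And>i. i < M + 3 \<Longrightarrow> u i = 0" for u
    using spl_zero_coeffs[OF that] by (simp add: energy_form_def)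
  then obtain m c where "orthonormal_system (energy_form M) m c"
    by (rule orthonormal_system_exists[OF psd_form_energy])
  note rep = orthonormal_systemD(2)[OF this]
  have null: "l r = 0" if "energy_form M r r = 0" for r
  proof -
    have "(l r)\<^sup>2 \<le> integral {0..1} (\<lambda>t. (spl2 M r t)\<^sup>2) * sq_integral 0 1 v"
      unfolding l_def by (rule L2_on_Cauchy_Schwarz[OF L Lv])
    also have "\<dots> = 0" using that by (simp add: energy_form_def power2_eq_square)
    finally show ?thesis by simp
  qed
  \<comment> \<open>Riesz representer of \<open>l\<close> in the energy form, so that its second
    derivative is the projection of \<open>v\<close>.\<close>
  define a0 where "a0 i = (\<Sum>k<m. l (c k) * c k i)" for i
  have a0: "energy_form M b a0 = l b" for b
  proof -
    have "l b = (\<Sum>k<m. energy_form M b (c k) * l (c k))" by (rule rep[OF ll null])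
    moreover have "energy_form M b a0 = (\<Sum>k<m. l (c k) * energy_form M b (c k))"
      unfolding a0_def by (rule linear_functional_sum[OF psd_formD(5)[OF psd_form_energy] finite_lessThan])
    ultimately show ?thesis by (simp add: mult.commute)
  qed
  \<comment> \<open>The coefficients of 1 and t do not affect second derivatives; they are set so
    that value and slope at 0 match those of f.\<close>
  define a where "a = a0(0 := f 0, 1 := f' 0)"
  have a2: "spl2 M a t = spl2 M a0 t" for t
    unfolding spl2_def a_def by (intro sum.cong) (auto simp: spline_basis2_def)
  define e where "e t = spl M a t + (- 1) * f t" for t
  have e: "ac2 0 1 e (\<lambda>t. spl1 M a t + (- 1) * f' t) (\<lambda>t. spl2 M a t + (- 1) * v t)"
    unfolding e_def by (rule ac2_linear[OF ac2_spl f])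
  have orth: "integral {0..1} (\<lambda>t. spl2 M b t * (spl2 M a t + (- 1) * v t)) = 0" for b
  proof -
    have "integral {0..1} (\<lambda>t. spl2 M b t * (spl2 M a t + (- 1) * v t))
       = integral {0..1} (\<lambda>t. spl2 M b t * spl2 M a0 t - spl2 M b t * v t)"
      by (simp add: a2 algebra_simps)
    also have "\<dots> = energy_form M b a0 - l b"
      unfolding energy_form_def l_def by (intro integral_diff L2_on_mult_integrable L Lv)
    finally show ?thesis by (simp add: a0)
  qed
  have "e (real j / real M) = 0" if "j \<le> M" for j
    by (rule zero_at_knots[OF e _ _ orth that M]) (simp_all add: e_def spl_at_0 a_def)
  moreover have "integral {0..1} (\<lambda>t. (spl2 M a t)\<^sup>2) + integral {0..1} (\<lambda>t. (spl2 M a t - v t)\<^sup>2) = sq_integral 0 1 v"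
  proof -
    have Le: "L2_on {0<..<1} (\<lambda>t. spl2 M a t + (- 1) * v t)" by (rule ac2_L2(3)[OF e])
    \<comment> \<open>Pythagoras: \<open>v\<close> is the projection minus the error, and the error
      is orthogonal to second derivatives of splines, so the cross term vanishes.\<close>
    have "integral {0..1} (\<lambda>t. (spl2 M a t + (- 1) * (spl2 M a t + (- 1) * v t))\<^sup>2)
      = integral {0..1} (\<lambda>t. (spl2 M a t)\<^sup>2) + integral {0..1} (\<lambda>t. (spl2 M a t + (- 1) * v t)\<^sup>2)"
      unfolding L2_on_integral_square_expand[OF L Le] orth by simp
    then show ?thesis by simp
  qed
  ultimately show ?thesis using that[of a] by (simp add: e_def)
qed

lemma complete_spline_error:
  assumes f: "ac2 0 1 f f' v" and M: "M > 0" and N: "N > 0" and x: "\<And>i. i \<in> {1..N} \<Longrightarrow> x i \<in> {0..1}"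
    and card: "\<And>j. j \<in> {1..M} \<Longrightarrow> real (card (cell_obs M N x j)) \<le> \<beta> * real N / real M" and \<beta>: "0 \<le> \<beta>"
  obtains a where "energy_form M a a \<le> sq_integral 0 1 v"
    "1 / real N * (\<Sum>i=1..N. (spl M a (x i) - f (x i))\<^sup>2) \<le> \<beta> * (1 / real M) ^ 4 * sq_integral 0 1 v"
proof -
  obtain a where a: "\<And>j. j \<le> M \<Longrightarrow> spl M a (real j / real M) = f (real j / real M)"
    "integral {0..1} (\<lambda>t. (spl2 M a t)\<^sup>2) + integral {0..1} (\<lambda>t. (spl2 M a t - v t)\<^sup>2) = sq_integral 0 1 v"
    using complete_spline[OF f M] by blast
  have e: "ac2 0 1 (\<lambda>t. spl M a t + (- 1) * f t) (\<lambda>t. spl1 M a t + (- 1) * f' t) (\<lambda>t. spl2 M a t + (- 1) * v t)"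
    by (rule ac2_linear[OF ac2_spl f])
  have n: "0 \<le> integral {0..1} (\<lambda>t. (spl2 M a t - v t)\<^sup>2)" "0 \<le> integral {0..1} (\<lambda>t. (spl2 M a t)\<^sup>2)"
    using L2_on_integral_square_nonneg[OF ac2_L2(3)[OF e]] L2_on_integral_square_nonneg[OF ac2_L2(3)[OF ac2_spl]] by simp_all
  have "1 / real N * (\<Sum>i=1..N. (spl M a (x i) - f (x i))\<^sup>2) \<le> \<beta> * (1 / real M) ^ 4 * integral {0..1} (\<lambda>t. (spl2 M a t - v t)\<^sup>2)"
    using knot_interpolation_sample_error[OF e _ M N x card] a(1) by simp
  also have "\<dots> \<le> \<beta> * (1 / real M) ^ 4 * sq_integral 0 1 v"
    using a(2) n \<beta> by (intro mult_left_mono) auto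
  finally show ?thesis using a(2) n that[of a] by (simp add: energy_form_def power2_eq_square)
qed

section \<open>The Tikhonov minimizer\<close>

definition sample_form :: "nat \<Rightarrow> (nat \<Rightarrow> real) \<Rightarrow> nat \<Rightarrow> (nat \<Rightarrow> real) \<Rightarrow> (nat \<Rightarrow> real) \<Rightarrow> real" where
  "sample_form N x M a b = 1 / real N * (\<Sum>i=1..N. spl M a (x i) * spl M b (x i))"

definition tikhonov_form ::
    "nat \<Rightarrow> (nat \<Rightarrow> real) \<Rightarrow> real \<Rightarrow> nat \<Rightarrow> (nat \<Rightarrow> real) \<Rightarrow> (nat \<Rightarrow> real) \<Rightarrow> real" where
  "tikhonov_form N x \<alpha> M a b = sample_form N x M a b + \<alpha> * energy_form M a b"

definition data_functional :: "nat \<Rightarrow> (nat \<Rightarrow> real) \<Rightarrow> nat \<Rightarrow> (nat \<Rightarrow> real) \<Rightarrow> (nat \<Rightarrow> real) \<Rightarrow> real" where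
  "data_functional N x M z b = 1 / real N * (\<Sum>i=1..N. z i * spl M b (x i))"

definition tikhonov_coeffs ::
    "nat \<Rightarrow> (nat \<Rightarrow> real) \<Rightarrow> real \<Rightarrow> nat \<Rightarrow> (nat \<Rightarrow> real) \<Rightarrow> (nat \<Rightarrow> real) \<Rightarrow> real" where
  "tikhonov_coeffs N x \<alpha> M z a = 1 / real N * (\<Sum>i=1..N. (spl M a (x i) - z i)\<^sup>2) + \<alpha> * energy_form M a a"

text \<open>The expansion of the data functional in an orthonormal system. It is explicitly linear
  in the data, which serves both the splitting into bias and noise and the measurability of the
  error.\<close>

definition minimizer ::
    "nat \<Rightarrow> (nat \<Rightarrow> real) \<Rightarrow> nat \<Rightarrow> nat \<Rightarrow> (nat \<Rightarrow> nat \<Rightarrow> real) \<Rightarrow> (nat \<Rightarrow> real) \<Rightarrow> nat \<Rightarrow> real" where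
  "minimizer N x M m c z i = (\<Sum>k<m. data_functional N x M z (c k) * c k i)"

lemma psd_form_sample: "psd_form (sample_form N x M)"
proof -
  have "sample_form N x M (\<lambda>i. u i + c * v i) w = sample_form N x M u w + c * sample_form N x M v w" for u v w c
    by (simp add: sample_form_def spl_linear distrib_right distrib_left sum.distrib sum_distrib_left mult_ac add_divide_distrib)
  moreover have "sample_form N x M u v = sample_form N x M v u" for u v by (simp add: sample_form_def mult.commute)
  moreover have "0 \<le> sample_form N x M u u" for u
    unfolding sample_form_def by (intro mult_nonneg_nonneg[of "1 / real N"] sum_nonneg zero_le_square) auto
  ultimately show ?thesis unfolding psd_form_def by blast
qed

lemma psd_form_tikhonov:
  assumes "0 \<le> \<alpha>"
  shows "psd_form (tikhonov_form N x \<alpha> M)"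
  using psd_formD[OF psd_form_sample, of N x M] psd_formD[OF psd_form_energy, of M] assms
  unfolding psd_form_def tikhonov_form_def by (auto simp: algebra_simps)

lemma linear_functional_data: "linear_functional (data_functional N x M z)"
  unfolding linear_functional_def
  by (simp add: data_functional_def spl_linear distrib_right distrib_left sum.distrib sum_distrib_left mult_ac add_divide_distrib)

lemma tikhonov_form_null:
  assumes "tikhonov_form N x \<alpha> M r r = 0" "\<alpha> > 0" "N > 0"
  shows "sample_form N x M r r = 0" "energy_form M r r = 0" "i \<in> {1..N} \<Longrightarrow> spl M r (x i) = 0"
proof -
  have n: "0 \<le> sample_form N x M r r" "0 \<le> \<alpha> * energy_form M r r"
    using psd_formD(2)[OF psd_form_sample] psd_formD(2)[OF psd_form_energy] assms(2) by auto
  then show s: "sample_form N x M r r = 0" using assms(1) unfolding tikhonov_form_def by linarith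
  have "\<alpha> * energy_form M r r = 0" using n assms(1) unfolding tikhonov_form_def by linarith
  then show "energy_form M r r = 0" using assms(2) by simp
  have "(\<Sum>i=1..N. spl M r (x i) * spl M r (x i)) = 0" using s assms(3) by (simp add: sample_form_def)
  then show "spl M r (x i) = 0" if "i \<in> {1..N}" using that by (subst (asm) sum_nonneg_eq_0_iff) auto
qed

lemma tikhonov_system:
  assumes "\<alpha> > 0"
  obtains m c where "m \<le> M + 3" "orthonormal_system (tikhonov_form N x \<alpha> M) m c"
proof -
  have A: "psd_form (tikhonov_form N x \<alpha> M)" using assms by (intro psd_form_tikhonov) simp
  have "tikhonov_form N x \<alpha> M u u = 0" if "\<And>i. i < M + 3 \<Longrightarrow> u i = 0" for u
    using spl_zero_coeffs[OF that] by (simp add: tikhonov_form_def sample_form_def energy_form_def)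
  then obtain m c where "m \<le> M + 3" "orthonormal_system (tikhonov_form N x \<alpha> M) m c"
    by (rule orthonormal_system_exists[OF A])
  then show ?thesis by (rule that)
qed

text \<open>Completeness of the system applied to the data functional, which vanishes on null
  vectors because null splines vanish at all observation points.\<close>

lemma minimizer_normal_equation:
  assumes o: "orthonormal_system (tikhonov_form N x \<alpha> M) m c" and \<alpha>: "\<alpha> > 0" and N: "N > 0"
  shows "tikhonov_form N x \<alpha> M (minimizer N x M m c z) b = data_functional N x M z b"
proof -
  have A: "psd_form (tikhonov_form N x \<alpha> M)" using \<alpha> by (intro psd_form_tikhonov) simp
  have null: "data_functional N x M z r = 0" if "tikhonov_form N x \<alpha> M r r = 0" for r
    using tikhonov_form_null(3)[OF that \<alpha> N] by (simp add: data_functional_def)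
  have "tikhonov_form N x \<alpha> M b (minimizer N x M m c z) = data_functional N x M z b"
  proof -
    have "data_functional N x M z b = (\<Sum>k<m. tikhonov_form N x \<alpha> M b (c k) * data_functional N x M z (c k))"
      by (rule orthonormal_systemD(2)[OF o linear_functional_data null])
    moreover have "tikhonov_form N x \<alpha> M b (minimizer N x M m c z)
        = (\<Sum>k<m. data_functional N x M z (c k) * tikhonov_form N x \<alpha> M b (c k))"
      unfolding minimizer_def by (rule linear_functional_sum[OF psd_formD(5)[OF A] finite_lessThan])
    ultimately show ?thesis by (simp add: mult.commute)
  qed
  then show ?thesis using psd_formD(1)[OF A, of b] by simp
qed

lemma minimizer_add:
  "minimizer N x M m c (\<lambda>i. z i + w i) k = minimizer N x M m c z k + minimizer N x M m c w k"
proof -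
  have "data_functional N x M (\<lambda>i. z i + w i) b = data_functional N x M z b + data_functional N x M w b" for b
    by (simp add: data_functional_def distrib_right distrib_left sum.distrib add_divide_distrib)
  then show ?thesis by (simp add: minimizer_def distrib_right sum.distrib)
qed

lemma tikhonov_coeffs_eq:
  "tikhonov_coeffs N x \<alpha> M z a =
     tikhonov_form N x \<alpha> M a a - 2 * data_functional N x M z a + 1 / real N * (\<Sum>i=1..N. (z i)\<^sup>2)"
proof -
  have E: "(\<Sum>i=1..N. (spl M a (x i) - z i)\<^sup>2)
     = (\<Sum>i=1..N. spl M a (x i) * spl M a (x i)) - 2 * (\<Sum>i=1..N. z i * spl M a (x i)) + (\<Sum>i=1..N. (z i)\<^sup>2)"
  proof -
    have "(spl M a (x i) - z i)\<^sup>2 = spl M a (x i) * spl M a (x i) - 2 * (z i * spl M a (x i)) + (z i)\<^sup>2" for i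
      by (simp add: power2_eq_square algebra_simps)
    then show ?thesis by (simp only: sum.distrib sum_subtractf sum_distrib_left)
  qed
  show ?thesis
    unfolding tikhonov_coeffs_def tikhonov_form_def sample_form_def data_functional_def E
    by (simp add: algebra_simps)
qed

text \<open>By the normal equations the data functional is the form paired with \<open>g\<close>, so
  completing the square leaves no linear term.\<close>

lemma tikhonov_coeffs_minimizer:
  fixes z a :: "nat \<Rightarrow> real"
  assumes o: "orthonormal_system (tikhonov_form N x \<alpha> M) m c" and \<alpha>: "\<alpha> > 0" and N: "N > 0"
  defines "g \<equiv> minimizer N x M m c z"
  defines "r \<equiv> \<lambda>i. a i + (- 1) * g i"
  shows "tikhonov_coeffs N x \<alpha> M z a = tikhonov_coeffs N x \<alpha> M z g + tikhonov_form N x \<alpha> M r r"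
proof -
  have A: "psd_form (tikhonov_form N x \<alpha> M)" using \<alpha> by (intro psd_form_tikhonov) simp
  have "tikhonov_form N x \<alpha> M r r = tikhonov_form N x \<alpha> M a a + 2 * (- 1) * tikhonov_form N x \<alpha> M a g
      + (- 1)\<^sup>2 * tikhonov_form N x \<alpha> M g g"
    unfolding r_def by (rule psd_form_expand[OF A])
  moreover have "tikhonov_form N x \<alpha> M a g = data_functional N x M z a"
    using minimizer_normal_equation[OF o \<alpha> N, of z a] psd_formD(1)[OF A, of a g] by (simp add: g_def)
  moreover have "tikhonov_form N x \<alpha> M g g = data_functional N x M z g"
    using minimizer_normal_equation[OF o \<alpha> N, of z g] by (simp add: g_def)
  ultimately show ?thesis unfolding tikhonov_coeffs_eq by simp
qed

lemma tikhonov_eq_coeffs: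
  assumes "\<And>t. t \<in> {0..1} \<Longrightarrow> g t = spl M a t" "\<And>i. i \<in> {1..N} \<Longrightarrow> x i \<in> {0..1}"
  shows "tikhonov N x \<alpha> z g = tikhonov_coeffs N x \<alpha> M z a"
proof -
  have g: "ac2 0 1 g (spl1 M a) (spl2 M a)" using assms(1) by (intro ac2_cong[OF ac2_spl])
  have "(L2_norm_on {0<..<1} (second_weak_deriv 0 1 g))\<^sup>2 = energy_form M a a"
    using L2_on_integral_square_nonneg[OF ac2_L2(3)[OF g]]
    by (simp add: ac2_L2_norm_second_weak_deriv[OF g] L2_norm_on_eq[OF ac2_L2(3)[OF g]] energy_form_def power2_eq_square)
  then show ?thesis using assms by (simp add: tikhonov_def tikhonov_coeffs_def)
qed

text \<open>The given minimizer costs no more than the explicit one, so by completion of the square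
  the difference of their coefficient vectors is null. Null vectors are dealt with on I' by
  \<open>spl_null\<close>.\<close>

lemma arg_min_tikhonov:
  assumes o: "orthonormal_system (tikhonov_form N x \<alpha> M) m c" and \<alpha>: "\<alpha> > 0" and N: "N > 0" and M: "M > 0"
    and x: "\<And>i. i \<in> {1..N} \<Longrightarrow> x i \<in> {0..1}"
    and min: "is_arg_min (tikhonov N x \<alpha> z) (\<lambda>g. g \<in> spline_space M) h"
  obtains r where "tikhonov_form N x \<alpha> M r r = 0"
    "\<And>t. t \<in> {0..1} \<Longrightarrow> h t = spl M (minimizer N x M m c z) t + spl M r t"
proof -
  let ?g = "minimizer N x M m c z"
  obtain a where a: "\<And>t. t \<in> {0..1} \<Longrightarrow> h t = spl M a t"
    using spline_space_imp_spl[OF M] min unfolding is_arg_min_def by blast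
  define r where "r = (\<lambda>i. a i + (- 1) * ?g i)"
  have le: "tikhonov N x \<alpha> z h \<le> tikhonov N x \<alpha> z (spl M ?g)"
    using min spl_in_spline_space[OF M, of ?g] unfolding is_arg_min_def by force
  have "tikhonov_coeffs N x \<alpha> M z a \<le> tikhonov_coeffs N x \<alpha> M z ?g"
  proof -
    have "tikhonov N x \<alpha> z h = tikhonov_coeffs N x \<alpha> M z a" by (rule tikhonov_eq_coeffs[OF a x])
    moreover have "tikhonov N x \<alpha> z (spl M ?g) = tikhonov_coeffs N x \<alpha> M z ?g" by (intro tikhonov_eq_coeffs x refl)
    ultimately show ?thesis using le by simp
  qed
  then have "tikhonov_form N x \<alpha> M r r \<le> 0"
    using tikhonov_coeffs_minimizer[OF o \<alpha> N, of z a] by (simp add: r_def)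
  then have "tikhonov_form N x \<alpha> M r r = 0"
    using psd_formD(2)[OF psd_form_tikhonov, of \<alpha> N x M r] \<alpha> by simp
  moreover have "h t = spl M ?g t + spl M r t" if "t \<in> {0..1}" for t
    using a[OF that] spl_linear(1)[of M a "- 1" ?g t] by (simp add: r_def)
  ultimately show ?thesis using that by blast
qed

text \<open>Both bounds come from S + \<alpha> E \<le> \<beta> d^4 F2 + \<alpha> F2, where the right
  side bounds the functional at the complete spline. Dropping \<alpha> E gives the first. Dropping S
  and using d^4 \<le> \<alpha> gives E \<le> (1 + \<beta>) F2, and (a - b)^2 \<le> 2 a^2 + 2 b^2
  turns this into the factor 4 + 2 \<beta>.\<close>

lemma exact_data_error:
  assumes o: "orthonormal_system (tikhonov_form N x \<alpha> M) m c" and N: "N > 0" and M: "M > 0"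
    and x: "\<And>i. i \<in> {1..N} \<Longrightarrow> x i \<in> {0..1}" and f: "ac2 0 1 f f' v"
    and card: "\<And>j. j \<in> {1..M} \<Longrightarrow> real (card (cell_obs M N x j)) \<le> \<beta> * real N / real M" and \<beta>: "0 \<le> \<beta>"
    and s: "0 \<le> s" and \<alpha>: "\<alpha> = s + (1 / real M) ^ 4"
  defines "g \<equiv> minimizer N x M m c (\<lambda>i. f (x i))" and "F2 \<equiv> sq_integral 0 1 v"
  shows "1 / real N * (\<Sum>i=1..N. (spl M g (x i) - f (x i))\<^sup>2) \<le> F2 * s + (1 + \<beta>) * F2 * (1 / real M) ^ 4"
    and "integral {0..1} (\<lambda>t. (spl2 M g t - v t)\<^sup>2) \<le> (4 + 2 * \<beta>) * F2"
proof -
  have d: "0 < (1 / real M) ^ 4" using M by simp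
  then have \<alpha>0: "\<alpha> > 0" using s \<alpha> by linarith
  have F0: "0 \<le> F2" unfolding F2_def by (rule L2_on_integral_square_nonneg[OF ac2_L2(3)[OF f]])
  obtain a where a: "energy_form M a a \<le> F2"
    "1 / real N * (\<Sum>i=1..N. (spl M a (x i) - f (x i))\<^sup>2) \<le> \<beta> * (1 / real M) ^ 4 * F2"
    using complete_spline_error[OF f M N x card \<beta>] unfolding F2_def by blast
  let ?S = "1 / real N * (\<Sum>i=1..N. (spl M g (x i) - f (x i))\<^sup>2)" and ?E = "energy_form M g g"
  have "tikhonov_coeffs N x \<alpha> M (\<lambda>i. f (x i)) g \<le> tikhonov_coeffs N x \<alpha> M (\<lambda>i. f (x i)) a"
    using tikhonov_coeffs_minimizer[OF o \<alpha>0 N, of "\<lambda>i. f (x i)" a] psd_formD(2)[OF psd_form_tikhonov, of \<alpha> N x M] \<alpha>0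
    by (simp add: g_def)
  also have "\<dots> \<le> \<beta> * (1 / real M) ^ 4 * F2 + \<alpha> * F2"
    unfolding tikhonov_coeffs_def using a \<alpha>0 by (intro add_mono mult_left_mono) auto
  finally have tot: "?S + \<alpha> * ?E \<le> \<beta> * (1 / real M) ^ 4 * F2 + \<alpha> * F2"
    by (simp add: tikhonov_coeffs_def)
  have S0: "0 \<le> ?S" by (intro mult_nonneg_nonneg sum_nonneg) auto
  have E0: "0 \<le> ?E" by (rule psd_formD(2)[OF psd_form_energy])
  have "0 \<le> \<alpha> * ?E" using E0 \<alpha>0 by simp
  then have "?S \<le> \<beta> * (1 / real M) ^ 4 * F2 + (s + (1 / real M) ^ 4) * F2" using tot unfolding \<alpha> by linarith
  then show "?S \<le> F2 * s + (1 + \<beta>) * F2 * (1 / real M) ^ 4" by (simp only: algebra_simps)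
  have "\<beta> * F2 * (1 / real M) ^ 4 \<le> \<beta> * F2 * \<alpha>"
    using s \<beta> F0 unfolding \<alpha> by (intro mult_left_mono) auto
  then have "\<alpha> * ?E \<le> \<alpha> * ((1 + \<beta>) * F2)" using tot S0 by (simp add: algebra_simps)
  then have E: "?E \<le> (1 + \<beta>) * F2" using \<alpha>0 by simp
  have L: "L2_on {0<..<1} (spl2 M g)" "L2_on {0<..<1} v" by (rule ac2_L2(3)[OF ac2_spl] ac2_L2(3)[OF f])+
  have sq: "(\<lambda>t. (w t)\<^sup>2) integrable_on {0..1}" if "L2_on {0<..<1} w" for w
    using L2_on_mult_integrable[OF that that] by (simp add: power2_eq_square)
  have "integral {0..1} (\<lambda>t. (spl2 M g t - v t)\<^sup>2) \<le> integral {0..1} (\<lambda>t. 2 * (spl2 M g t)\<^sup>2 + 2 * (v t)\<^sup>2)"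
    using power2_sum_le[of "spl2 M g _" "- v _"] sq[OF L2_on_linear[OF L, of "- 1"]] sq L
    by (intro integral_le integrable_add integrable_on_mult_right) auto
  also have "\<dots> = 2 * ?E + 2 * F2"
    using sq L by (subst integral_add) (auto simp: energy_form_def F2_def power2_eq_square intro: integrable_on_mult_right)
  also have "\<dots> \<le> (4 + 2 * \<beta>) * F2" using E by (simp add: algebra_simps)
  finally show "integral {0..1} (\<lambda>t. (spl2 M g t - v t)\<^sup>2) \<le> (4 + 2 * \<beta>) * F2" .
qed

section \<open>Estimates on an interval covered by observation points\<close>

locale observed_interval =
  fixes M N p q :: nat and x :: "nat \<Rightarrow> real" and \<gamma> :: real
  assumes M: "M > 0" and N: "N > 0" and pq: "q \<le> M" "real q - real p \<ge> 2 * sqrt K_star"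
    and \<gamma>: "\<gamma> > 0"
    and card: "\<And>j. p < j \<Longrightarrow> j \<le> q \<Longrightarrow> \<gamma> * real N / real M \<le> real (card (cell_obs M N x j))"
begin

abbreviation "pM \<equiv> real p / real M"
abbreviation "qM \<equiv> real q / real M"

lemma p_less_q: "p < q"
proof -
  have "0 < 2 * sqrt K_star" by (simp add: K_star_def)
  then show ?thesis using pq by linarith
qed

lemma ac2_restrict:
  assumes "ac2 0 1 u u' v"
  shows "ac2 pM qM u u' v"
  using p_less_q pq M by (intro ac2_subinterval[OF assms]) (auto simp: divide_simps)

lemma L2_sample_bound:
  assumes u: "ac2 0 1 u u' v"
  shows "sq_integral pM qM u \<le> 4 / \<gamma> * (1 / real N * (\<Sum>i=1..N. (u (x i))\<^sup>2))
     + 16 * K_star\<^sup>2 * (1 / real M) ^ 4 * sq_integral 0 1 v"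
proof -
  note ur = ac2_restrict[OF u]
  let ?U = "sq_integral pM qM u" and ?D = "sq_integral pM qM u'"
  let ?S = "1 / real N * (\<Sum>i=1..N. (u (x i))\<^sup>2)"
  let ?V = "sq_integral pM qM v" and ?W = "sq_integral 0 1 v"
  define d where "d = 1 / real M"
  have d: "d > 0" using M by (simp add: d_def)
  have 1: "?U \<le> 2 / \<gamma> * ?S + 2 * d\<^sup>2 * ?D"
    unfolding d_def by (rule interval_sampling[OF ur p_less_q M N \<gamma> card])
  \<comment> \<open>The largest scale that the length of the interval is known to allow;
    \<epsilon>^2 = 4 \<open>K_star\<close> d^2.\<close>
  define \<epsilon> where "\<epsilon> = 2 * sqrt K_star * d"
  have e2: "\<epsilon>\<^sup>2 = 128 * d\<^sup>2" by (simp add: \<epsilon>_def power_mult_distrib K_star_def)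
  have "?D \<le> 24 / \<epsilon>\<^sup>2 * ?U + 8 * \<epsilon>\<^sup>2 * ?V"
  proof (rule derivative_L2_interpolation[OF ur])
    show "0 < \<epsilon>" using d by (simp add: \<epsilon>_def K_star_def)
    have "2 * sqrt K_star * d \<le> (real q - real p) * d" using pq d by (intro mult_right_mono) auto
    then show "\<epsilon> \<le> qM - pM" by (simp add: \<epsilon>_def d_def diff_divide_distrib)
  qed
  then have "2 * d\<^sup>2 * ?D \<le> 2 * d\<^sup>2 * (24 / \<epsilon>\<^sup>2 * ?U + 8 * \<epsilon>\<^sup>2 * ?V)" by (intro mult_left_mono) auto
  \<comment> \<open>The share 3/8 = 2 * 24 / 128 is below 1, so it can be absorbed; 2048 is 2 * 8 *
    128.\<close>
  also have "\<dots> = 3 / 8 * ?U + 2048 * (d ^ 4 * ?V)"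
    unfolding e2 using d by (simp add: field_simps power_def numeral_eq_Suc)
  \<comment> \<open>Absorption would leave the factors 16/5 and 16384/5; they are relaxed to 4 and
    16384 = 16 * \<open>K_star\<close>^2.\<close>
  finally have 2: "5 * ?U \<le> 16 * (1 / \<gamma> * ?S) + 16384 * (d ^ 4 * ?V)" using 1 by simp
  have "?V \<le> ?W"
    using L2_integral_subinterval_le[OF ac2_L2(3)[OF u], of pM qM] p_less_q pq M by (simp add: divide_simps)
  then have 3: "d ^ 4 * ?V \<le> d ^ 4 * ?W" using d by (intro mult_left_mono) auto
  have "0 \<le> ?V" by (rule L2_on_integral_square_nonneg[OF ac2_L2(3)[OF ur]])
  then have "0 \<le> d ^ 4 * ?V" using d by simp
  moreover have "0 \<le> 1 / \<gamma> * ?S" using \<gamma> by (intro mult_nonneg_nonneg sum_nonneg) auto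
  moreover have "U \<le> 4 * S + 16384 * W" if "5 * U \<le> 16 * S + 16384 * V" "V \<le> W" "0 \<le> V" "0 \<le> S"
    for U S V W :: real using that by linarith
  ultimately have "?U \<le> 4 * (1 / \<gamma> * ?S) + 16384 * (d ^ 4 * ?W)" using 2 3 by metis
  then show ?thesis by (simp add: K_star_def d_def)
qed

lemma deriv_ac2:
  assumes "ac2 a b u u' v" "t \<in> {a<..<b}"
  shows "(u has_real_derivative u' t) (at t)" "deriv u t = u' t"
proof -
  have "(u has_real_derivative u' t) (at t within {a..b})" using assms by (intro ac2D(3)) auto
  then have "(u has_real_derivative u' t) (at t within {a<..<b})" by (rule DERIV_subset) auto
  then show "(u has_real_derivative u' t) (at t)" using assms(2) by (subst (asm) at_within_open) auto
  then show "deriv u t = u' t" by (rule DERIV_imp_deriv)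
qed

lemma sobolev_bound:
  assumes u: "ac2 0 1 u u' v" and K: "sobolev_constant \<epsilon>0 pM qM K" and e: "0 < \<epsilon>" "\<epsilon> \<le> \<epsilon>0"
  shows "(L2_norm_on {pM<..<qM} u')\<^sup>2 \<le>
    K * (sq_integral pM qM u / \<epsilon>\<^sup>2 + \<epsilon>\<^sup>2 * sq_integral pM qM v)"
proof -
  note ur = ac2_restrict[OF u]
  have "L2_norm_on {pM<..<qM} (deriv u) = L2_norm_on {pM<..<qM} u'"
    by (rule L2_norm_on_cong) (rule deriv_ac2(2)[OF ur])
  moreover have "(L2_norm_on {pM<..<qM} w)\<^sup>2 = sq_integral pM qM w" if "L2_on {pM<..<qM} w" for w
    using L2_on_integral_square_nonneg[OF that] by (simp add: L2_norm_on_eq[OF that])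
  ultimately show ?thesis
    using K ac2_imp_W22[OF ur] e ac2_L2[OF ur] ac2_L2_norm_second_weak_deriv[OF ur]
    unfolding sobolev_constant_def by (metis (no_types, lifting) greaterThanAtMost_iff)
qed

text \<open>The definition fixes no sign. Testing with the identity, whose second derivative
  vanishes, bounds a positive number by \<open>K\<close> times a nonnegative one.\<close>

lemma sobolev_constant_pos:
  assumes K: "sobolev_constant \<epsilon>0 pM qM K" and e: "0 < \<epsilon>0"
  shows "0 < K"
proof -
  have u: "ac2 0 1 (\<lambda>t. t) (\<lambda>t. 1) (\<lambda>t. 0)" by (intro ac2_classical) (auto intro!: derivative_eq_intros)
  have pq': "pM < qM" using p_less_q M by (simp add: divide_strict_right_mono)
  have L: "L2_on {pM<..<qM} (\<lambda>t. 1)" by (intro L2_on_continuous continuous_intros)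
  have "(L2_norm_on {pM<..<qM} (\<lambda>t. 1))\<^sup>2 = qM - pM" using pq' by (simp add: L2_norm_on_eq[OF L])
  then have "0 < K * (integral {pM..qM} (\<lambda>t. t\<^sup>2) / \<epsilon>0\<^sup>2)"
    using sobolev_bound[OF u K e] pq' by simp
  moreover have "0 \<le> integral {pM..qM} (\<lambda>t. t\<^sup>2) / \<epsilon>0\<^sup>2"
    by (intro divide_nonneg_nonneg integral_nonneg integrable_continuous_interval continuous_intros) auto
  ultimately show ?thesis by (metis zero_less_mult_iff leD)
qed

text \<open>Applied twice, to the bias and to the noise; \<open>X1\<close>, \<open>X2\<close> and
  \<open>Y\<close> carry their different bounds on mean square and energy. Terms in \<open>s\<close>
  and in powers of 1/M are kept apart, so that the constants of the theorem can be read off.\<close>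

lemma error_bounds:
  assumes u: "ac2 0 1 u u' v"
    and S: "1 / real N * (\<Sum>i=1..N. (u (x i))\<^sup>2) \<le> X1 * s + X2 * (1 / real M) ^ 4"
    and V: "sq_integral 0 1 v \<le> Y" and nn: "0 \<le> X1" "0 \<le> X2" "0 \<le> Y" "0 \<le> s"
    and K: "sobolev_constant \<epsilon>0 pM qM K" and e0: "s powr (1 / 4) \<le> \<epsilon>0" "(real q - real p) / real M \<le> \<epsilon>0"
  shows "L2_norm_on {pM<..<qM} u
      \<le> sqrt (4 / \<gamma> * X1) * sqrt s + sqrt (4 / \<gamma> * X2 + 16 * K_star\<^sup>2 * Y) / (real M)\<^sup>2"
    and "L2_norm_on {pM<..<qM} u'
      \<le> sqrt K * (sqrt (4 / \<gamma> * X1 + Y) * s powr (1 / 4) + sqrt (X2 / (K_star * \<gamma>) + 8 * K_star * Y) / real M)"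
proof -
  note ur = ac2_restrict[OF u]
  let ?U = "sq_integral pM qM u" and ?V = "sq_integral pM qM v"
  define d where "d = 1 / real M"
  have d: "d > 0" using M by (simp add: d_def)
  define A B where "A = 4 / \<gamma> * X1" and "B = 4 / \<gamma> * X2 + 16 * K_star\<^sup>2 * Y"
  have AB: "0 \<le> A" "0 \<le> B" using nn \<gamma> by (auto simp: A_def B_def)
  have "4 / \<gamma> * (1 / real N * (\<Sum>i=1..N. (u (x i))\<^sup>2)) \<le> 4 / \<gamma> * (X1 * s + X2 * d ^ 4)"
    using S \<gamma> by (intro mult_left_mono) (auto simp: d_def)
  moreover have "16 * K_star\<^sup>2 * d ^ 4 * sq_integral 0 1 v \<le> 16 * K_star\<^sup>2 * d ^ 4 * Y"
    using V d by (intro mult_left_mono) auto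
  ultimately have "?U \<le> 4 / \<gamma> * (X1 * s + X2 * d ^ 4) + 16 * K_star\<^sup>2 * d ^ 4 * Y"
    using L2_sample_bound[OF u] by (simp add: d_def)
  then have U: "?U \<le> A * s + B * d ^ 4" by (simp add: A_def B_def algebra_simps)
  have "L2_norm_on {pM<..<qM} u \<le> sqrt (A * s + B * d ^ 4)"
    using U by (simp add: L2_norm_on_eq[OF ac2_L2(1)[OF ur]])
  also have "\<dots> \<le> sqrt (A * s) + sqrt (B * d ^ 4)"
    using AB nn d by (intro sqrt_add_le_add_sqrt) auto
  also have "sqrt (A * s) = sqrt A * sqrt s" by (rule real_sqrt_mult)
  also have "sqrt (B * d ^ 4) = sqrt B * d\<^sup>2"
    using d by (simp add: real_sqrt_mult) (metis power2_eq_square power4_eq_xxxx mult.assoc real_sqrt_abs2 abs_of_nonneg zero_le_power2)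
  finally show "L2_norm_on {pM<..<qM} u
      \<le> sqrt (4 / \<gamma> * X1) * sqrt s + sqrt (4 / \<gamma> * X2 + 16 * K_star\<^sup>2 * Y) / (real M)\<^sup>2"
    by (simp add: A_def B_def d_def power_divide)
  define r where "r = sqrt s"
  have r: "0 \<le> r" "r * r = s" using nn by (auto simp: r_def)
  \<comment> \<open>The maximum makes r / e2 and 4 \<open>K_star\<close> d^2 / e2 at most 1, while
    e2 itself is at most the sum. So both summands of the Sobolev inequality split into a term in
    \<open>r\<close> and one in d^2.\<close>
  define e2 where "e2 = max r (4 * K_star * d\<^sup>2)"
  have Ks: "0 < K_star" by (simp add: K_star_def)
  have e2: "0 < e2" "r \<le> e2" "4 * K_star * d\<^sup>2 \<le> e2" "e2 \<le> r + 4 * K_star * d\<^sup>2"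
  proof -
    have "0 < 4 * K_star * d\<^sup>2" using d Ks by simp
    then show "0 < e2" "r \<le> e2" "4 * K_star * d\<^sup>2 \<le> e2" "e2 \<le> r + 4 * K_star * d\<^sup>2"
      using r unfolding e2_def by (simp_all add: less_max_iff_disj)
  qed
  define \<epsilon> where "\<epsilon> = sqrt e2"
  have \<epsilon>: "0 < \<epsilon>" "\<epsilon>\<^sup>2 = e2" using e2 by (auto simp: \<epsilon>_def)
  have sr: "sqrt r = s powr (1 / 4)"
    unfolding r_def using nn by (simp add: powr_half_sqrt[symmetric] powr_powr)
  \<comment> \<open>Both candidates for \<epsilon> are admissible: the one from \<open>s\<close> by
    hypothesis, the one from d by the length of the interval.\<close>
  have "sqrt (4 * K_star * d\<^sup>2) = 2 * sqrt K_star * d" using d by (simp add: real_sqrt_mult)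
  also have "\<dots> \<le> (real q - real p) * d" using pq d by (intro mult_right_mono) auto
  finally have "\<epsilon> \<le> \<epsilon>0" using e0 sr unfolding \<epsilon>_def e2_def d_def by (auto simp: max_def)
  then have h1: "(L2_norm_on {pM<..<qM} u')\<^sup>2 \<le> K * (?U / e2 + e2 * ?V)"
    using sobolev_bound[OF u K] \<epsilon> by metis
  have K0: "0 < K" using sobolev_constant_pos[OF K] \<epsilon>(1) \<open>\<epsilon> \<le> \<epsilon>0\<close> by simp
  have h2: "?U / e2 + e2 * ?V \<le> r * (A + Y) + d\<^sup>2 * (B / (4 * K_star) + 4 * K_star * Y)"
  proof -
    have "?U / e2 \<le> (A * s + B * d ^ 4) / e2" using U e2 by (intro divide_right_mono) auto
    also have "\<dots> = A * r * (r / e2) + B * d\<^sup>2 / (4 * K_star) * (4 * K_star * d\<^sup>2 / e2)"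
      using Ks by (simp add: r(2)[symmetric] add_divide_distrib power2_eq_square power4_eq_xxxx)
    also have "\<dots> \<le> A * r * 1 + B * d\<^sup>2 / (4 * K_star) * 1"
      using e2 AB r Ks by (intro add_mono mult_left_mono) auto
    finally have 1: "?U / e2 \<le> A * r + B * d\<^sup>2 / (4 * K_star)" by simp
    have "?V \<le> sq_integral 0 1 v"
      using L2_integral_subinterval_le[OF ac2_L2(3)[OF u], of pM qM] p_less_q pq M by (simp add: divide_simps)
    then have "?V \<le> Y" using V by simp
    then have "e2 * ?V \<le> e2 * Y" using e2 by (intro mult_left_mono) auto
    also have "\<dots> \<le> (r + 4 * K_star * d\<^sup>2) * Y" using e2 nn by (intro mult_right_mono) auto
    finally show ?thesis using 1 by (simp add: algebra_simps)
  qed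
  \<comment> \<open>The energy part of \<open>B\<close> contributes another 4 \<open>K_star\<close>
    Y, which doubles the direct term.\<close>
  have h3: "B / (4 * K_star) + 4 * K_star * Y = X2 / (K_star * \<gamma>) + 8 * K_star * Y"
    using \<gamma> by (simp add: B_def K_star_def field_simps)
  have "(L2_norm_on {pM<..<qM} u')\<^sup>2 \<le> K * (r * (A + Y) + d\<^sup>2 * (X2 / (K_star * \<gamma>) + 8 * K_star * Y))"
    by (rule order_trans[OF h1 mult_left_mono[OF h2[unfolded h3] less_imp_le[OF K0]]])
  then have "L2_norm_on {pM<..<qM} u' \<le> sqrt (K * (r * (A + Y) + d\<^sup>2 * (X2 / (K_star * \<gamma>) + 8 * K_star * Y)))"
    by (rule real_le_rsqrt)
  also have "\<dots> = sqrt K * sqrt (r * (A + Y) + d\<^sup>2 * (X2 / (K_star * \<gamma>) + 8 * K_star * Y))" by (rule real_sqrt_mult)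
  also have "\<dots> \<le> sqrt K * (sqrt (r * (A + Y)) + sqrt (d\<^sup>2 * (X2 / (K_star * \<gamma>) + 8 * K_star * Y)))"
    using K0 r AB nn \<gamma> Ks
    by (intro mult_left_mono sqrt_add_le_add_sqrt) auto
  finally show "L2_norm_on {pM<..<qM} u'
      \<le> sqrt K * (sqrt (4 / \<gamma> * X1 + Y) * s powr (1 / 4) + sqrt (X2 / (K_star * \<gamma>) + 8 * K_star * Y) / real M)"
    using d by (simp add: real_sqrt_mult sr A_def d_def mult.commute)
qed

text \<open>A null spline vanishes at the observation points and has energy 0, so
  \<open>L2_sample_bound\<close> makes its norm on I' zero, and continuity gives pointwise
  vanishing. Hence all minimizers coincide on I'.\<close>

lemma spl_null:
  assumes "tikhonov_form N x \<alpha> M r r = 0" "\<alpha> > 0" "t \<in> {pM<..<qM}"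
  shows "spl M r t = 0"
proof -
  have "integral {pM..qM} (\<lambda>t. (spl M r t)\<^sup>2) \<le> 0"
    using L2_sample_bound[OF ac2_spl, of M r] tikhonov_form_null(2,3)[OF assms(1,2) N]
    by (simp add: energy_form_def power2_eq_square)
  then have "integral {pM..qM} (\<lambda>t. (spl M r t)\<^sup>2) = 0"
    using L2_on_integral_square_nonneg[OF ac2_L2(1)[OF ac2_restrict[OF ac2_spl]], of M r] by simp
  moreover have "continuous_on {pM..qM} (\<lambda>t. (spl M r t)\<^sup>2)"
    by (intro continuous_intros ac2_continuous(1)[OF ac2_restrict[OF ac2_spl]])
  ultimately show ?thesis
    using assms(3) integral_cbox_eq_0_iff[of pM qM "\<lambda>t. (spl M r t)\<^sup>2"] by simp
qed

end

section \<open>The noise part\<close>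

lemma L2_on_sum:
  assumes "finite K" "\<And>k. k \<in> K \<Longrightarrow> L2_on {a<..<b} (h k)"
  shows "L2_on {a<..<b} (\<lambda>t. \<Sum>k\<in>K. y k * h k t)"
  using assms
proof (induction K)
  case empty
  then show ?case using L2_on_continuous[of a b "\<lambda>_. 0"] by simp
next
  case (insert k K)
  then have "L2_on {a<..<b} (\<lambda>t. (\<Sum>k\<in>K. y k * h k t) + y k * h k t)" by (intro L2_on_linear) auto
  then show ?case using insert.hyps by (simp add: add.commute)
qed

text \<open>The squared norm of a combination is a quadratic form in the random coefficients with
  fixed Gram entries. Measurability of the final event rests on this.\<close>

lemma borel_measurable_L2_norm_combination:
  assumes K: "finite K" and Y: "\<And>k. k \<in> K \<Longrightarrow> Y k \<in> borel_measurable P"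
    and h: "\<And>k. k \<in> K \<Longrightarrow> L2_on {a<..<b} (h k)"
  shows "(\<lambda>\<omega>. L2_norm_on {a<..<b} (\<lambda>t. \<Sum>k\<in>K. Y k \<omega> * h k t)) \<in> borel_measurable P"
proof -
  have "L2_norm_on {a<..<b} (\<lambda>t. \<Sum>k\<in>K. Y k \<omega> * h k t)
     = sqrt (\<Sum>k\<in>K. \<Sum>l\<in>K. Y k \<omega> * Y l \<omega> * integral {a..b} (\<lambda>t. h k t * h l t))" for \<omega>
  proof -
    have i: "(\<lambda>t. h k t * h l t) integrable_on {a..b}" if "k \<in> K" "l \<in> K" for k l
      using that by (intro L2_on_mult_integrable h)
    have "integral {a..b} (\<lambda>t. (\<Sum>k\<in>K. Y k \<omega> * h k t)\<^sup>2)
       = integral {a..b} (\<lambda>t. \<Sum>k\<in>K. \<Sum>l\<in>K. (Y k \<omega> * Y l \<omega>) * (h k t * h l t))"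
      by (simp add: power2_eq_square sum_product mult_ac)
    also have "\<dots> = (\<Sum>k\<in>K. integral {a..b} (\<lambda>t. \<Sum>l\<in>K. (Y k \<omega> * Y l \<omega>) * (h k t * h l t)))"
      by (intro integral_sum K integrable_sum integrable_on_mult_right i)
    also have "\<dots> = (\<Sum>k\<in>K. \<Sum>l\<in>K. integral {a..b} (\<lambda>t. (Y k \<omega> * Y l \<omega>) * (h k t * h l t)))"
      by (intro sum.cong refl integral_sum K integrable_on_mult_right i)
    finally show ?thesis by (simp add: L2_norm_on_eq[OF L2_on_sum[OF K h]])
  qed
  moreover have "(\<lambda>\<omega>. sqrt (\<Sum>k\<in>K. \<Sum>l\<in>K. Y k \<omega> * Y l \<omega> * integral {a..b} (\<lambda>t. h k t * h l t))) \<in> borel_measurable P"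
    using Y by measurable
  ultimately show ?thesis by simp
qed

lemma spl_minimizer:
  "spl M (minimizer N x M m c z) t = (\<Sum>k<m. data_functional N x M z (c k) * spl M (c k) t)"
  "spl1 M (minimizer N x M m c z) t = (\<Sum>k<m. data_functional N x M z (c k) * spl1 M (c k) t)"
proof -
  have l: "linear_functional (\<lambda>a. spl M a t)" "linear_functional (\<lambda>a. spl1 M a t)"
    by (simp_all add: linear_functional_def spl_linear)
  show "spl M (minimizer N x M m c z) t = (\<Sum>k<m. data_functional N x M z (c k) * spl M (c k) t)"
    unfolding minimizer_def[abs_def] by (rule linear_functional_sum[OF l(1) finite_lessThan])
  show "spl1 M (minimizer N x M m c z) t = (\<Sum>k<m. data_functional N x M z (c k) * spl1 M (c k) t)"
    unfolding minimizer_def[abs_def] by (rule linear_functional_sum[OF l(2) finite_lessThan])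
qed

definition noise_energy ::
    "nat \<Rightarrow> (nat \<Rightarrow> real) \<Rightarrow> real \<Rightarrow> nat \<Rightarrow> (nat \<Rightarrow> real) \<Rightarrow> real" where
  "noise_energy N x \<alpha> M w = sample_form N x M w w + 4 * (\<alpha> * energy_form M w w)"

lemma noise_energy_nonneg: "0 \<le> \<alpha> \<Longrightarrow> 0 \<le> noise_energy N x \<alpha> M w"
  unfolding noise_energy_def using psd_formD(2)[OF psd_form_sample] psd_formD(2)[OF psd_form_energy] by simp

text \<open>By the normal equations, sample form plus \<alpha> times energy of the minimizer is the
  sum of squares of its coefficients. Weighting the energy by 4 thus gives four times that sum minus
  three times the sample form, which is a quadratic form with the Gram matrix of the system.\<close>

lemma noise_energy_minimizer:
  fixes z :: "nat \<Rightarrow> real"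
  assumes o: "orthonormal_system (tikhonov_form N x \<alpha> M) m c" and \<alpha>: "\<alpha> > 0" and N: "N > 0"
  defines "y \<equiv> \<lambda>k. data_functional N x M z (c k)"
  shows "noise_energy N x \<alpha> M (minimizer N x M m c z)
     = 4 * (\<Sum>k<m. y k * y k) - 3 * (\<Sum>k<m. \<Sum>l<m. y k * y l * sample_form N x M (c k) (c l))"
proof -
  let ?w = "minimizer N x M m c z"
  have "tikhonov_form N x \<alpha> M ?w ?w = data_functional N x M z ?w"
    by (rule minimizer_normal_equation[OF o \<alpha> N])
  also have "\<dots> = (\<Sum>k<m. y k * y k)"
    unfolding minimizer_def[abs_def] linear_functional_sum[OF linear_functional_data finite_lessThan] y_def ..
  finally have 1: "sample_form N x M ?w ?w + \<alpha> * energy_form M ?w ?w = (\<Sum>k<m. y k * y k)"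
    by (simp add: tikhonov_form_def)
  have s: "sample_form N x M a ?w = (\<Sum>k<m. y k * sample_form N x M a (c k))" for a
    unfolding minimizer_def[abs_def] linear_functional_sum[OF psd_formD(5)[OF psd_form_sample] finite_lessThan] y_def ..
  have "sample_form N x M ?w ?w = (\<Sum>k<m. y k * sample_form N x M ?w (c k))" by (rule s)
  also have "\<dots> = (\<Sum>k<m. y k * (\<Sum>l<m. y l * sample_form N x M (c k) (c l)))"
    using s psd_formD(1)[OF psd_form_sample, of N x M ?w] by simp
  also have "\<dots> = (\<Sum>k<m. \<Sum>l<m. y k * y l * sample_form N x M (c k) (c l))"
    by (simp add: sum_distrib_left mult.assoc)
  finally show ?thesis using 1 unfolding noise_energy_def by linarith
qed

text \<open>Uncorrelated noise keeps only the diagonal of the double sum; one of the two factors 1/N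
  completes the sample form.\<close>

lemma data_functional_covariance:
  fixes P :: "'w measure" and \<eta> :: "nat \<Rightarrow> 'w \<Rightarrow> real"
  assumes int: "\<And>i j. i \<in> {1..N} \<Longrightarrow> j \<in> {1..N} \<Longrightarrow> integrable P (\<lambda>\<omega>. \<eta> i \<omega> * \<eta> j \<omega>)"
    and cov: "\<And>i j. i \<in> {1..N} \<Longrightarrow> j \<in> {1..N} \<Longrightarrow>
           (\<integral>\<omega>. \<eta> i \<omega> * \<eta> j \<omega> \<partial>P) = \<sigma>\<^sup>2 * (if i = j then 1 else 0)"
  shows "integrable P (\<lambda>\<omega>. data_functional N x M (\<lambda>i. \<eta> i \<omega>) a * data_functional N x M (\<lambda>i. \<eta> i \<omega>) b)"
    and "(\<integral>\<omega>. data_functional N x M (\<lambda>i. \<eta> i \<omega>) a * data_functional N x M (\<lambda>i. \<eta> i \<omega>) b \<partial>P)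
       = \<sigma>\<^sup>2 / real N * sample_form N x M a b"
proof -
  have e: "data_functional N x M (\<lambda>i. \<eta> i \<omega>) a * data_functional N x M (\<lambda>i. \<eta> i \<omega>) b
     = (\<Sum>i=1..N. \<Sum>j=1..N. (spl M a (x i) * spl M b (x j) / (real N)\<^sup>2) * (\<eta> i \<omega> * \<eta> j \<omega>))" for \<omega>
    unfolding data_functional_def
    by (simp add: sum_product sum_divide_distrib power2_eq_square mult_ac)
  have i: "integrable P (\<lambda>\<omega>. (spl M a (x i) * spl M b (x j) / (real N)\<^sup>2) * (\<eta> i \<omega> * \<eta> j \<omega>))"
    if "i \<in> {1..N}" "j \<in> {1..N}" for i j
    using int[OF that] by (rule integrable_mult_right)
  show "integrable P (\<lambda>\<omega>. data_functional N x M (\<lambda>i. \<eta> i \<omega>) a * data_functional N x M (\<lambda>i. \<eta> i \<omega>) b)"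
    unfolding e by (intro Bochner_Integration.integrable_sum i)
  have "(\<integral>\<omega>. data_functional N x M (\<lambda>i. \<eta> i \<omega>) a * data_functional N x M (\<lambda>i. \<eta> i \<omega>) b \<partial>P)
     = (\<Sum>i=1..N. \<Sum>j=1..N. \<integral>\<omega>. (spl M a (x i) * spl M b (x j) / (real N)\<^sup>2) * (\<eta> i \<omega> * \<eta> j \<omega>) \<partial>P)"
    unfolding e by (subst Bochner_Integration.integral_sum; (intro Bochner_Integration.integrable_sum i sum.cong refl Bochner_Integration.integral_sum)?) auto
  also have "\<dots> = (\<Sum>i=1..N. \<Sum>j=1..N. if j = i then spl M a (x i) * spl M b (x j) / (real N)\<^sup>2 * \<sigma>\<^sup>2 else 0)"
    using cov by (intro sum.cong refl) (auto simp del: times_divide_eq_left)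
  also have "\<dots> = (\<Sum>i=1..N. spl M a (x i) * spl M b (x i) / (real N)\<^sup>2 * \<sigma>\<^sup>2)"
    by (intro sum.cong) auto
  also have "\<dots> = \<sigma>\<^sup>2 / real N * sample_form N x M a b"
    by (simp add: sample_form_def sum_distrib_left sum_divide_distrib power2_eq_square mult_ac)
  finally show "(\<integral>\<omega>. data_functional N x M (\<lambda>i. \<eta> i \<omega>) a * data_functional N x M (\<lambda>i. \<eta> i \<omega>) b \<partial>P)
       = \<sigma>\<^sup>2 / real N * sample_form N x M a b" .
qed

text \<open>With \<open>G\<close> the Gram matrix of the orthonormal system with respect to the sample form, the
  expectation is \<open>\<sigma>\<^sup>2 / N\<close> times \<open>4 tr G - 3 tr G\<^sup>2 \<le> \<Sum>\<^sub>k (4 G\<^sub>k\<^sub>k - 3 G\<^sub>k\<^sub>k\<^sup>2)\<close>, and each summand is at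
  most \<open>4 / 3\<close>.\<close>

lemma expected_noise_energy:
  fixes P :: "'w measure" and \<eta> :: "nat \<Rightarrow> 'w \<Rightarrow> real"
  assumes int: "\<And>i j. i \<in> {1..N} \<Longrightarrow> j \<in> {1..N} \<Longrightarrow> integrable P (\<lambda>\<omega>. \<eta> i \<omega> * \<eta> j \<omega>)"
    and cov: "\<And>i j. i \<in> {1..N} \<Longrightarrow> j \<in> {1..N} \<Longrightarrow>
           (\<integral>\<omega>. \<eta> i \<omega> * \<eta> j \<omega> \<partial>P) = \<sigma>\<^sup>2 * (if i = j then 1 else 0)"
    and o: "orthonormal_system (tikhonov_form N x \<alpha> M) m c" and m: "m \<le> M + 3"
    and \<alpha>: "\<alpha> > 0" and N: "N > 0" and M: "M \<ge> 3"
  defines "Q \<equiv> \<lambda>\<omega>. noise_energy N x \<alpha> M (minimizer N x M m c (\<lambda>i. \<eta> i \<omega>))"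
  shows "integrable P Q" "(\<integral>\<omega>. Q \<omega> \<partial>P) \<le> 4 * (real M * \<sigma>\<^sup>2 / real N)"
proof -
  define y where "y \<omega> k = data_functional N x M (\<lambda>i. \<eta> i \<omega>) (c k)" for \<omega> k
  define G where "G k l = sample_form N x M (c k) (c l)" for k l
  have Q: "Q \<omega> = 4 * (\<Sum>k<m. y \<omega> k * y \<omega> k) - 3 * (\<Sum>k<m. \<Sum>l<m. G k l * (y \<omega> k * y \<omega> l))" for \<omega>
    using noise_energy_minimizer[OF o \<alpha> N, of "\<lambda>i. \<eta> i \<omega>"] unfolding Q_def y_def G_def by (simp add: mult_ac)
  have yi: "integrable P (\<lambda>\<omega>. y \<omega> k * y \<omega> l)" for k l
    unfolding y_def by (rule data_functional_covariance(1)[OF int cov])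
  have yc: "(\<integral>\<omega>. y \<omega> k * y \<omega> l \<partial>P) = \<sigma>\<^sup>2 / real N * G k l" for k l
    unfolding y_def G_def by (rule data_functional_covariance(2)[OF int cov])
  have i1: "integrable P (\<lambda>\<omega>. \<Sum>k<m. y \<omega> k * y \<omega> k)" by (intro Bochner_Integration.integrable_sum yi)
  have i2: "integrable P (\<lambda>\<omega>. \<Sum>k<m. \<Sum>l<m. G k l * (y \<omega> k * y \<omega> l))"
    by (intro Bochner_Integration.integrable_sum integrable_mult_right yi)
  show "integrable P Q" unfolding Q
    by (intro Bochner_Integration.integrable_diff integrable_mult_right i1 i2)
  have e1: "(\<integral>\<omega>. (\<Sum>k<m. y \<omega> k * y \<omega> k) \<partial>P) = (\<Sum>k<m. \<sigma>\<^sup>2 / real N * G k k)"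
    by (subst Bochner_Integration.integral_sum) (auto simp: yi yc)
  have "(\<integral>\<omega>. (\<Sum>k<m. \<Sum>l<m. G k l * (y \<omega> k * y \<omega> l)) \<partial>P) = (\<Sum>k<m. \<integral>\<omega>. (\<Sum>l<m. G k l * (y \<omega> k * y \<omega> l)) \<partial>P)"
    by (intro Bochner_Integration.integral_sum Bochner_Integration.integrable_sum integrable_mult_right yi)
  also have "\<dots> = (\<Sum>k<m. \<Sum>l<m. \<integral>\<omega>. G k l * (y \<omega> k * y \<omega> l) \<partial>P)"
    by (intro sum.cong refl Bochner_Integration.integral_sum integrable_mult_right yi)
  also have "\<dots> = (\<Sum>k<m. \<Sum>l<m. \<sigma>\<^sup>2 / real N * (G k l)\<^sup>2)"
    by (simp add: yc power2_eq_square mult_ac)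
  finally have e2: "(\<integral>\<omega>. (\<Sum>k<m. \<Sum>l<m. G k l * (y \<omega> k * y \<omega> l)) \<partial>P) = (\<Sum>k<m. \<Sum>l<m. \<sigma>\<^sup>2 / real N * (G k l)\<^sup>2)" .
  have "(\<integral>\<omega>. Q \<omega> \<partial>P) = 4 * (\<integral>\<omega>. (\<Sum>k<m. y \<omega> k * y \<omega> k) \<partial>P) - 3 * (\<integral>\<omega>. (\<Sum>k<m. \<Sum>l<m. G k l * (y \<omega> k * y \<omega> l)) \<partial>P)"
    unfolding Q using i1 i2
    by (subst Bochner_Integration.integral_diff) (auto intro: integrable_mult_right)
  also have "\<dots> \<le> 4 * (\<Sum>k<m. \<sigma>\<^sup>2 / real N * G k k) - 3 * (\<Sum>k<m. \<sigma>\<^sup>2 / real N * (G k k)\<^sup>2)"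
  proof -
    \<comment> \<open>Off-diagonal squares only increase the trace of the squared Gram matrix, which
      enters with a minus sign.\<close>
    have "(\<Sum>k<m. \<sigma>\<^sup>2 / real N * (G k k)\<^sup>2) \<le> (\<Sum>k<m. \<Sum>l<m. \<sigma>\<^sup>2 / real N * (G k l)\<^sup>2)"
    proof (rule sum_mono)
      fix k assume "k \<in> {..<m}"
      then show "\<sigma>\<^sup>2 / real N * (G k k)\<^sup>2 \<le> (\<Sum>l<m. \<sigma>\<^sup>2 / real N * (G k l)\<^sup>2)"
        by (intro member_le_sum[of k "{..<m}" "\<lambda>l. \<sigma>\<^sup>2 / real N * (G k l)\<^sup>2"]) auto
    qed
    then show ?thesis unfolding e1 e2 by linarith
  qed
  also have "\<dots> = (\<Sum>k<m. \<sigma>\<^sup>2 / real N * (4 * G k k - 3 * (G k k)\<^sup>2))"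
    by (simp add: sum_distrib_left sum_subtractf[symmetric] right_diff_distrib mult_ac)
  also have "\<dots> \<le> (\<Sum>k<m. \<sigma>\<^sup>2 / real N * (4 / 3))"
  proof (intro sum_mono mult_left_mono)
    fix k
    have "0 \<le> 3 * (G k k - 2 / 3)\<^sup>2" by simp
    then show "4 * G k k - 3 * (G k k)\<^sup>2 \<le> 4 / 3" by (simp add: power2_eq_square algebra_simps)
  qed simp
  also have "\<dots> = \<sigma>\<^sup>2 / real N * (real m * (4 / 3))" by simp
  \<comment> \<open>Since m \<le> M + 3 \<le> 2 M, the number 4 m / 3 is at most 4 M.\<close>
  also have "\<dots> \<le> \<sigma>\<^sup>2 / real N * (4 * real M)" using m M by (intro mult_left_mono) auto
  finally show "(\<integral>\<omega>. Q \<omega> \<partial>P) \<le> 4 * (real M * \<sigma>\<^sup>2 / real N)" by (simp add: mult_ac)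
qed

text \<open>For C = 0, which occurs for vanishing noise, the threshold is 0 and Markov's inequality
  would divide by it; there the nonnegative \<open>Q\<close> has expectation 0 and vanishes almost
  surely.\<close>

lemma (in prob_space) Markov_prob_le:
  assumes int: "integrable M Q" and nn: "\<And>\<omega>. 0 \<le> Q \<omega>" and E: "expectation Q \<le> C" and \<delta>: "0 < \<delta>"
  shows "prob {\<omega>\<in>space M. Q \<omega> \<le> C / \<delta>} \<ge> 1 - \<delta>"
proof (cases "C = 0")
  case True
  have "0 \<le> expectation Q" using nn by (intro integral_nonneg_AE) simp
  then have "expectation Q = 0" using E True by simp
  then have "AE \<omega> in M. Q \<omega> = 0" using integral_nonneg_eq_0_iff_AE[OF int] nn by simp
  then have "AE \<omega> in M. Q \<omega> \<le> C / \<delta>" by eventually_elim (simp add: True)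
  then have "prob {\<omega>\<in>space M. Q \<omega> \<le> C / \<delta>} = 1" using int by (intro prob_eq_1[THEN iffD2]) auto
  then show ?thesis using \<delta> by simp
next
  case False
  have "0 \<le> expectation Q" using nn by (intro integral_nonneg_AE) simp
  then have C: "C > 0" using E False by simp
  have "prob {\<omega>\<in>space M. Q \<omega> \<ge> C / \<delta>} \<le> expectation Q / (C / \<delta>)"
    using int nn C \<delta> by (intro integral_Markov_inequality_measure[where A="{}"]) auto
  also have "\<dots> \<le> C / (C / \<delta>)" using E C \<delta> by (intro divide_right_mono) auto
  finally have 1: "prob {\<omega>\<in>space M. Q \<omega> \<ge> C / \<delta>} \<le> \<delta>" using C by simp
  have "prob (space M - {\<omega>\<in>space M. Q \<omega> \<ge> C / \<delta>}) = 1 - prob {\<omega>\<in>space M. Q \<omega> \<ge> C / \<delta>}"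
    using int by (intro prob_compl) auto
  moreover have "prob (space M - {\<omega>\<in>space M. Q \<omega> \<ge> C / \<delta>}) \<le> prob {\<omega>\<in>space M. Q \<omega> \<le> C / \<delta>}"
    using int by (intro finite_measure_mono) auto
  ultimately show ?thesis using 1 by simp
qed

section \<open>The main estimate\<close>

lemma powr_minus_half: "0 < a \<Longrightarrow> a powr - (1/2) = 1 / sqrt a"
  using powr_minus_divide[of a "1/2"] by (simp add: powr_half_sqrt)

text \<open>Here and in the three splitting lemmas below, a constant is the sum of its bias and
  noise parts, shaped as \<open>error_bounds\<close> delivers them: (X1, X2, Y) is (F^2, F^2 (9/8
  \<beta> + 1), F^2 (9/4 \<beta> + 4)) for the bias and (4/\<delta>, 0, 1/\<delta>) for the
  noise.\<close>

lemma C1_const_split: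
  assumes "\<gamma> > 0" "\<delta> > 0" "0 \<le> F"
  shows "C1_const \<gamma> \<delta> F = sqrt (4 / \<gamma> * F\<^sup>2) + sqrt (4 / \<gamma> * (4 / \<delta>))"
proof -
  have "sqrt (4 / \<gamma> * F\<^sup>2) = 2 * \<gamma> powr (-1/2) * F"
    using assms by (simp add: powr_minus_half real_sqrt_mult real_sqrt_divide)
  moreover have "sqrt (4 / \<gamma> * (4 / \<delta>)) = sqrt (4\<^sup>2 / (\<delta> * \<gamma>))" by (simp add: mult.commute)
  then have "sqrt (4 / \<gamma> * (4 / \<delta>)) = 4 / sqrt (\<delta> * \<gamma>)" by (simp only: real_sqrt_divide real_sqrt_abs abs_numeral)
  ultimately show ?thesis by (simp add: C1_const_def)
qed

lemma sqrt_square_factor: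
  assumes "0 \<le> F" "A = F\<^sup>2 * B"
  shows "F * sqrt B = sqrt A"
  using assms by (simp add: real_sqrt_mult)

lemma C2_const_split:
  assumes "\<gamma> > 0" "\<delta> > 0" "0 \<le> F"
  shows "C2_const \<beta> \<gamma> \<delta> F
     = sqrt (4 / \<gamma> * (F\<^sup>2 * (9 / 8 * \<beta> + 1)) + 16 * K_star\<^sup>2 * (F\<^sup>2 * (9 / 4 * \<beta> + 4)))
     + sqrt (4 / \<gamma> * 0 + 16 * K_star\<^sup>2 * (1 / \<delta>))"
proof -
  have "F * sqrt ((9 * \<beta> + 8) / (2 * \<gamma>) + 36 * K_star\<^sup>2 * \<beta> + 64 * K_star\<^sup>2)
     = sqrt (4 / \<gamma> * (F\<^sup>2 * (9 / 8 * \<beta> + 1)) + 16 * K_star\<^sup>2 * (F\<^sup>2 * (9 / 4 * \<beta> + 4)))"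
    using assms by (intro sqrt_square_factor) (simp_all add: field_simps)
  moreover have "(4 * K_star) * sqrt (1 / \<delta>) = sqrt (4 / \<gamma> * 0 + 16 * K_star\<^sup>2 * (1 / \<delta>))"
    by (intro sqrt_square_factor) (simp_all add: K_star_def)
  ultimately show ?thesis using assms by (simp add: C2_const_def powr_minus_half real_sqrt_divide)
qed

lemma C3_const_split:
  assumes "\<gamma> > 0" "\<delta> > 0" "0 \<le> F"
  shows "C3_const K \<beta> \<gamma> \<delta> F
     = sqrt K * (sqrt (4 / \<gamma> * F\<^sup>2 + F\<^sup>2 * (9 / 4 * \<beta> + 4)) + sqrt (4 / \<gamma> * (4 / \<delta>) + 1 / \<delta>))"
proof -
  have "F * sqrt (4 / \<gamma> + 9 / 4 * \<beta> + 4) = sqrt (4 / \<gamma> * F\<^sup>2 + F\<^sup>2 * (9 / 4 * \<beta> + 4))"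
    using assms by (intro sqrt_square_factor) (simp_all add: field_simps)
  moreover have "\<delta> powr (-1/2) * sqrt (16 / \<gamma> + 1) = sqrt (4 / \<gamma> * (4 / \<delta>) + 1 / \<delta>)"
    using assms by (intro sqrt_square_factor) (simp_all add: powr_minus_half power_divide field_simps)
  ultimately show ?thesis by (simp only: C3_const_def)
qed

lemma C4_const_split:
  assumes "\<gamma> > 0" "\<delta> > 0" "0 \<le> F"
  shows "C4_const K \<beta> \<gamma> \<delta> F
     = sqrt K * (sqrt (F\<^sup>2 * (9 / 8 * \<beta> + 1) / (K_star * \<gamma>) + 8 * K_star * (F\<^sup>2 * (9 / 4 * \<beta> + 4)))
       + sqrt (0 / (K_star * \<gamma>) + 8 * K_star * (1 / \<delta>)))"
proof -
  have "F * sqrt ((9 * \<beta> + 8) / (8 * K_star * \<gamma>) + 18 * K_star * \<beta> + 32 * K_star)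
     = sqrt (F\<^sup>2 * (9 / 8 * \<beta> + 1) / (K_star * \<gamma>) + 8 * K_star * (F\<^sup>2 * (9 / 4 * \<beta> + 4)))"
    using assms by (intro sqrt_square_factor) (simp_all add: K_star_def field_simps)
  moreover have "(2 * sqrt 2 * \<delta> powr (-1/2)) * sqrt K_star = sqrt (0 / (K_star * \<gamma>) + 8 * K_star * (1 / \<delta>))"
    using assms by (intro sqrt_square_factor) (simp_all add: powr_minus_half power_divide power_mult_distrib)
  ultimately show ?thesis by (simp only: C4_const_def)
qed

theorem theorem3p16:
  fixes P :: "'w measure"
    and M N p q :: nat
    and f :: "real \<Rightarrow> real"
    and x :: "nat \<Rightarrow> real"
    and \<eta> y :: "nat \<Rightarrow> 'w \<Rightarrow> real"
    and fN :: "'w \<Rightarrow> real \<Rightarrow> real"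
    and d \<sigma> \<beta> \<gamma> \<alpha> \<delta> K\<sigma> F :: real
    and I' :: "real set"
  assumes "prob_space P"
    and "M \<ge> 3" and "N \<ge> M" and "d = 1 / real M"
    and "f \<in> W22 0 1"
    and "\<And>i. i \<in> {1..N} \<Longrightarrow> x i \<in> {0..1}"
    and "\<sigma> \<ge> 0"
    and "\<And>i. i \<in> {1..N} \<Longrightarrow> \<eta> i \<in> borel_measurable P"
    and "\<And>i. i \<in> {1..N} \<Longrightarrow> integrable P (\<eta> i)"
    and "\<And>i. i \<in> {1..N} \<Longrightarrow> (\<integral>\<omega>. \<eta> i \<omega> \<partial>P) = 0"
    and "\<And>i j. i \<in> {1..N} \<Longrightarrow> j \<in> {1..N} \<Longrightarrow> integrable P (\<lambda>\<omega>. \<eta> i \<omega> * \<eta> j \<omega>)"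
    and "\<And>i j. i \<in> {1..N} \<Longrightarrow> j \<in> {1..N} \<Longrightarrow>
           (\<integral>\<omega>. \<eta> i \<omega> * \<eta> j \<omega> \<partial>P) = \<sigma>\<^sup>2 * (if i = j then 1 else 0)"
    and "\<And>i \<omega>. i \<in> {1..N} \<Longrightarrow> \<omega> \<in> space P \<Longrightarrow> y i \<omega> = f (x i) + \<eta> i \<omega>"
    and "(SUP t\<in>{0..1}. obs_density M N x t) \<le> \<beta>"
    and "p < q" and "q \<le> M" and "real q - real p \<ge> 2 * sqrt K_star"
    and "I' = {real p * d <..< real q * d}"
    and "\<alpha> = real M * \<sigma>\<^sup>2 / real N + d ^ 4"
    and "(INF t\<in>I'. obs_density M N x t) \<ge> \<gamma>" and "\<gamma> > 0"
    and "\<And>\<omega>. \<omega> \<in> space P \<Longrightarrow>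
           is_arg_min (tikhonov N x \<alpha> (\<lambda>i. y i \<omega>)) (\<lambda>g. g \<in> spline_space M) (fN \<omega>)"
    and "0 < \<delta>" and "\<delta> < 1"
    and "sobolev_constant (max (sqrt \<sigma>) ((real q - real p) * d)) (real p * d) (real q * d) K\<sigma>"
    and "F = L2_norm_on {0<..<1} (second_weak_deriv 0 1 f)"
  shows "measure P {\<omega> \<in> space P.
           L2_norm_on I' (\<lambda>t. fN \<omega> t - f t)
             \<le> C1_const \<gamma> \<delta> F * sqrt (real M * \<sigma>\<^sup>2 / real N)
                + C2_const \<beta> \<gamma> \<delta> F / (real M)\<^sup>2 \<and>
           L2_norm_on I' (deriv (\<lambda>t. fN \<omega> t - f t))
             \<le> C3_const K\<sigma> \<beta> \<gamma> \<delta> F * (real M * \<sigma>\<^sup>2 / real N) powr (1/4)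
                + C4_const K\<sigma> \<beta> \<gamma> \<delta> F / real M}
         \<ge> 1 - \<delta>"
proof -
  interpret prob_space P by fact
  have M: "M > 0" and N: "N > 0" using assms(2,3) by auto
  have d: "real p * d = real p / real M" "real q * d = real q / real M" "d ^ 4 = (1 / real M) ^ 4"
    using assms(4) by simp_all
  have I: "I' = {real p / real M<..<real q / real M}" using assms(18) d by simp
  have x: "\<And>i. i \<in> {1..N} \<Longrightarrow> x i \<in> {0..1}" by fact
  have \<gamma>: "\<gamma> > 0" by fact
  have \<delta>: "0 < \<delta>" by fact
  have card_le: "real (card (cell_obs M N x j)) \<le> \<beta> * real N / real M" if "j \<in> {1..M}" for j
    by (rule card_cell_obs_le[OF assms(14) that N])
  have "0 \<le> \<beta> * real N / real M" using card_le[of 1] M by (intro order_trans[OF of_nat_0_le_iff]) auto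
  then have \<beta>: "0 \<le> \<beta>" using M N by (simp add: zero_le_divide_iff zero_le_mult_iff)
  interpret observed_interval M N p q x \<gamma>
    using assms(20) M N \<open>q \<le> M\<close> assms(17) \<gamma> unfolding I
    by unfold_locales (auto intro!: card_cell_obs_ge)
  define s where "s = real M * \<sigma>\<^sup>2 / real N"
  have s: "0 \<le> s" by (simp add: s_def)
  have \<alpha>: "\<alpha> = s + (1 / real M) ^ 4" using assms(19) d by (simp add: s_def)
  have "0 < (1 / real M) ^ 4" using M by simp
  then have \<alpha>0: "\<alpha> > 0" using \<alpha> s by linarith
  obtain m c where m: "m \<le> M + 3" and o: "orthonormal_system (tikhonov_form N x \<alpha> M) m c"
    by (rule tikhonov_system[OF \<alpha>0])
  define v where "v = second_weak_deriv 0 1 f"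
  obtain f' where f: "ac2 0 1 f f' v" using W22_imp_ac2[OF assms(5)] by (auto simp: v_def)
  have F2: "F\<^sup>2 = sq_integral 0 1 v"
    using L2_on_integral_square_nonneg[OF ac2_L2(3)[OF f]] L2_norm_on_eq[OF ac2_L2(3)[OF f]] assms(26) by (simp add: v_def)
  have F: "0 \<le> F" using assms(26) by (simp add: L2_norm_on_def)
  let ?\<epsilon> = "max (sqrt \<sigma>) ((real q - real p) * d)"
  have K: "sobolev_constant ?\<epsilon> pM qM K\<sigma>" using assms(25) d by simp
  \<comment> \<open>N \<ge> M makes s \<le> \<sigma>^2, which is why sqrt \<sigma> appears in the
    range of the Sobolev constant.\<close>
  have \<epsilon>1: "s powr (1 / 4) \<le> ?\<epsilon>"
  proof -
    have "s \<le> \<sigma>\<^sup>2" using assms(3) N mult_right_mono[of "real M" "real N" "\<sigma>\<^sup>2"] by (simp add: s_def divide_simps mult.commute)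
    then have "s powr (1 / 4) \<le> (\<sigma>\<^sup>2) powr (1 / 4)" using s by (intro powr_mono2) auto
    also have "(\<sigma>\<^sup>2) powr (1 / 4) = sqrt \<sigma>"
      using assms(7) by (cases "\<sigma> = 0") (simp_all add: powr_half_sqrt[symmetric] powr_powr flip: powr_numeral)
    finally show ?thesis by simp
  qed
  have \<epsilon>2: "(real q - real p) / real M \<le> ?\<epsilon>" using assms(4) by simp
  define g0 where "g0 = minimizer N x M m c (\<lambda>i. f (x i))"
  define e0 where "e0 t = spl M g0 t + (- 1) * f t" for t
  have e0: "ac2 0 1 e0 (\<lambda>t. spl1 M g0 t + (- 1) * f' t) (\<lambda>t. spl2 M g0 t + (- 1) * v t)"
    unfolding e0_def by (rule ac2_linear[OF ac2_spl f])
  \<comment> \<open>Slightly larger than the factors 1 + \<beta> and 4 + 2 \<beta> of the error for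
    exact data, to fit the constants of the theorem.\<close>
  define X2 Y where "X2 = F\<^sup>2 * (9 / 8 * \<beta> + 1)" and "Y = F\<^sup>2 * (9 / 4 * \<beta> + 4)"
  have XY: "0 \<le> X2" "0 \<le> Y" using \<beta> by (auto simp: X2_def Y_def)
  note exact = exact_data_error[OF o N M x f card_le \<beta> s \<alpha>, folded g0_def F2]
  have "(1 + \<beta>) * F\<^sup>2 \<le> X2" "(4 + 2 * \<beta>) * F\<^sup>2 \<le> Y" using \<beta> by (simp_all add: X2_def Y_def mult.commute[of _ "F\<^sup>2"] mult_left_mono)
  then have "(1 + \<beta>) * F\<^sup>2 * (1 / real M) ^ 4 \<le> X2 * (1 / real M) ^ 4" by (intro mult_right_mono) auto
  then have S0: "1 / real N * (\<Sum>i=1..N. (e0 (x i))\<^sup>2) \<le> F\<^sup>2 * s + X2 * (1 / real M) ^ 4"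
    using exact(1) by (simp add: e0_def)
  have V0: "integral {0..1} (\<lambda>t. (spl2 M g0 t + (- 1) * v t)\<^sup>2) \<le> Y"
    using exact(2) \<open>(4 + 2 * \<beta>) * F\<^sup>2 \<le> Y\<close> by simp
  note bias = error_bounds[OF e0 S0 V0 zero_le_power2 XY s K \<epsilon>1 \<epsilon>2]
  define z where "z \<omega> = minimizer N x M m c (\<lambda>i. y i \<omega>)" for \<omega>
  define w where "w \<omega> = minimizer N x M m c (\<lambda>i. \<eta> i \<omega>)" for \<omega>
  have split: "spl M (z \<omega>) t - f t = e0 t + spl M (w \<omega>) t"
    "spl1 M (z \<omega>) t - f' t = (spl1 M g0 t + (- 1) * f' t) + spl1 M (w \<omega>) t" if "\<omega> \<in> space P" for \<omega> t
  proof -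
    have "data_functional N x M (\<lambda>i. y i \<omega>) b = data_functional N x M (\<lambda>i. f (x i) + \<eta> i \<omega>) b" for b
      unfolding data_functional_def using assms(13) that by (intro arg_cong[where f="\<lambda>a. 1 / real N * a"] sum.cong) auto
    then have "z \<omega> = (\<lambda>k. g0 k + 1 * w \<omega> k)"
      unfolding z_def g0_def w_def by (intro ext) (simp add: minimizer_add[symmetric], simp add: minimizer_def)
    then show "spl M (z \<omega>) t - f t = e0 t + spl M (w \<omega>) t"
      "spl1 M (z \<omega>) t - f' t = (spl1 M g0 t + (- 1) * f' t) + spl1 M (w \<omega>) t"
      by (simp_all only: spl_linear e0_def)
  qed
  \<comment> \<open>The null spline that separates the given minimizer from the explicit one
    vanishes on I'. As I' is open, the derivatives agree there as well.\<close>
  have err: "L2_norm_on I' (\<lambda>t. fN \<omega> t - f t) = L2_norm_on {pM<..<qM} (\<lambda>t. spl M (z \<omega>) t - f t)"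
    "L2_norm_on I' (deriv (\<lambda>t. fN \<omega> t - f t)) = L2_norm_on {pM<..<qM} (\<lambda>t. spl1 M (z \<omega>) t - f' t)"
    if \<omega>: "\<omega> \<in> space P" for \<omega>
  proof -
    obtain r where r: "tikhonov_form N x \<alpha> M r r = 0" "\<And>t. t \<in> {0..1} \<Longrightarrow> fN \<omega> t = spl M (z \<omega>) t + spl M r t"
      using arg_min_tikhonov[OF o \<alpha>0 N M x assms(22)[OF \<omega>]] unfolding z_def by blast
    have I01: "0 \<le> pM" "qM \<le> 1" using pq(1) M by (auto simp: divide_simps)
    then have sub: "t \<in> {0..1}" if "t \<in> {pM<..<qM}" for t
      using I01 that unfolding atLeastAtMost_iff greaterThanLessThan_iff by linarith
    have eq: "fN \<omega> t - f t = spl M (z \<omega>) t - f t" if "t \<in> {pM<..<qM}" for t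
      using r(2)[OF sub[OF that]] spl_null[OF r(1) \<alpha>0 that] by simp
    then show "L2_norm_on I' (\<lambda>t. fN \<omega> t - f t) = L2_norm_on {pM<..<qM} (\<lambda>t. spl M (z \<omega>) t - f t)"
      unfolding I by (rule L2_norm_on_cong)
    have u: "ac2 pM qM (\<lambda>t. spl M (z \<omega>) t + (- 1) * f t) (\<lambda>t. spl1 M (z \<omega>) t + (- 1) * f' t) (\<lambda>t. spl2 M (z \<omega>) t + (- 1) * v t)"
      by (rule ac2_restrict[OF ac2_linear[OF ac2_spl f]])
    have "deriv (\<lambda>t. fN \<omega> t - f t) t = spl1 M (z \<omega>) t - f' t" if t: "t \<in> {pM<..<qM}" for t
    proof -
      have "((\<lambda>t. fN \<omega> t - f t) has_real_derivative spl1 M (z \<omega>) t + (- 1) * f' t) (at t)"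
        by (rule has_field_derivative_transform_within_open[OF deriv_ac2(1)[OF u t] open_greaterThanLessThan t]) (simp add: eq)
      then show ?thesis by (simp add: DERIV_imp_deriv)
    qed
    then show "L2_norm_on I' (deriv (\<lambda>t. fN \<omega> t - f t)) = L2_norm_on {pM<..<qM} (\<lambda>t. spl1 M (z \<omega>) t - f' t)"
      unfolding I by (rule L2_norm_on_cong)
  qed
  let ?E = "{\<omega> \<in> space P.
           L2_norm_on I' (\<lambda>t. fN \<omega> t - f t)
             \<le> C1_const \<gamma> \<delta> F * sqrt (real M * \<sigma>\<^sup>2 / real N)
                + C2_const \<beta> \<gamma> \<delta> F / (real M)\<^sup>2 \<and>
           L2_norm_on I' (deriv (\<lambda>t. fN \<omega> t - f t))
             \<le> C3_const K\<sigma> \<beta> \<gamma> \<delta> F * (real M * \<sigma>\<^sup>2 / real N) powr (1/4)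
                + C4_const K\<sigma> \<beta> \<gamma> \<delta> F / real M}"
  have "(\<lambda>\<omega>. y i \<omega>) \<in> borel_measurable P" if "i \<in> {1..N}" for i
  proof -
    have "(\<lambda>\<omega>. f (x i) + \<eta> i \<omega>) \<in> borel_measurable P" using assms(8)[OF that] by measurable
    then show ?thesis using assms(13)[OF that] by (subst measurable_cong) auto
  qed
  then have ymeas: "(\<lambda>\<omega>. data_functional N x M (\<lambda>i. y i \<omega>) b) \<in> borel_measurable P" for b
    unfolding data_functional_def by (intro borel_measurable_times borel_measurable_const borel_measurable_sum) auto
  have meas: "(\<lambda>\<omega>. L2_norm_on {pM<..<qM} (\<lambda>t. (\<Sum>k<m. data_functional N x M (\<lambda>i. y i \<omega>) (c k) * h (c k) t) - h0 t)) \<in> borel_measurable P"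
    if h: "\<And>a. L2_on {pM<..<qM} (h a)" and h0: "L2_on {pM<..<qM} h0" for h h0
  proof -
    \<comment> \<open>The fixed function is appended as member \<open>m\<close> with constant
      coefficient -1, which makes the error a combination of m + 1 functions.\<close>
    define Yk where "Yk k \<omega> = (if k < m then data_functional N x M (\<lambda>i. y i \<omega>) (c k) else - 1)" for k \<omega>
    define hk where "hk k = (if k < m then h (c k) else h0)" for k
    have "(\<lambda>\<omega>. L2_norm_on {pM<..<qM} (\<lambda>t. \<Sum>k\<in>{..m}. Yk k \<omega> * hk k t)) \<in> borel_measurable P"
      using ymeas h h0 by (intro borel_measurable_L2_norm_combination) (auto simp: Yk_def hk_def)
    then show ?thesis by (simp add: lessThan_Suc_atMost[symmetric] Yk_def hk_def)
  qed
  have L2: "L2_on {pM<..<qM} (spl M a)" "L2_on {pM<..<qM} (spl1 M a)" "L2_on {pM<..<qM} f" "L2_on {pM<..<qM} f'" for a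
    using ac2_L2[OF ac2_restrict[OF ac2_spl]] ac2_L2[OF ac2_restrict[OF f]] by auto
  have m1: "(\<lambda>\<omega>. L2_norm_on {pM<..<qM} (\<lambda>t. spl M (z \<omega>) t - f t)) \<in> borel_measurable P"
    unfolding z_def spl_minimizer by (rule meas[OF L2(1,3)])
  have m2: "(\<lambda>\<omega>. L2_norm_on {pM<..<qM} (\<lambda>t. spl1 M (z \<omega>) t - f' t)) \<in> borel_measurable P"
    unfolding z_def spl_minimizer by (rule meas[OF L2(2,4)])
  have E: "?E = {\<omega> \<in> space P.
           L2_norm_on {pM<..<qM} (\<lambda>t. spl M (z \<omega>) t - f t)
             \<le> C1_const \<gamma> \<delta> F * sqrt s + C2_const \<beta> \<gamma> \<delta> F / (real M)\<^sup>2 \<and>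
           L2_norm_on {pM<..<qM} (\<lambda>t. spl1 M (z \<omega>) t - f' t)
             \<le> C3_const K\<sigma> \<beta> \<gamma> \<delta> F * s powr (1/4) + C4_const K\<sigma> \<beta> \<gamma> \<delta> F / real M}" (is "_ = ?E'")
    unfolding s_def using err by auto
  have Ev: "?E' \<in> events" using m1 m2 by measurable
  define Q where "Q \<omega> = noise_energy N x \<alpha> M (w \<omega>)" for \<omega>
  have Q: "integrable P Q" "expectation Q \<le> 4 * s"
    using expected_noise_energy[OF assms(11,12) o m \<alpha>0 N assms(2)] by (simp_all add: Q_def[abs_def] w_def s_def)
  have "0 \<le> Q \<omega>" for \<omega> using \<alpha>0 by (simp add: Q_def noise_energy_nonneg)
  then have "1 - \<delta> \<le> prob {\<omega> \<in> space P. Q \<omega> \<le> 4 * s / \<delta>}"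
    by (rule Markov_prob_le[OF Q(1) _ Q(2) \<delta>])
  also have "\<dots> \<le> prob ?E'"
  proof (rule finite_measure_mono[OF _ Ev], safe)
    fix \<omega> assume \<omega>: "\<omega> \<in> space P" and "Q \<omega> \<le> 4 * s / \<delta>"
    then have q: "sample_form N x M (w \<omega>) (w \<omega>) + 4 * (\<alpha> * energy_form M (w \<omega>) (w \<omega>)) \<le> 4 / \<delta> * s"
      by (simp add: Q_def noise_energy_def)
    have n: "0 \<le> sample_form N x M (w \<omega>) (w \<omega>)" "0 \<le> \<alpha> * energy_form M (w \<omega>) (w \<omega>)"
      using psd_formD(2)[OF psd_form_sample] psd_formD(2)[OF psd_form_energy] \<alpha>0 by simp_all
    then have "sample_form N x M (w \<omega>) (w \<omega>) \<le> 4 / \<delta> * s" using q by linarith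
    then have S1: "1 / real N * (\<Sum>i=1..N. (spl M (w \<omega>) (x i))\<^sup>2) \<le> 4 / \<delta> * s + 0 * (1 / real M) ^ 4"
      by (simp add: sample_form_def power2_eq_square)
    \<comment> \<open>Dropping the sample form from \<open>q\<close> and cancelling the weight 4
      bounds \<alpha> times the energy; s \<le> \<alpha> then removes \<alpha>.\<close>
    have "\<alpha> * energy_form M (w \<omega>) (w \<omega>) \<le> s / \<delta>" using q n by simp
    also have "\<dots> \<le> \<alpha> * (1 / \<delta>)" using \<alpha> \<delta> by (simp add: divide_right_mono)
    finally have "energy_form M (w \<omega>) (w \<omega>) \<le> 1 / \<delta>" using \<alpha>0 by (rule mult_left_le_imp_le)
    then have V1: "integral {0..1} (\<lambda>t. (spl2 M (w \<omega>) t)\<^sup>2) \<le> 1 / \<delta>"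
      by (simp add: energy_form_def power2_eq_square)
    have "0 \<le> 4 / \<delta>" "0 \<le> 1 / \<delta>" using \<delta> by simp_all
    note noise = error_bounds[OF ac2_spl S1 V1 this(1) order_refl this(2) s K \<epsilon>1 \<epsilon>2]
    have le: "L2_on {pM<..<qM} e0" "L2_on {pM<..<qM} (\<lambda>t. spl1 M g0 t + (- 1) * f' t)"
      using ac2_L2(1,2)[OF ac2_restrict[OF e0]] by auto
    have "L2_norm_on {pM<..<qM} (\<lambda>t. spl M (z \<omega>) t - f t)
        \<le> L2_norm_on {pM<..<qM} e0 + L2_norm_on {pM<..<qM} (spl M (w \<omega>))"
      unfolding split[OF \<omega>] by (rule L2_norm_on_triangle[OF le(1) L2(1)])
    then show "L2_norm_on {pM<..<qM} (\<lambda>t. spl M (z \<omega>) t - f t)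
             \<le> C1_const \<gamma> \<delta> F * sqrt s + C2_const \<beta> \<gamma> \<delta> F / (real M)\<^sup>2"
      unfolding C1_const_split[OF \<gamma> \<delta> F] C2_const_split[OF \<gamma> \<delta> F]
      using bias(1) noise(1) unfolding X2_def Y_def by (simp only: distrib_right add_divide_distrib)
    have "L2_norm_on {pM<..<qM} (\<lambda>t. spl1 M (z \<omega>) t - f' t)
        \<le> L2_norm_on {pM<..<qM} (\<lambda>t. spl1 M g0 t + (- 1) * f' t) + L2_norm_on {pM<..<qM} (spl1 M (w \<omega>))"
      unfolding split[OF \<omega>] by (rule L2_norm_on_triangle[OF le(2) L2(2)])
    then show "L2_norm_on {pM<..<qM} (\<lambda>t. spl1 M (z \<omega>) t - f' t)
             \<le> C3_const K\<sigma> \<beta> \<gamma> \<delta> F * s powr (1/4) + C4_const K\<sigma> \<beta> \<gamma> \<delta> F / real M"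
      unfolding C3_const_split[OF \<gamma> \<delta> F] C4_const_split[OF \<gamma> \<delta> F]
      using bias(2) noise(2) unfolding X2_def Y_def
      by (simp only: distrib_right distrib_left add_divide_distrib times_divide_eq_right mult.assoc)
  qed
  finally show ?thesis unfolding E .
qed

end
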